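(* Let $V$ be a vertex operator algebra, $T\ge1$ an integer, $g_1,g_2,g_3$ commuting automorphisms of $V$ with $g_k^T=1$ and $g_3=g_1g_2$, and let $M^k$ be a $g_k$-twisted $V$-module for $k=1,2,3$ satisfying the standing assumptions in the context. Let $$\pi:\mathcal V^{M^3}_{M^1M^2}\to \mathrm{Hom}_{A_{g_1g_2}(V)}\big(A_{g_1g_2,g_2}(M^1)\otimes_{A_{g_2}(V)}M^2(0),\,M^3(0)\big),\qquad \pi(I)(w_1\otimes w_2)=o_I(w_1)w_2,$$ be the linear map described in the context. If $M^3$ is irreducible, then $\pi$ is injective. In particular, $$\dim \mathcal V^{M^3}_{M^1M^2}\le\dim \mathrm{Hom}_{A_{g_1g_2}(V)}\big(A_{g_1g_2,g_2}(M^1)\otimes_{A_{g_2}(V)}M^2(0),\,M^3(0)\big).$$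
   Context: All vector spaces are over $\mathbb{C}$; $\mathbb N$ contains $0$. $V=\coprod_{n\in\mathbb Z}V_n$ is a vertex operator algebra (vacuum $\mathbf 1$, conformal vector $\omega$, $\dim V_n<\infty$, $V_n=0$ for $n\ll0$, $Y(\omega,z)=\sum L(n)z^{-n-2}$); $\mathrm{wt}\,u=n$ for $u\in V_n$. Automorphisms of $V$ satisfy $gY(u,z)g^{-1}=Y(gu,z)$ and $g\omega=\omega$. $W\{z\}$ denotes formal series with arbitrary complex powers of $z$. Powers such as $(z_2+z_0)^\alpha$ and $(1+z)^\alpha$ are expanded in nonnegative integer powers of the second variable; $\mathrm{Res}_z$ is the coefficient of $z^{-1}$; $\delta(x)=\sum_{n\in\mathbb Z}x^n$. Twisted modules. Let $g$ be an automorphism with $g^T=1$ and $V^r=\{v: gv=e^{2\pi i r/T}v\}$, $0\le r<T$. A weak $g$-twisted $V$-module is a vector space $M$ with a linear map $Y_M:V\to(\mathrm{End}\,M)\{z\}$ such that: for $u\in V^r$, $w\in M$, $Y_M(u,z)w=\sum_{n\in \frac rT+\mathbb Z}u_nwz^{-n-1}$ with $u_nw=0$ for $n\gg0$; $Y_M(\mathbf 1,z)=\mathrm{id}$; and for $u\in V^r$, $v\in V$, $$z_0^{-1}\delta\Big(\frac{z_1-z_2}{z_0}\Big)Y_M(u,z_1)Y_M(v,z_2)-z_0^{-1}\delta\Big(\frac{-z_2+z_1}{z_0}\Big)Y_M(v,z_2)Y_M(u,z_1)=z_1^{-1}\delta\Big(\frac{z_2+z_0}{z_1}\Big)\Big(\frac{z_2+z_0}{z_1}\Big)^{\frac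 rT}Y_M(Y(u,z_0)v,z_2).$$ A $g$-twisted $V$-module is a weak one with $M=\oplus_{\lambda\in\mathbb C}M_\lambda$, $M_\lambda=\{w: L(0)w=\lambda w\}$, $\dim M_\lambda<\infty$, and $M_{\lambda+n/T}=0$ for all sufficiently negative integers $n$. Standing assumptions: for $k=1,2,3$, $M^k=\oplus_{n\in\mathbb N}M^k_{h_k+n/T}$ for some $h_k\in\mathbb C$, with $L(0)$ acting as $h_k+\frac nT$ on $M^k_{h_k+n/T}$, and $M^k$ is generated by $M^k_{h_k}$. Write $M^k(\frac nT)=M^k_{h_k+n/T}$, and $\deg w=\frac nT$ for $w\in M^k(\frac nT)$. For homogeneous $u\in V$, $o_{M^k}(u)=u_{\mathrm{wt}u-1}$ acting on $M^k$ (zero if this index does not occur in $Y_{M^k}(u,z)$), extended linearly. The algebra $A_g(V)$. Put $\delta(r)=1$ if $r\equiv0\pmod T$, else $\delta(r)=0$. For homogeneous $u\in V^r$, $v\in V$ put $u\circ_g v=\mathrm{Res}_z\frac{(1+z)^{\mathrm{wt}u-1+\delta(r)+r/T}}{z^{1+\delta(r)}}Y(u,z)v$, and $u\ast_g v=\mathrm{Res}_z\frac{(1+z)^{\mathrm{wt}u}}{z}Y(u,z)v$ if $r=0$, $u\ast_g v=0$ if $r\ne0$; extend linearly in $u$. $O_g(V)$ is the span of all $u\circ_g v$ and all $(L(-1)+L(0))u$. $A_g(V)=V/O_g(V)$ is known to be an associative algebra under $\ast_g$ with identity $\mathbf 1+O_g(V)$, and $M^2(0)$ (resp. $M^3(0)$)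 is a left $A_{g_2}(V)$- (resp. $A_{g_1g_2}(V)$-) module with $u+O_g(V)$ acting as $o_{M^2}(u)$ (resp. $o_{M^3}(u)$). The bimodule. $V=\oplus_{0\le j_1,j_2<T}V^{(j_1,j_2)}$, $V^{(j_1,j_2)}=\{v: g_kv=e^{2\pi i j_k/T}v,\ k=1,2\}$. Put $\delta(j_1,j_2)=1$ if $j_2=0$; $=1$ if $j_2\ne0$ and $j_1+j_2\ge T$; $=0$ if $j_2\neq0$ and $j_1+j_2<T$. For homogeneous $u\in V^{(j_1,j_2)}$ and $w_1\in M^1$ define (and extend linearly in $u$): $$u\circ_{g_1g_2,g_2}w_1=\mathrm{Res}_z\frac{(1+z)^{\mathrm{wt}u-1+\delta(j_2)+\frac{j_2}T}}{z^{1+\delta(j_1,j_2)-\frac{j_1}T}}Y_{M^1}(u,z)w_1;$$ $$u\ast_{g_1g_2,g_2}w_1=\mathrm{Res}_z\frac{(1+z)^{\mathrm{wt}u-1+\delta(j_2)+\frac{j_2}T}}{z^{1-\frac{j_1}T}}Y_{M^1}(u,z)w_1\ \text{ if } j_1+j_2\equiv0\ (\mathrm{mod}\ T),\text{ and }0\text{ otherwise};$$ $$w_1\ast_{g_2,g_1g_2}u=e^{-\frac{j_1}T\pi i}\,\mathrm{Res}_z\frac{(1+z)^{\mathrm{wt}u-1}}{z^{1-\frac{j_1}T}}Y_{M^1}(u,z)w_1\ \text{ if } j_2=0,\text{ and }0\text{ otherwise}.$$ $O'_{g_1g_2,g_2}(M^1)$ is the span of all $u\circ_{g_1g_2,g_2}w_1$.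 $O''_{g_1g_2,g_2}(M^1)$ is the span of all $(u\ast_{g_1g_2}v)\ast_{g_1g_2,g_2}w_1-u\ast_{g_1g_2,g_2}(v\ast_{g_1g_2,g_2}w_1)$, $w_1\ast_{g_2,g_1g_2}(v\ast_{g_2}u)-(w_1\ast_{g_2,g_1g_2}v)\ast_{g_2,g_1g_2}u$, $u'\ast_{g_1g_2,g_2}w_1$ and $w_1\ast_{g_2,g_1g_2}v'$, with $u,v\in V$, $u'\in O_{g_1g_2}(V)$, $v'\in O_{g_2}(V)$, $w_1\in M^1$. $O_{g_1g_2,g_2}(M^1)=O'_{g_1g_2,g_2}(M^1)+O''_{g_1g_2,g_2}(M^1)$, and $A_{g_1g_2,g_2}(M^1)=M^1/O_{g_1g_2,g_2}(M^1)$ is an $A_{g_1g_2}(V)$-$A_{g_2}(V)$-bimodule with left action $\ast_{g_1g_2,g_2}$ and right action $\ast_{g_2,g_1g_2}$. Intertwining operators. $\mathcal V^{M^3}_{M^1M^2}$ is the space of linear maps $I(\cdot,z):M^1\to\mathrm{Hom}(M^2,M^3)\{z\}$ such that: (1) $I(w^1,z)w^2=\sum_{n\in\mathbb C}w^1_nw^2z^{-n-1}$ and, for each fixed $c\in\mathbb C$, $w^1_{c+n}w^2=0$ for $n\in\mathbb Q$, $n\gg0$; (2) for $u\in V^{(j_1,j_2)}$, $w_1\in M^1$, $w_2\in M^2$, $$z_0^{-1}\delta\Big(\frac{z_1-z_2}{z_0}\Big)\Big(\frac{z_1-z_2}{z_0}\Big)^{\frac{j_1}T}Y_{M^3}(u,z_1)I(w_1,z_2)w_2-e^{\frac{j_1}T\pi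 i}z_0^{-1}\delta\Big(\frac{-z_2+z_1}{z_0}\Big)\Big(\frac{z_2-z_1}{z_0}\Big)^{\frac{j_1}T}I(w_1,z_2)Y_{M^2}(u,z_1)w_2$$ $$=z_1^{-1}\delta\Big(\frac{z_2+z_0}{z_1}\Big)\Big(\frac{z_2+z_0}{z_1}\Big)^{\frac{j_2}T}I(Y_{M^1}(u,z_0)w_1,z_2)w_2;$$ (3) $I(L(-1)w_1,z)=\frac{d}{dz}I(w_1,z)$. For such $I$, put $I^\circ(w_1,z)=z^{h_1+h_2-h_3}I(w_1,z)$; then $I^\circ(w_1,z)=\sum_{n\in\frac1T\mathbb Z}w_1(n)z^{-n-1}$ and, for homogeneous $w_1$, $w_1(n)M^2(m)\subseteq M^3(m+\deg w_1-n-1)$. Put $o_I(w_1)=w_1(\deg w_1-1)$ for homogeneous $w_1$, extended linearly to $M^1$. In the definition of $\pi(I)$, $w_1$ denotes a class in $A_{g_1g_2,g_2}(M^1)$ and $w_2\in M^2(0)$; the map $\pi(I)$ is well defined and a homomorphism of left $A_{g_1g_2}(V)$-modules, because $o_I(w)|_{M^2(0)}=0$ for $w\in O_{g_1g_2,g_2}(M^1)$ and $o_I(u\ast_{g_1g_2,g_2}w_1)=o_{M^3}(u)o_I(w_1)$, $o_I(w_1\ast_{g_2,g_1g_2}u)=o_I(w_1)o_{M^2}(u)$ on $M^2(0)$. *)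

theory Defs
  imports
    Complex_Main
    "HOL-Library.Function_Algebras"
    "HOL-Library.Set_Algebras"
    "HOL-Library.Poly_Mapping"
begin

unbundle cardinal_syntax

section \<open>Linear algebra over the complex numbers\<close>

text \<open>
  Vector spaces are whole types with an explicit scalar multiplication, as in the locale
  \<^locale>\<open>vector_space\<close>.  Sums written with \<^const>\<open>Sum_any\<close> are sums over the (finite) support
  of the summand.
\<close>

definition fin_dim :: "(complex \<Rightarrow> 'b \<Rightarrow> 'b) \<Rightarrow> 'b::ab_group_add set \<Rightarrow> bool" where
  "fin_dim s W \<longleftrightarrow> (\<exists>B. finite B \<and> W \<subseteq> module.span s B)"

definition is_basis :: "(complex \<Rightarrow> 'b \<Rightarrow> 'b) \<Rightarrow> 'b::ab_group_add set \<Rightarrow> 'b set \<Rightarrow> bool" where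
  "is_basis s W B \<longleftrightarrow> B \<subseteq> W \<and> \<not> module.dependent s B \<and> module.span s B = W"

text \<open>
  The dimension is a cardinal, since neither of the spaces to be compared is assumed to be
  finite-dimensional.
\<close>

definition vdim :: "(complex \<Rightarrow> 'b \<Rightarrow> 'b) \<Rightarrow> 'b::ab_group_add set \<Rightarrow> 'b rel" where
  "vdim s W = |SOME B. is_basis s W B|"

text \<open>
  For a family of subspaces whose (internal) direct sum is the whole space, the component of
  \<open>x\<close> in \<open>E i\<close>.
\<close>

definition homog_part :: "('i \<Rightarrow> 'b::ab_group_add set) \<Rightarrow> 'i \<Rightarrow> 'b \<Rightarrow> 'b" where
  "homog_part E i x =
     (THE c. (\<forall>i. c i \<in> E i) \<and> finite {i. c i \<noteq> 0} \<and> Sum_any c = x) i"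

definition quot :: "'b::ab_group_add set \<Rightarrow> 'b set set" where
  "quot S = range (\<lambda>x. x +o S)"

text \<open>
  Scalar multiplication on \<open>quot S\<close>; addition is the sum of sets.  Adding \<open>S\<close> matters only for
  the scalar \<open>0\<close>.
\<close>

definition quot_scale ::
  "(complex \<Rightarrow> 'b \<Rightarrow> 'b) \<Rightarrow> 'b::ab_group_add set \<Rightarrow> complex \<Rightarrow> 'b set \<Rightarrow> 'b set" where
  "quot_scale s S c X = s c ` X + S"


section \<open>Vertex operator algebras\<close>

text \<open>
  \<open>vY V u n v\<close> is the mode \<open>u\<^sub>n v\<close>, where \<open>Y(u,z) = \<Sum>n. u\<^sub>n z\<^bsup>-n-1\<^esup>\<close>.
\<close>

record 'v voa =
  vscale :: "complex \<Rightarrow> 'v \<Rightarrow> 'v"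
  vY :: "'v \<Rightarrow> int \<Rightarrow> 'v \<Rightarrow> 'v"
  vac :: 'v
  conf :: 'v

definition Lop :: "'v voa \<Rightarrow> int \<Rightarrow> 'v \<Rightarrow> 'v" where
  "Lop V n = vY V (conf V) (n + 1)"

definition wtspace :: "'v voa \<Rightarrow> int \<Rightarrow> 'v set" where
  "wtspace V n = {v. Lop V 0 v = vscale V (of_int n) v}"

text \<open>
  Axiom \<open>jacobi\<close> is the coefficient of \<open>z\<^sub>0\<^bsup>-l-1\<^esup> z\<^sub>1\<^bsup>-m-1\<^esup> z\<^sub>2\<^bsup>-n-1\<^esup>\<close> in the Jacobi identity
  for \<open>Y\<close>.
\<close>

locale vertex_operator_algebra =
  fixes V :: "'v::ab_group_add voa"
  assumes vector_space: "vector_space (vscale V)"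
    and linear_left: "\<And>n v. Vector_Spaces.linear (vscale V) (vscale V) (\<lambda>u. vY V u n v)"
    and linear_right: "\<And>u n. Vector_Spaces.linear (vscale V) (vscale V) (vY V u n)"
    and truncation: "\<And>u v. \<exists>N. \<forall>n\<ge>N. vY V u n v = 0"
    and vacuum: "\<And>n v. vY V (vac V) n v = (if n = -1 then v else 0)"
    and creation: "\<And>u n. n \<ge> 0 \<Longrightarrow> vY V u n (vac V) = 0" "\<And>u. vY V u (-1) (vac V) = u"
    and jacobi: "\<And>u v w l m n.
        Sum_any (\<lambda>i::nat. vscale V ((-1) ^ i * (of_int l gchoose i))
            (vY V u (m + l - int i) (vY V v (n + int i) w)))
        - vscale V ((-1) powi l) (Sum_any (\<lambda>i::nat. vscale V ((-1) ^ i * (of_int l gchoose i))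
            (vY V v (n + l - int i) (vY V u (m + int i) w))))
        = Sum_any (\<lambda>i::nat. vscale V (of_int m gchoose i)
            (vY V (vY V u (l + int i) v) (m + n - int i) w))"
    and virasoro: "\<exists>c. \<forall>m n v.
        Lop V m (Lop V n v) - Lop V n (Lop V m v)
        = vscale V (of_int (m - n)) (Lop V (m + n) v)
          + (if m + n = 0 then vscale V (of_int (m ^ 3 - m) / 12 * c) v else 0)"
    and L_minus1_derivative: "\<And>u n v.
        vY V (Lop V (-1) u) n v = vscale V (- of_int n) (vY V u (n - 1) v)"
    and grading: "module.span (vscale V) (\<Union>n. wtspace V n) = UNIV"
    and finite_dim: "\<And>n. fin_dim (vscale V) (wtspace V n)"
    and bounded_below: "\<exists>N. \<forall>n\<le>N. wtspace V n = {0}"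

definition voa_automorphism :: "'v::ab_group_add voa \<Rightarrow> ('v \<Rightarrow> 'v) \<Rightarrow> bool" where
  "voa_automorphism V g \<longleftrightarrow>
     Vector_Spaces.linear (vscale V) (vscale V) g \<and> bij g \<and>
     (\<forall>u n v. g (vY V u n v) = vY V (g u) n (g v)) \<and> g (conf V) = conf V"

definition eig :: "'v voa \<Rightarrow> nat \<Rightarrow> ('v \<Rightarrow> 'v) \<Rightarrow> nat \<Rightarrow> 'v set" where
  "eig V T g r =
     {v. g v = vscale V (exp (2 * of_real pi * \<i> * of_nat r / of_nat T)) v}"


section \<open>Twisted modules\<close>

text \<open>
  \<open>mY M u n w\<close> is the coefficient \<open>u\<^sub>n w\<close> of \<open>z\<^bsup>-n-1\<^esup>\<close> in \<open>Y\<^sub>M(u,z)w\<close>, with an arbitrary complex index.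
\<close>

record ('v, 'm) vmod =
  mscale :: "complex \<Rightarrow> 'm \<Rightarrow> 'm"
  mY :: "'v \<Rightarrow> complex \<Rightarrow> 'm \<Rightarrow> 'm"

definition mL :: "'v voa \<Rightarrow> ('v, 'm) vmod \<Rightarrow> int \<Rightarrow> 'm \<Rightarrow> 'm" where
  "mL V M n = mY M (conf V) (of_int n + 1)"

definition lspace :: "'v voa \<Rightarrow> ('v, 'm) vmod \<Rightarrow> complex \<Rightarrow> 'm set" where
  "lspace V M x = {w. mL V M 0 w = mscale M x w}"

text \<open>
  Axiom \<open>jacobi\<close> is the coefficient of \<open>z\<^sub>0\<^bsup>-l-1\<^esup> z\<^sub>1\<^bsup>-m-1\<^esup> z\<^sub>2\<^bsup>-n-1\<^esup>\<close> with \<open>m = r/T + p\<close>,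
  where \<open>l\<close>, \<open>p\<close> are integers and \<open>n\<close> is complex; all coefficients with other exponents vanish on
  both sides.
\<close>

locale weak_twisted_module =
  fixes V :: "'v::ab_group_add voa" and T :: nat and g :: "'v \<Rightarrow> 'v"
    and M :: "('v, 'm::ab_group_add) vmod"
  assumes vector_space: "vector_space (mscale M)"
    and linear_left: "\<And>n w. Vector_Spaces.linear (vscale V) (mscale M) (\<lambda>u. mY M u n w)"
    and linear_right: "\<And>u n. Vector_Spaces.linear (mscale M) (mscale M) (mY M u n)"
    and exponents: "\<And>r u n w. r < T \<Longrightarrow> u \<in> eig V T g r \<Longrightarrow>
        n - of_nat r / of_nat T \<notin> \<int> \<Longrightarrow> mY M u n w = 0"
    and truncation: "\<And>r u w. r < T \<Longrightarrow> u \<in> eig V T g r \<Longrightarrow>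
        \<exists>N::int. \<forall>k\<ge>N. mY M u (of_nat r / of_nat T + of_int k) w = 0"
    and vacuum: "\<And>n w. mY M (vac V) n w = (if n = -1 then w else 0)"
    and jacobi: "\<And>r u v w l p m n. r < T \<Longrightarrow> u \<in> eig V T g r \<Longrightarrow>
        m = of_nat r / of_nat T + of_int p \<Longrightarrow>
        Sum_any (\<lambda>i::nat. mscale M ((-1) ^ i * (of_int l gchoose i))
            (mY M u (m + of_int l - of_nat i) (mY M v (n + of_nat i) w)))
        - mscale M ((-1) powi l) (Sum_any (\<lambda>i::nat. mscale M ((-1) ^ i * (of_int l gchoose i))
            (mY M v (n + of_int l - of_nat i) (mY M u (m + of_nat i) w))))
        = Sum_any (\<lambda>i::nat. mscale M (m gchoose i)
            (mY M (vY V u (l + int i) v) (m + n - of_nat i) w))"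

locale twisted_module = weak_twisted_module +
  assumes grading: "module.span (mscale M) (\<Union>x. lspace V M x) = UNIV"
    and finite_dim: "\<And>x. fin_dim (mscale M) (lspace V M x)"
    and bounded_below: "\<And>x. \<exists>N::int. \<forall>n\<le>N. lspace V M (x + of_int n / of_nat T) = {0}"

definition is_submodule :: "('v, 'm::ab_group_add) vmod \<Rightarrow> 'm set \<Rightarrow> bool" where
  "is_submodule M S \<longleftrightarrow>
     module.subspace (mscale M) S \<and> (\<forall>u n. \<forall>w\<in>S. mY M u n w \<in> S)"

definition generated_by :: "('v, 'm::ab_group_add) vmod \<Rightarrow> 'm set \<Rightarrow> bool" where
  "generated_by M S \<longleftrightarrow> \<Inter> {N. is_submodule M N \<and> S \<subseteq> N} = UNIV"

definition irreducible_module :: "('v, 'm::ab_group_add) vmod \<Rightarrow> bool" where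
  "irreducible_module M \<longleftrightarrow>
     (\<exists>w::'m. w \<noteq> 0) \<and> (\<forall>S. is_submodule M S \<longrightarrow> S = {0} \<or> S = UNIV)"

text \<open>
  \<open>mdeg V T M h n\<close> is \<open>M(n/T)\<close>, the subspace of degree \<open>n/T\<close>.
\<close>

definition mdeg :: "'v voa \<Rightarrow> nat \<Rightarrow> ('v, 'm) vmod \<Rightarrow> complex \<Rightarrow> nat \<Rightarrow> 'm set" where
  "mdeg V T M h n = lspace V M (h + of_nat n / of_nat T)"

definition standing ::
  "'v voa \<Rightarrow> nat \<Rightarrow> ('v, 'm::ab_group_add) vmod \<Rightarrow> complex \<Rightarrow> bool" where
  "standing V T M h \<longleftrightarrow>
     module.span (mscale M) (\<Union>n. mdeg V T M h n) = UNIV \<and> generated_by M (mdeg V T M h 0)"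

definition o_mod :: "'v::ab_group_add voa \<Rightarrow> ('v, 'm::ab_group_add) vmod \<Rightarrow> 'v \<Rightarrow> 'm \<Rightarrow> 'm" where
  "o_mod V M u w =
     Sum_any (\<lambda>n::int. mY M (homog_part (wtspace V) n u) (of_int n - 1) w)"


section \<open>The algebra \<open>A\<^sub>g(V)\<close>\<close>

definition delta1 :: "nat \<Rightarrow> nat" where
  "delta1 r = (if r = 0 then 1 else 0)"

text \<open>\<open>Res\<^sub>z (1+z)\<^sup>a z\<^bsup>-k\<^esup> Y(u,z)v\<close>\<close>

definition vres :: "'v::ab_group_add voa \<Rightarrow> complex \<Rightarrow> int \<Rightarrow> 'v \<Rightarrow> 'v \<Rightarrow> 'v" where
  "vres V a k u v = Sum_any (\<lambda>i::nat. vscale V (a gchoose i) (vY V u (int i - k) v))"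

definition grade1 ::
  "'v::ab_group_add voa \<Rightarrow> nat \<Rightarrow> ('v \<Rightarrow> 'v) \<Rightarrow> int \<times> nat \<Rightarrow> 'v set" where
  "grade1 V T g = (\<lambda>(n, r). if r < T then wtspace V n \<inter> eig V T g r else {0})"

definition circ_g ::
  "'v::ab_group_add voa \<Rightarrow> nat \<Rightarrow> ('v \<Rightarrow> 'v) \<Rightarrow> 'v \<Rightarrow> 'v \<Rightarrow> 'v" where
  "circ_g V T g u v = Sum_any (\<lambda>(n, r).
     vres V (of_int n - 1 + of_nat (delta1 r) + of_nat r / of_nat T) (1 + int (delta1 r))
       (homog_part (grade1 V T g) (n, r) u) v)"

definition star_g ::
  "'v::ab_group_add voa \<Rightarrow> nat \<Rightarrow> ('v \<Rightarrow> 'v) \<Rightarrow> 'v \<Rightarrow> 'v \<Rightarrow> 'v" where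
  "star_g V T g u v = Sum_any (\<lambda>(n, r).
     if r = 0 then vres V (of_int n) 1 (homog_part (grade1 V T g) (n, r) u) v else 0)"

definition O_g :: "'v::ab_group_add voa \<Rightarrow> nat \<Rightarrow> ('v \<Rightarrow> 'v) \<Rightarrow> 'v set" where
  "O_g V T g = module.span (vscale V)
     ({circ_g V T g u v | u v. True} \<union> {Lop V (-1) u + Lop V 0 u | u. True})"

definition A_g :: "'v::ab_group_add voa \<Rightarrow> nat \<Rightarrow> ('v \<Rightarrow> 'v) \<Rightarrow> 'v set set" where
  "A_g V T g = quot (O_g V T g)"


section \<open>The bimodule \<open>A\<^bsub>g\<^sub>1g\<^sub>2,g\<^sub>2\<^esub>(M\<^sup>1)\<close>\<close>

definition delta2 :: "nat \<Rightarrow> nat \<Rightarrow> nat \<Rightarrow> nat" where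
  "delta2 T j1 j2 = (if j2 = 0 then 1 else if j1 + j2 \<ge> T then 1 else 0)"

definition eig2 ::
  "'v voa \<Rightarrow> nat \<Rightarrow> ('v \<Rightarrow> 'v) \<Rightarrow> ('v \<Rightarrow> 'v) \<Rightarrow> nat \<Rightarrow> nat \<Rightarrow> 'v set" where
  "eig2 V T g1 g2 j1 j2 = eig V T g1 j1 \<inter> eig V T g2 j2"

definition grade2 ::
  "'v::ab_group_add voa \<Rightarrow> nat \<Rightarrow> ('v \<Rightarrow> 'v) \<Rightarrow> ('v \<Rightarrow> 'v) \<Rightarrow> int \<times> nat \<times> nat \<Rightarrow> 'v set" where
  "grade2 V T g1 g2 = (\<lambda>(n, j1, j2).
     if j1 < T \<and> j2 < T then wtspace V n \<inter> eig2 V T g1 g2 j1 j2 else {0})"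

text \<open>\<open>Res\<^sub>z (1+z)\<^sup>a z\<^bsup>-b\<^esup> Y\<^sub>M(u,z)w\<close>\<close>

definition mres ::
  "('v, 'm::ab_group_add) vmod \<Rightarrow> complex \<Rightarrow> complex \<Rightarrow> 'v \<Rightarrow> 'm \<Rightarrow> 'm" where
  "mres M a b u w = Sum_any (\<lambda>i::nat. mscale M (a gchoose i) (mY M u (of_nat i - b) w))"

definition circ_b ::
  "'v::ab_group_add voa \<Rightarrow> nat \<Rightarrow> ('v \<Rightarrow> 'v) \<Rightarrow> ('v \<Rightarrow> 'v) \<Rightarrow> ('v, 'm::ab_group_add) vmod
    \<Rightarrow> 'v \<Rightarrow> 'm \<Rightarrow> 'm" where
  "circ_b V T g1 g2 M u w = Sum_any (\<lambda>(n, j1, j2).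
     mres M (of_int n - 1 + of_nat (delta1 j2) + of_nat j2 / of_nat T)
       (1 + of_nat (delta2 T j1 j2) - of_nat j1 / of_nat T)
       (homog_part (grade2 V T g1 g2) (n, j1, j2) u) w)"

definition star_left ::
  "'v::ab_group_add voa \<Rightarrow> nat \<Rightarrow> ('v \<Rightarrow> 'v) \<Rightarrow> ('v \<Rightarrow> 'v) \<Rightarrow> ('v, 'm::ab_group_add) vmod
    \<Rightarrow> 'v \<Rightarrow> 'm \<Rightarrow> 'm" where
  "star_left V T g1 g2 M u w = Sum_any (\<lambda>(n, j1, j2).
     if (j1 + j2) mod T = 0
     then mres M (of_int n - 1 + of_nat (delta1 j2) + of_nat j2 / of_nat T)
            (1 - of_nat j1 / of_nat T) (homog_part (grade2 V T g1 g2) (n, j1, j2) u) w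
     else 0)"

definition star_right ::
  "'v::ab_group_add voa \<Rightarrow> nat \<Rightarrow> ('v \<Rightarrow> 'v) \<Rightarrow> ('v \<Rightarrow> 'v) \<Rightarrow> ('v, 'm::ab_group_add) vmod
    \<Rightarrow> 'm \<Rightarrow> 'v \<Rightarrow> 'm" where
  "star_right V T g1 g2 M w u = Sum_any (\<lambda>(n, j1, j2).
     if j2 = 0
     then mscale M (exp (- (of_nat j1 / of_nat T) * of_real pi * \<i>))
            (mres M (of_int n - 1) (1 - of_nat j1 / of_nat T)
              (homog_part (grade2 V T g1 g2) (n, j1, j2) u) w)
     else 0)"

definition O_b' ::
  "'v::ab_group_add voa \<Rightarrow> nat \<Rightarrow> ('v \<Rightarrow> 'v) \<Rightarrow> ('v \<Rightarrow> 'v) \<Rightarrow> ('v, 'm::ab_group_add) vmod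
    \<Rightarrow> 'm set" where
  "O_b' V T g1 g2 M = module.span (mscale M) {circ_b V T g1 g2 M u w | u w. True}"

definition O_b'' ::
  "'v::ab_group_add voa \<Rightarrow> nat \<Rightarrow> ('v \<Rightarrow> 'v) \<Rightarrow> ('v \<Rightarrow> 'v) \<Rightarrow> ('v, 'm::ab_group_add) vmod
    \<Rightarrow> 'm set" where
  "O_b'' V T g1 g2 M =
    (let lact = star_left V T g1 g2 M; ract = star_right V T g1 g2 M in
     module.span (mscale M)
      ({lact (star_g V T (g1 \<circ> g2) u v) w - lact u (lact v w) | u v w. True}
       \<union> {ract w (star_g V T g2 v u) - ract (ract w v) u | u v w. True}
       \<union> {lact u' w | u' w. u' \<in> O_g V T (g1 \<circ> g2)}
       \<union> {ract w v' | w v'. v' \<in> O_g V T g2}))"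

definition O_b ::
  "'v::ab_group_add voa \<Rightarrow> nat \<Rightarrow> ('v \<Rightarrow> 'v) \<Rightarrow> ('v \<Rightarrow> 'v) \<Rightarrow> ('v, 'm::ab_group_add) vmod
    \<Rightarrow> 'm set" where
  "O_b V T g1 g2 M = O_b' V T g1 g2 M + O_b'' V T g1 g2 M"

definition A_b ::
  "'v::ab_group_add voa \<Rightarrow> nat \<Rightarrow> ('v \<Rightarrow> 'v) \<Rightarrow> ('v \<Rightarrow> 'v) \<Rightarrow> ('v, 'm::ab_group_add) vmod
    \<Rightarrow> 'm set set" where
  "A_b V T g1 g2 M = quot (O_b V T g1 g2 M)"

definition cls_b ::
  "'v::ab_group_add voa \<Rightarrow> nat \<Rightarrow> ('v \<Rightarrow> 'v) \<Rightarrow> ('v \<Rightarrow> 'v) \<Rightarrow> ('v, 'm::ab_group_add) vmod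
    \<Rightarrow> 'm \<Rightarrow> 'm set" where
  "cls_b V T g1 g2 M w = w +o O_b V T g1 g2 M"


section \<open>The tensor product over \<open>A\<^bsub>g\<^sub>2\<^esub>(V)\<close>\<close>

definition free_scale :: "complex \<Rightarrow> ('i \<Rightarrow>\<^sub>0 complex) \<Rightarrow> ('i \<Rightarrow>\<^sub>0 complex)" where
  "free_scale c p = Poly_Mapping.map ((*) c) p"

text \<open>
  The tensor product is the quotient of the free complex vector space on
  \<open>A\<^bsub>g\<^sub>1g\<^sub>2,g\<^sub>2\<^esub>(M\<^sup>1) \<times> M\<^sup>2(0)\<close> by the bilinearity relations and the relations \<open>(x a, m) - (x, a m)\<close>
  for \<open>a\<close> in \<open>A\<^bsub>g\<^sub>2\<^esub>(V)\<close>.  The action of a class \<open>a\<close> is the one induced by its representatives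
  \<open>u \<in> a\<close>: the class of \<open>w\<close> times \<open>a\<close> is the class of \<open>star_right w u\<close>, and \<open>a m = o(u) m\<close>.
\<close>

definition tensor_relators ::
  "'v::ab_group_add voa \<Rightarrow> nat \<Rightarrow> ('v \<Rightarrow> 'v) \<Rightarrow> ('v \<Rightarrow> 'v) \<Rightarrow> ('v, 'a::ab_group_add) vmod
    \<Rightarrow> ('v, 'b::ab_group_add) vmod \<Rightarrow> complex \<Rightarrow> (('a set \<times> 'b) \<Rightarrow>\<^sub>0 complex) set" where
  "tensor_relators V T g1 g2 M1 M2 h2 =
    (let A = A_b V T g1 g2 M1; B = mdeg V T M2 h2 0;
         e = (\<lambda>x m. Poly_Mapping.single (x, m) (1::complex));
         sA = quot_scale (mscale M1) (O_b V T g1 g2 M1);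
         cl = cls_b V T g1 g2 M1
     in {e (x + x') m - e x m - e x' m | x x' m. x \<in> A \<and> x' \<in> A \<and> m \<in> B}
      \<union> {e x (m + m') - e x m - e x m' | x m m'. x \<in> A \<and> m \<in> B \<and> m' \<in> B}
      \<union> {e (sA c x) m - free_scale c (e x m) | c x m. x \<in> A \<and> m \<in> B}
      \<union> {e x (mscale M2 c m) - free_scale c (e x m) | c x m. x \<in> A \<and> m \<in> B}
      \<union> {e (cl (star_right V T g1 g2 M1 w u)) m - e (cl w) (o_mod V M2 u m) | a u w m.
           a \<in> A_g V T g2 \<and> u \<in> a \<and> m \<in> B})"

definition tensor_null ::
  "'v::ab_group_add voa \<Rightarrow> nat \<Rightarrow> ('v \<Rightarrow> 'v) \<Rightarrow> ('v \<Rightarrow> 'v) \<Rightarrow> ('v, 'a::ab_group_add) vmod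
    \<Rightarrow> ('v, 'b::ab_group_add) vmod \<Rightarrow> complex \<Rightarrow> (('a set \<times> 'b) \<Rightarrow>\<^sub>0 complex) set" where
  "tensor_null V T g1 g2 M1 M2 h2 =
     module.span free_scale (tensor_relators V T g1 g2 M1 M2 h2)"

definition tensor_space ::
  "'v::ab_group_add voa \<Rightarrow> nat \<Rightarrow> ('v \<Rightarrow> 'v) \<Rightarrow> ('v \<Rightarrow> 'v) \<Rightarrow> ('v, 'a::ab_group_add) vmod
    \<Rightarrow> ('v, 'b::ab_group_add) vmod \<Rightarrow> complex \<Rightarrow> (('a set \<times> 'b) \<Rightarrow>\<^sub>0 complex) set set" where
  "tensor_space V T g1 g2 M1 M2 h2 =
     (\<lambda>p. p +o tensor_null V T g1 g2 M1 M2 h2) `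
       {p. Poly_Mapping.keys p \<subseteq> A_b V T g1 g2 M1 \<times> mdeg V T M2 h2 0}"

definition pure_tensor ::
  "'v::ab_group_add voa \<Rightarrow> nat \<Rightarrow> ('v \<Rightarrow> 'v) \<Rightarrow> ('v \<Rightarrow> 'v) \<Rightarrow> ('v, 'a::ab_group_add) vmod
    \<Rightarrow> ('v, 'b::ab_group_add) vmod \<Rightarrow> complex \<Rightarrow> 'a set \<Rightarrow> 'b
    \<Rightarrow> (('a set \<times> 'b) \<Rightarrow>\<^sub>0 complex) set" where
  "pure_tensor V T g1 g2 M1 M2 h2 x m =
     Poly_Mapping.single (x, m) 1 +o tensor_null V T g1 g2 M1 M2 h2"

definition fun_scale :: "(complex \<Rightarrow> 'c \<Rightarrow> 'c) \<Rightarrow> complex \<Rightarrow> ('x \<Rightarrow> 'c) \<Rightarrow> ('x \<Rightarrow> 'c)" where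
  "fun_scale s c f = (\<lambda>x. s c (f x))"

text \<open>
  Homomorphisms of left \<open>A\<^bsub>g\<^sub>1g\<^sub>2\<^esub>(V)\<close>-modules into \<open>M\<^sup>3(0)\<close>, extended by zero outside the tensor
  product so that they form a subspace of a function type.  The module structure on the tensor
  product is \<open>a (x \<otimes> m) = (a x) \<otimes> m\<close>, where the class of \<open>u\<close> sends the class of \<open>w\<close> to the class of
  \<open>star_left u w\<close>; on \<open>M\<^sup>3(0)\<close> it acts by \<open>o(u)\<close>.
\<close>

definition tensor_hom ::
  "'v::ab_group_add voa \<Rightarrow> nat \<Rightarrow> ('v \<Rightarrow> 'v) \<Rightarrow> ('v \<Rightarrow> 'v) \<Rightarrow> ('v, 'a::ab_group_add) vmod
    \<Rightarrow> ('v, 'b::ab_group_add) vmod \<Rightarrow> ('v, 'c::ab_group_add) vmod \<Rightarrow> complex \<Rightarrow> complex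
    \<Rightarrow> ((('a set \<times> 'b) \<Rightarrow>\<^sub>0 complex) set \<Rightarrow> 'c) set" where
  "tensor_hom V T g1 g2 M1 M2 M3 h2 h3 =
    (let X = tensor_space V T g1 g2 M1 M2 h2;
         sX = quot_scale free_scale (tensor_null V T g1 g2 M1 M2 h2);
         tens = pure_tensor V T g1 g2 M1 M2 h2;
         cl = cls_b V T g1 g2 M1
     in {f. (\<forall>t. t \<notin> X \<longrightarrow> f t = 0) \<and>
            (\<forall>t\<in>X. f t \<in> mdeg V T M3 h3 0) \<and>
            (\<forall>t\<in>X. \<forall>t'\<in>X. f (t + t') = f t + f t') \<and>
            (\<forall>c. \<forall>t\<in>X. f (sX c t) = mscale M3 c (f t)) \<and>
            (\<forall>a\<in>A_g V T (g1 \<circ> g2). \<forall>u\<in>a. \<forall>w. \<forall>m\<in>mdeg V T M2 h2 0.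
               f (tens (cl (star_left V T g1 g2 M1 u w)) m) = o_mod V M3 u (f (tens (cl w) m)))})"


section \<open>Intertwining operators\<close>

text \<open>
  \<open>I w n\<close> is the coefficient of \<open>z\<^bsup>-n-1\<^esup>\<close> in \<open>I(w,z)\<close>.  The Jacobi identity is again given by the
  coefficients of \<open>z\<^sub>0\<^bsup>-l-1\<^esup> z\<^sub>1\<^bsup>-m-1\<^esup> z\<^sub>2\<^bsup>-n-1\<^esup>\<close>, \<open>l = j\<^sub>1/T + k\<close>, \<open>m = j\<^sub>2/T + p\<close> with integers
  \<open>k\<close>, \<open>p\<close> and complex \<open>n\<close>, all others being zero on both sides.  In the second term
  \<open>(-z\<^sub>2 + z\<^sub>1)\<^sup>k (z\<^sub>2 - z\<^sub>1)\<^bsup>j\<^sub>1/T\<^esup> = (-1)\<^sup>k (z\<^sub>2 - z\<^sub>1)\<^sup>l\<close>.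
\<close>

definition intertwiners ::
  "'v::ab_group_add voa \<Rightarrow> nat \<Rightarrow> ('v \<Rightarrow> 'v) \<Rightarrow> ('v \<Rightarrow> 'v) \<Rightarrow> ('v, 'a::ab_group_add) vmod
    \<Rightarrow> ('v, 'b::ab_group_add) vmod \<Rightarrow> ('v, 'c::ab_group_add) vmod
    \<Rightarrow> ('a \<Rightarrow> complex \<Rightarrow> 'b \<Rightarrow> 'c) set" where
  "intertwiners V T g1 g2 M1 M2 M3 = {I.
     (\<forall>n w2. Vector_Spaces.linear (mscale M1) (mscale M3) (\<lambda>w1. I w1 n w2)) \<and>
     (\<forall>w1 n. Vector_Spaces.linear (mscale M2) (mscale M3) (I w1 n)) \<and>
     (\<forall>w1 w2 c. \<exists>N::rat. \<forall>q\<ge>N. I w1 (c + of_rat q) w2 = 0) \<and>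
     (\<forall>j1<T. \<forall>j2<T. \<forall>u\<in>eig2 V T g1 g2 j1 j2. \<forall>w1 w2. \<forall>(k::int) (p::int) (n::complex).
        let l = of_nat j1 / of_nat T + of_int k; m = of_nat j2 / of_nat T + of_int p in
        Sum_any (\<lambda>i::nat. mscale M3 ((-1) ^ i * (l gchoose i))
            (mY M3 u (m + l - of_nat i) (I w1 (n + of_nat i) w2)))
        - mscale M3 (exp (of_nat j1 / of_nat T * of_real pi * \<i>) * (-1) powi k)
            (Sum_any (\<lambda>i::nat. mscale M3 ((-1) ^ i * (l gchoose i))
              (I w1 (n + l - of_nat i) (mY M2 u (m + of_nat i) w2))))
        = Sum_any (\<lambda>i::nat. mscale M3 (m gchoose i)
            (I (mY M1 u (l + of_nat i) w1) (m + n - of_nat i) w2))) \<and>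
     (\<forall>w1 n w2. I (mL V M1 (-1) w1) n w2 = mscale M3 (- n) (I w1 (n - 1) w2))}"

definition intertwiner_scale ::
  "(complex \<Rightarrow> 'c \<Rightarrow> 'c) \<Rightarrow> complex \<Rightarrow> ('a \<Rightarrow> complex \<Rightarrow> 'b \<Rightarrow> 'c) \<Rightarrow> ('a \<Rightarrow> complex \<Rightarrow> 'b \<Rightarrow> 'c)" where
  "intertwiner_scale s c I = (\<lambda>w1 n w2. s c (I w1 n w2))"

text \<open>
  \<open>w(n)\<close>, the coefficient of \<open>z\<^bsup>-n-1\<^esup>\<close> in \<open>z\<^bsup>h\<^sub>1+h\<^sub>2-h\<^sub>3\<^esup> I(w,z)\<close>.
\<close>

definition I_circ ::
  "complex \<Rightarrow> complex \<Rightarrow> complex \<Rightarrow> ('a \<Rightarrow> complex \<Rightarrow> 'b \<Rightarrow> 'c) \<Rightarrow> 'a \<Rightarrow> complex \<Rightarrow> 'b \<Rightarrow> 'c" where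
  "I_circ h1 h2 h3 I w n = I w (n + h1 + h2 - h3)"

definition o_int ::
  "'v voa \<Rightarrow> nat \<Rightarrow> ('v, 'a::ab_group_add) vmod \<Rightarrow> complex \<Rightarrow> complex \<Rightarrow> complex
    \<Rightarrow> ('a \<Rightarrow> complex \<Rightarrow> 'b \<Rightarrow> 'c::ab_group_add) \<Rightarrow> 'a \<Rightarrow> 'b \<Rightarrow> 'c" where
  "o_int V T M1 h1 h2 h3 I w m =
     Sum_any (\<lambda>n::nat. I_circ h1 h2 h3 I (homog_part (mdeg V T M1 h1) n w)
                         (of_nat n / of_nat T - 1) m)"

text \<open>
  The map \<open>\<pi>\<close>; a homomorphism on the tensor product is determined by its values on pure tensors.
\<close>

definition pi_map ::
  "'v::ab_group_add voa \<Rightarrow> nat \<Rightarrow> ('v \<Rightarrow> 'v) \<Rightarrow> ('v \<Rightarrow> 'v) \<Rightarrow> ('v, 'a::ab_group_add) vmod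
    \<Rightarrow> ('v, 'b::ab_group_add) vmod \<Rightarrow> ('v, 'c::ab_group_add) vmod
    \<Rightarrow> complex \<Rightarrow> complex \<Rightarrow> complex \<Rightarrow> ('a \<Rightarrow> complex \<Rightarrow> 'b \<Rightarrow> 'c)
    \<Rightarrow> ((('a set \<times> 'b) \<Rightarrow>\<^sub>0 complex) set \<Rightarrow> 'c)" where
  "pi_map V T g1 g2 M1 M2 M3 h1 h2 h3 I =
     (THE f. f \<in> tensor_hom V T g1 g2 M1 M2 M3 h2 h3 \<and>
        (\<forall>w1. \<forall>w2\<in>mdeg V T M2 h2 0.
           f (pure_tensor V T g1 g2 M1 M2 h2 (cls_b V T g1 g2 M1 w1) w2)
           = o_int V T M1 h1 h2 h3 I w1 w2))"

end

theory Submission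
  imports Defs
begin

text \<open>
  The coefficients of the Jacobi identity with suitable \<open>m\<close> and \<open>l\<close> express \<open>o\<^sub>I\<close> of a residue
  \<open>Res\<^sub>z (1+z)\<^sup>m z\<^sup>l Y(u,z)w\<close> through products of modes of \<open>u\<close> and \<open>w\<close>; on \<open>M\<^sup>2(0)\<close> all these products
  pass through negative degrees, except possibly the leading one.  This makes \<open>\<pi>\<close> well defined.

  For injectivity, suppose \<open>o\<^sub>I\<close> vanishes on \<open>M\<^sup>2(0)\<close>.  Taking \<open>m\<close> so large that \<open>u\<^bsub>m+i\<^esub>w\<^sub>2 = 0\<close> for
  \<open>i \<ge> 0\<close>, the Jacobi identity shows, by descending induction on \<open>n\<close>, that the span of all
  \<open>I(w\<^sub>1)\<^sub>n w\<^sub>2\<close> with \<open>w\<^sub>2 \<in> M\<^sup>2(0)\<close> is a submodule of \<open>M\<^sup>3\<close>.  It has no component of degree \<open>0\<close>, hence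
  is \<open>0\<close> by irreducibility.  The vectors of \<open>M\<^sup>2\<close> annihilated by all \<open>I(w\<^sub>1)\<^sub>n\<close> likewise form a
  submodule; it contains \<open>M\<^sup>2(0)\<close> and is therefore everything.
\<close>

section \<open>Graded vector spaces\<close>

text \<open>Every residue that occurs has the form \<open>mres M1 m (- l) u w1\<close> with l = j1/T
  + k, m = j2/T + p and u of weight a. Two numbers decide its zero mode on M2(0). One is e =
  (j1+j2)/T + k + p + 1 - a, the degree of the first vector I(w1)_n w2 to which modes of u are
  applied; the other is f = a - 1 - p - j2/T, the degree of u_m w2. If both are negative, the zero
  mode is 0. If e = 0 > f, only o(u) o_I(w1) survives; if f = 0 > e, only o_I(w1) o(u). The shifts
  \<delta>(j2), \<delta>(j1,j2) and the conditions on j1, j2 in the three operations are made to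
  realise these three cases.

  The submodule of M3 is built from M2(0) alone because only there is something known about degree
  0: a nonzero homogeneous I(w1)_n w2 of degree 0 has to be o_I(w1) w2.

  All operations are extended linearly from components in a direct sum, so the arguments rest on V
  being the direct sum of the joint eigenspaces of L(0), g1 and g2. Moreover \<open>pi_map\<close>
  is a definite description, so nothing can be said about \<pi> before a homomorphism with the right
  values is shown to exist and to be unique.\<close>

definition graded :: "(complex \<Rightarrow> 'b \<Rightarrow> 'b) \<Rightarrow> ('i \<Rightarrow> 'b::ab_group_add set) \<Rightarrow> bool" where
  "graded s E \<longleftrightarrow> (\<forall>i. module.subspace s (E i)) \<and> module.span s (\<Union>i. E i) = UNIV \<and>
     (\<forall>F c. finite F \<longrightarrow> (\<forall>i\<in>F. c i \<in> E i) \<longrightarrow> sum c F = 0 \<longrightarrow> (\<forall>i\<in>F. c i = 0))"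

lemma Sum_any_eq_sum:
  assumes "finite A" "\<And>i. i \<notin> A \<Longrightarrow> f i = 0"
  shows "Sum_any f = sum f A"
  using assms by (intro Sum_any.expand_superset) auto

lemma Sum_any_eq_single:
  assumes "\<And>i. i \<noteq> a \<Longrightarrow> f i = 0"
  shows "Sum_any f = f a"
  using Sum_any_eq_sum[of "{a}" f] assms by simp

lemma Sum_any_linear:
  assumes "Vector_Spaces.linear s1 s2 f" "finite {i. c i \<noteq> 0}"
  shows "f (Sum_any c) = Sum_any (\<lambda>i. f (c i))"
proof -
  interpret f: Vector_Spaces.linear s1 s2 f by fact
  have "Sum_any (\<lambda>i. f (c i)) = sum (\<lambda>i. f (c i)) {i. c i \<noteq> 0}"
    by (rule Sum_any_eq_sum) (auto simp: assms f.zero)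
  thus ?thesis by (simp add: Sum_any.expand_set f.sum)
qed

lemma linearI:
  assumes "vector_space s1" "vector_space s2"
    "\<And>x y. f (x + y) = f x + f y" "\<And>c x. f (s1 c x) = s2 c (f x)"
  shows "Vector_Spaces.linear s1 s2 f"
proof -
  interpret a: vector_space s1 by fact
  interpret b: vector_space s2 by fact
  show ?thesis by unfold_locales (auto simp: assms)
qed

lemma linear_apply:
  assumes "Vector_Spaces.linear s1 s2 f"
  shows "f (x + y) = f x + f y" "f (s1 c x) = s2 c (f x)" "f 0 = 0" "f (x - y) = f x - f y"
proof -
  interpret f: Vector_Spaces.linear s1 s2 f by fact
  show "f (x + y) = f x + f y" "f (s1 c x) = s2 c (f x)" "f 0 = 0" "f (x - y) = f x - f y"
    by (simp_all add: f.add f.scale f.zero f.diff)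
qed

lemma linear_spaces:
  assumes "Vector_Spaces.linear s1 s2 f"
  shows "vector_space s1" "vector_space s2"
  using assms unfolding Vector_Spaces.linear_def by auto

lemma linear_compose:
  assumes "Vector_Spaces.linear s1 s2 f" "Vector_Spaces.linear s2 s3 g"
  shows "Vector_Spaces.linear s1 s3 (\<lambda>x. g (f x))"
  by (rule linearI)
    (auto simp: linear_apply[OF assms(1)] linear_apply[OF assms(2)]
      intro: linear_spaces[OF assms(1)] linear_spaces[OF assms(2)])

lemma linear_scaled:
  assumes "Vector_Spaces.linear s1 s2 f"
  shows "Vector_Spaces.linear s1 s2 (\<lambda>x. s2 c (f x))"
proof -
  interpret b: vector_space s2 using assms by (rule linear_spaces)
  show ?thesis
    by (rule linearI)
      (use linear_spaces[OF assms] in \<open>auto simp: linear_apply[OF assms] b.scale_right_distrib mult.commute\<close>)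
qed

lemma linear_zero_map:
  assumes "vector_space s1" "vector_space s2"
  shows "Vector_Spaces.linear s1 s2 (\<lambda>x. 0)"
proof -
  interpret b: vector_space s2 by fact
  show ?thesis by (rule linearI) (use assms in auto)
qed

text \<open>The support of the summands may depend on x. This is the situation of residues:
  infinitely many modes occur, but each vector is killed by almost all of them.\<close>

lemma linear_Sum_any:
  assumes "\<And>i. Vector_Spaces.linear s1 s2 (G i)" "\<And>x. finite {i. G i x \<noteq> 0}"
    "vector_space s1" "vector_space s2"
  shows "Vector_Spaces.linear s1 s2 (\<lambda>x. Sum_any (\<lambda>i. G i x))"
proof (rule linearI)
  interpret b: vector_space s2 by fact
  show "Sum_any (\<lambda>i. G i (x + y)) = Sum_any (\<lambda>i. G i x) + Sum_any (\<lambda>i. G i y)" for x y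
    using Sum_any.distrib[OF assms(2)[of x] assms(2)[of y]] by (simp add: linear_apply(1)[OF assms(1)])
  show "Sum_any (\<lambda>i. G i (s1 c x)) = s2 c (Sum_any (\<lambda>i. G i x))" for c x
  proof -
    have "Vector_Spaces.linear s2 s2 (s2 c)"
      by (rule linearI) (auto simp: assms b.scale_right_distrib mult.commute)
    from Sum_any_linear[OF this assms(2)[of x]] show ?thesis
      by (simp add: linear_apply(2)[OF assms(1)])
  qed
qed (use assms in auto)

lemma linear_vanishes_on_span:
  assumes "Vector_Spaces.linear s1 s2 f" "\<And>x. x \<in> S \<Longrightarrow> f x = 0" "x \<in> module.span s1 S"
  shows "f x = 0"
proof -
  interpret f: Vector_Spaces.linear s1 s2 f by fact
  show ?thesis using f.eq_0_on_span[OF assms(2,3)] .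
qed

text \<open>Applying f - \<mu> b to a vanishing sum removes the b-summand and multiplies the others
  by \<mu> i - \<mu> b, so induction on the number of summands applies. The operator may change with
  the pair i, j, as joint eigenspaces of several operators require; the alternatives with {0} admit
  indices that merely pad an index type.\<close>

lemma joint_eigenspaces_independent:
  assumes vs: "vector_space s" and sub: "\<And>i. module.subspace s (E i)"
    and sep: "\<And>i j. i \<noteq> j \<Longrightarrow> E i \<subseteq> {0} \<or> E j \<subseteq> {0} \<or>
        (\<exists>f \<mu>. Vector_Spaces.linear s s f \<and> (\<forall>k. \<forall>x\<in>E k. f x = s (\<mu> k) x) \<and> \<mu> i \<noteq> \<mu> j)"
    and "finite F" "\<forall>i\<in>F. c i \<in> E i" "sum c F = 0"
  shows "\<forall>i\<in>F. c i = 0"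
  using assms(4-6)
proof (induction "card F" arbitrary: F c rule: less_induct)
  case less
  interpret vector_space s by fact
  show ?case
  proof (intro ballI, rule ccontr)
    fix a assume a: "a \<in> F" "c a \<noteq> 0"
    have "F \<noteq> {a}" using less.prems a by auto
    then obtain b where b: "b \<in> F" "b \<noteq> a" using a by auto
    have card: "card (F - {b}) < card F"
      using less.prems(1) b(1) by (meson card_Diff1_less)
    have split: "sum h F = h b + sum h (F - {b})" for h
      using less.prems(1) b(1) by (rule sum.remove)
    show False
    proof (cases "c b = 0")
      case True
      then have "sum c (F - {b}) = 0" using split[of c] less.prems(3) by simp
      from less.hyps[OF card _ _ this] less.prems a b show False by auto
    next
      case False
      then obtain f \<mu> where f: "Vector_Spaces.linear s s f"
        and eig: "\<And>k x. x \<in> E k \<Longrightarrow> f x = s (\<mu> k) x" and ne: "\<mu> a \<noteq> \<mu> b"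
        using sep[of a b] a b less.prems(2) by (metis singletonD subsetD)
      interpret f: Vector_Spaces.linear s s f by fact
      have "f (sum c F) = (\<Sum>i\<in>F. s (\<mu> i) (c i))"
        unfolding f.sum using less.prems(2) eig by (intro sum.cong) auto
      then have "(\<Sum>i\<in>F. s (\<mu> i) (c i)) - s (\<mu> b) (sum c F) = 0"
        using less.prems(3) by (simp add: f.zero)
      then have "(\<Sum>i\<in>F. s (\<mu> i - \<mu> b) (c i)) = 0"
        by (simp add: scale_sum_right scale_left_diff_distrib sum_subtractf)
      then have "(\<Sum>i\<in>F - {b}. s (\<mu> i - \<mu> b) (c i)) = 0"
        using split[of "\<lambda>i. s (\<mu> i - \<mu> b) (c i)"] by simp
      from less.hyps[OF card _ _ this] less.prems sub have "s (\<mu> a - \<mu> b) (c a) = 0"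
        using a b by (auto simp: subspace_scale)
      then show False using a ne by simp
    qed
  qed
qed

lemma graded_subspace: "graded s E \<Longrightarrow> module.subspace s (E i)"
  unfolding graded_def by blast

lemma graded_independent:
  "graded s E \<Longrightarrow> finite F \<Longrightarrow> \<forall>i\<in>F. c i \<in> E i \<Longrightarrow> sum c F = 0 \<Longrightarrow> i \<in> F \<Longrightarrow> c i = 0"
  unfolding graded_def by blast

text \<open>Scalars are absent from the cases: a multiple of a homogeneous vector is homogeneous, so
  sums of homogeneous vectors exhaust the space.\<close>

lemma graded_induct [consumes 2, case_names zero add mem]:
  assumes "graded s E" "vector_space s" "P 0" "\<And>x y. P x \<Longrightarrow> P y \<Longrightarrow> P (x + y)"
    "\<And>i x. x \<in> E i \<Longrightarrow> P x"
  shows "P x"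
proof -
  interpret vector_space s by fact
  have "x \<in> span (\<Union>i. E i)" using assms(1) by (simp add: graded_def)
  then show ?thesis
  proof (induction rule: span_induct_alt)
    case base
    then show ?case by (rule assms(3))
  next
    case (step c y z)
    then obtain i where "y \<in> E i" by auto
    then have "s c y \<in> E i" using graded_subspace[OF assms(1)] by (intro subspace_scale)
    then show ?case using assms(4,5) step.IH by blast
  qed
qed

section \<open>Homogeneous components in a direct sum\<close>

lemma graded_decomposition_unique:
  assumes g: "graded s E" and vs: "vector_space s"
    and c: "\<forall>i. c i \<in> E i" "finite {i. c i \<noteq> 0}"
    and d: "\<forall>i. d i \<in> E i" "finite {i. d i \<noteq> 0}" and eq: "Sum_any c = Sum_any d"
  shows "c = d"
proof
  fix i
  interpret vector_space s by fact
  let ?F = "insert i ({i. c i \<noteq> 0} \<union> {i. d i \<noteq> 0})"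
  have "sum c ?F = Sum_any c" "sum d ?F = Sum_any d"
    using c d by (auto intro!: Sum_any_eq_sum[symmetric])
  then have "(\<Sum>j\<in>?F. c j - d j) = 0" using eq by (simp only: sum_subtractf diff_self)
  moreover have "\<forall>j\<in>?F. c j - d j \<in> E j"
    using c d graded_subspace[OF g] by (blast intro: subspace_diff)
  moreover have "finite ?F" using c d by simp
  ultimately have "c i - d i = 0" using graded_independent[OF g, of ?F "\<lambda>j. c j - d j" i] by blast
  then show "c i = d i" by simp
qed

text \<open>Uniqueness turns the definite description in \<open>homog_part\<close> into a
  computation: any decomposition that can be exhibited is the one it denotes.\<close>

lemma homog_part_eqI:
  assumes "graded s E" "vector_space s" "\<forall>i. c i \<in> E i" "finite {i. c i \<noteq> 0}" "Sum_any c = x"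
  shows "homog_part E i x = c i"
proof -
  have "(THE c. (\<forall>i. c i \<in> E i) \<and> finite {i. c i \<noteq> 0} \<and> Sum_any c = x) = c"
    using assms by (intro the_equality) (auto intro!: graded_decomposition_unique[of s E])
  then show ?thesis by (simp add: homog_part_def)
qed

lemma graded_mem_decomposition:
  assumes "graded s E" "vector_space s" "x \<in> E i"
  shows "\<forall>j. (if j = i then x else 0) \<in> E j" "finite {j. (if j = i then x else 0) \<noteq> 0}"
    "Sum_any (\<lambda>j. if j = i then x else 0) = x"
proof -
  interpret vector_space s by fact
  show "\<forall>j. (if j = i then x else 0) \<in> E j" using assms(3) subspace_0[OF graded_subspace[OF assms(1)]] by simp
  show "finite {j. (if j = i then x else 0) \<noteq> 0}" by (rule finite_subset[of _ "{i}"]) auto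
  show "Sum_any (\<lambda>j. if j = i then x else 0) = x" using Sum_any_eq_single[of i] by simp
qed

lemma graded_decomposition_add:
  assumes "graded s E" "vector_space s"
    "\<forall>i. c i \<in> E i" "finite {i. c i \<noteq> 0}" "\<forall>i. d i \<in> E i" "finite {i. d i \<noteq> 0}"
  shows "\<forall>i. c i + d i \<in> E i" "finite {i. c i + d i \<noteq> 0}"
    "Sum_any (\<lambda>i. c i + d i) = Sum_any c + Sum_any d"
proof -
  interpret vector_space s by fact
  show "\<forall>i. c i + d i \<in> E i" using assms(3,5) subspace_add[OF graded_subspace[OF assms(1)]] by blast
  show "finite {i. c i + d i \<noteq> 0}"
    by (rule finite_subset[of _ "{i. c i \<noteq> 0} \<union> {i. d i \<noteq> 0}"]) (use assms(4,6) in auto)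
  show "Sum_any (\<lambda>i. c i + d i) = Sum_any c + Sum_any d" using assms(4,6) by (intro Sum_any.distrib) auto
qed

lemma graded_decomposition_exists:
  assumes "graded s E" "vector_space s"
  shows "\<exists>c. (\<forall>i. c i \<in> E i) \<and> finite {i. c i \<noteq> 0} \<and> Sum_any c = x"
  using assms
proof (induction x rule: graded_induct)
  case zero
  interpret vector_space s by fact
  show ?case using subspace_0[OF graded_subspace[OF assms(1)]] by (intro exI[of _ "\<lambda>_. 0"]) simp
next
  case (add x y)
  then obtain c d where "(\<forall>i. c i \<in> E i) \<and> finite {i. c i \<noteq> 0} \<and> Sum_any c = x"
    "(\<forall>i. d i \<in> E i) \<and> finite {i. d i \<noteq> 0} \<and> Sum_any d = y" by blast
  then show ?case using graded_decomposition_add[OF assms, of c d]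
    by (intro exI[of _ "\<lambda>i. c i + d i"]) simp
next
  case (mem i x)
  from graded_mem_decomposition[OF assms this] show ?case
    by (intro exI[of _ "\<lambda>j. if j = i then x else 0"]) simp
qed

lemma homog_part_decomposition:
  assumes "graded s E" "vector_space s"
  shows "\<forall>i. homog_part E i x \<in> E i" "finite {i. homog_part E i x \<noteq> 0}"
    "Sum_any (\<lambda>i. homog_part E i x) = x"
proof -
  obtain c where c: "\<forall>i. c i \<in> E i" "finite {i. c i \<noteq> 0}" "Sum_any c = x"
    using graded_decomposition_exists[OF assms] by blast
  note * = homog_part_eqI[OF assms c]
  show "\<forall>i. homog_part E i x \<in> E i" "finite {i. homog_part E i x \<noteq> 0}"
    "Sum_any (\<lambda>i. homog_part E i x) = x" unfolding * using c by auto
qed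

lemma homog_part_mem:
  assumes "graded s E" "vector_space s" "x \<in> E i"
  shows "homog_part E j x = (if j = i then x else 0)"
  by (rule homog_part_eqI[OF assms(1,2) graded_mem_decomposition[OF assms]])

lemma homog_part_linear:
  assumes "graded s E" "vector_space s"
  shows "Vector_Spaces.linear s s (homog_part E i)"
proof (rule linearI)
  interpret vector_space s by fact
  note d = homog_part_decomposition[OF assms]
  show "homog_part E i (x + y) = homog_part E i x + homog_part E i y" for x y
    using graded_decomposition_add[OF assms d(1,2) d(1,2), of x y] d(3)
    by (intro homog_part_eqI[OF assms]) auto
  show "homog_part E i (s c x) = s c (homog_part E i x)" for c x
  proof (intro homog_part_eqI[OF assms])
    show "\<forall>i. s c (homog_part E i x) \<in> E i"
      using d(1) subspace_scale[OF graded_subspace[OF assms(1)]] by blast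
    show "finite {i. s c (homog_part E i x) \<noteq> 0}"
      by (rule finite_subset[OF _ d(2)[of x]]) auto
    have "Vector_Spaces.linear s s (s c)"
      by (rule linearI) (auto simp: assms scale_right_distrib mult.commute)
    from Sum_any_linear[OF this d(2)[of x]] show "Sum_any (\<lambda>i. s c (homog_part E i x)) = s c x"
      by (simp add: d)
  qed
qed (rule assms)+

text \<open>The zero modes o(u) and o_I(w), the circle products and the star products are all
  defined as such sums over components. This lemma and the next give their linearity and their value
  on a homogeneous argument.\<close>

lemma linear_Sum_any_homog_part:
  assumes "graded s E" "\<And>i. Vector_Spaces.linear s s' (G i)"
  shows "Vector_Spaces.linear s s' (\<lambda>x. Sum_any (\<lambda>i. G i (homog_part E i x)))"
proof -
  note vs = linear_spaces[OF assms(2)]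
  have "finite {i. G i (homog_part E i x) \<noteq> 0}" for x
    by (rule finite_subset[OF _ homog_part_decomposition(2)[OF assms(1) vs(1), of x]])
      (auto simp: linear_apply[OF assms(2)])
  then show ?thesis
    by (intro linear_Sum_any linear_compose[OF homog_part_linear[OF assms(1) vs(1)] assms(2)] vs)
qed

lemma Sum_any_homog_part_mem:
  assumes "graded s E" "\<And>i. Vector_Spaces.linear s s' (G i)" "x \<in> E i"
  shows "Sum_any (\<lambda>i. G i (homog_part E i x)) = G i x"
proof -
  note p = homog_part_mem[OF assms(1) linear_spaces(1)[OF assms(2)] assms(3)]
  have "Sum_any (\<lambda>i. G i (homog_part E i x)) = G i (homog_part E i x)"
    by (rule Sum_any_eq_single) (simp add: p linear_apply(3)[OF assms(2)])
  then show ?thesis by (simp add: p)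
qed

lemma gbinomial_0_left: "(0 :: complex) gchoose i = (if i = 0 then 1 else 0)"
  by (cases i) auto

lemma gbinomial_1_left: "i \<notin> {..<2} \<Longrightarrow> (1 :: complex) gchoose i = 0"
proof -
  assume "i \<notin> {..<2}"
  moreover have "(of_nat 1 :: complex) gchoose i = of_nat (1 choose i)"
    by (simp only: binomial_gbinomial)
  ultimately show ?thesis by simp
qed

section \<open>Eigenspaces of automorphisms and weights\<close>

lemma gradedI:
  assumes "vector_space s" "\<And>i. module.subspace s (E i)" "module.span s (\<Union>i. E i) = UNIV"
    "\<And>i j. i \<noteq> j \<Longrightarrow> E i \<subseteq> {0} \<or> E j \<subseteq> {0} \<or>
        (\<exists>f \<mu>. Vector_Spaces.linear s s f \<and> (\<forall>k. \<forall>x\<in>E k. f x = s (\<mu> k) x) \<and> \<mu> i \<noteq> \<mu> j)"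
  shows "graded s E"
  unfolding graded_def
  using joint_eigenspaces_independent[OF assms(1,2,4)] assms(2,3) by blast

lemma eigenspace_subspace:
  assumes "Vector_Spaces.linear s s f"
  shows "module.subspace s {x. f x = s c x}"
proof -
  interpret vector_space s using assms by (rule linear_spaces)
  show ?thesis
    by (rule subspaceI) (auto simp: linear_apply[OF assms] scale_right_distrib mult.commute)
qed

lemma exp_root_of_unity_inj:
  assumes "r < T" "r' < T"
    "exp (2 * of_real pi * \<i> * of_nat r / of_nat T) = exp (2 * of_real pi * \<i> * of_nat r' / of_nat T)"
  shows "r = r'"
proof -
  have "cis (2 * pi * real r / real T) = cis (2 * pi * real r' / real T)"
    using assms(3) by (simp add: cis_conv_exp mult_ac)
  then show ?thesis
    using bij_betw_roots_unity[of T] assms(1,2) by (auto simp: bij_betw_def inj_on_def)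
qed

lemma exp_root_of_unity_power:
  assumes "T \<ge> 1"
  shows "exp (2 * of_real pi * \<i> * of_nat r / of_nat T) ^ T = (1::complex)"
proof -
  have "exp (2 * of_real pi * \<i> * of_nat r / of_nat T) ^ T = exp (2 * of_real pi * \<i>) ^ r"
  proof -
    have "of_nat T * (2 * of_real pi * \<i> * of_nat r / of_nat T) = of_nat r * (2 * of_real pi * \<i> :: complex)"
      using assms by simp
    then show ?thesis by (simp only: exp_of_nat_mult[symmetric])
  qed
  also have "exp (2 * of_real pi * \<i>) = (1::complex)"
    by (simp add: exp_two_pi_i)
  finally show ?thesis by simp
qed

text \<open>Orthogonality of the characters of Z/T.\<close>

lemma sum_roots_of_unity_powers:
  assumes "k < T"
  shows "(\<Sum>r<T. inverse (exp (2 * of_real pi * \<i> * of_nat r / of_nat T)) ^ k)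
    = (if k = 0 then of_nat T else (0::complex))"
proof (cases "k = 0")
  case False
  define x where "x = inverse (exp (2 * of_real pi * \<i> * of_nat k / of_nat T) :: complex)"
  have T: "T \<ge> 1" using assms by simp
  \<comment> \<open>The exponent is symmetric in r and k, so the sum over r is geometric with ratio
    x.\<close>
  have "inverse (exp (2 * of_real pi * \<i> * of_nat r / of_nat T)) ^ k = x ^ r" for r
    by (simp add: x_def exp_minus[symmetric] exp_of_nat_mult[symmetric] mult_ac)
  then have "(\<Sum>r<T. inverse (exp (2 * of_real pi * \<i> * of_nat r / of_nat T)) ^ k) = (\<Sum>r<T. x ^ r)"
    by simp
  also have "\<dots> = 0"
  proof -
    have "x ^ T = 1" unfolding x_def power_inverse exp_root_of_unity_power[OF T] by simp
    moreover have "x \<noteq> 1"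
      using exp_root_of_unity_inj[OF assms, of 0] T False by (auto simp: x_def)
    ultimately show ?thesis by (simp add: geometric_sum)
  qed
  finally show ?thesis using False by simp
qed simp

text \<open>The projection to the eigenvalue \<open>z r\<close> is the average of \<open>z r\<close>
  to the power -k times g^k over k < T, and it maps every g-invariant subspace into itself. The
  subspace W permits splitting a weight space under one automorphism and the pieces under a second
  one.\<close>

lemma finite_order_eigen_decomposition:
  assumes lin: "Vector_Spaces.linear s s g" and ord: "g ^^ T = id" and T: "T \<ge> 1"
    and W: "module.subspace s W" "\<And>x. x \<in> W \<Longrightarrow> g x \<in> W" "v \<in> W"
  shows "\<exists>P. v = (\<Sum>r<T. P r) \<and>
    (\<forall>r<T. P r \<in> W \<and> g (P r) = s (exp (2 * of_real pi * \<i> * of_nat r / of_nat T)) (P r))"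
proof -
  interpret vector_space s using lin by (rule linear_spaces)
  interpret g: Vector_Spaces.linear s s g by fact
  define z where "z r = exp (2 * of_real pi * \<i> * of_nat r / of_nat T :: complex)" for r
  define P where "P r = s (1 / of_nat T) (\<Sum>k<T. s (inverse (z r) ^ k) ((g ^^ k) v))" for r
  have zT: "z r ^ T = 1" for r unfolding z_def by (rule exp_root_of_unity_power[OF T])
  have z0: "z r \<noteq> 0" for r by (simp add: z_def)
  have "P r \<in> W" for r
  proof -
    have "(g ^^ k) v \<in> W" for k by (induction k) (auto simp: W)
    then show ?thesis unfolding P_def by (intro subspace_scale subspace_sum W)
  qed
  moreover have "g (P r) = s (z r) (P r)" for r
  proof -
    let ?f = "\<lambda>k. s (inverse (z r) ^ k) ((g ^^ k) v)"
    have step: "g (?f k) = s (z r) (?f (Suc k))" for k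
      using z0[of r] by (simp add: g.scale field_simps)
    \<comment> \<open>A cyclic shift of the index changes nothing, since the term at k = T equals
      the term at k = 0.\<close>
    have "(\<Sum>k<T. ?f (Suc k)) + ?f 0 = (\<Sum>k<T. ?f k) + ?f T"
      using sum.lessThan_Suc_shift[of ?f T] by (simp add: add.commute)
    moreover have "?f T = ?f 0" by (simp add: ord power_inverse zT)
    ultimately have shift: "(\<Sum>k<T. ?f (Suc k)) = (\<Sum>k<T. ?f k)" by simp
    have "g (P r) = s (1 / of_nat T) (\<Sum>k<T. s (z r) (?f (Suc k)))"
      unfolding P_def g.scale[of "1 / of_nat T"] g.sum step ..
    also have "\<dots> = s (z r) (s (1 / of_nat T) (\<Sum>k<T. ?f (Suc k)))"
      by (simp only: scale_sum_right[symmetric] scale_left_commute)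
    finally show ?thesis by (simp only: shift P_def)
  qed
  moreover have "v = (\<Sum>r<T. P r)"
  proof -
    have "(\<Sum>r<T. P r) = s (1 / of_nat T) (\<Sum>r<T. \<Sum>k<T. s (inverse (z r) ^ k) ((g ^^ k) v))"
      by (simp only: P_def scale_sum_right)
    \<comment> \<open>After the exchange of sums the coefficient of g^k v is a character sum: only k
      = 0 survives, and 1/T cancels its value T.\<close>
    also have "(\<Sum>r<T. \<Sum>k<T. s (inverse (z r) ^ k) ((g ^^ k) v))
        = (\<Sum>k<T. s (\<Sum>r<T. inverse (z r) ^ k) ((g ^^ k) v))"
      by (subst sum.swap) (simp only: scale_sum_left)
    also have "\<dots> = (\<Sum>k<T. if k = 0 then s (of_nat T) v else 0)"
      unfolding z_def by (intro sum.cong) (auto simp: sum_roots_of_unity_powers)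
    also have "\<dots> = s (of_nat T) v" using T by (simp add: sum.delta)
    finally show ?thesis using T by simp
  qed
  ultimately show ?thesis unfolding z_def by blast
qed

section \<open>Weights and residues in V\<close>

context vertex_operator_algebra
begin

sublocale vs: vector_space "vscale V"
  by (rule vector_space)

lemma Lop_linear: "Vector_Spaces.linear (vscale V) (vscale V) (Lop V n)"
  unfolding Lop_def by (rule linear_right)

lemma wtspace_subspace: "vs.subspace (wtspace V n)"
  unfolding wtspace_def by (rule eigenspace_subspace[OF Lop_linear])

lemma wtspace_graded: "graded (vscale V) (wtspace V)"
proof (rule gradedI[OF vector_space wtspace_subspace grading])
  fix i j :: int assume "i \<noteq> j"
  then show "wtspace V i \<subseteq> {0} \<or> wtspace V j \<subseteq> {0} \<or>
      (\<exists>f \<mu>. Vector_Spaces.linear (vscale V) (vscale V) f \<and>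
        (\<forall>k. \<forall>x\<in>wtspace V k. f x = vscale V (\<mu> k) x) \<and> \<mu> i \<noteq> \<mu> j)"
    by (intro disjI2 exI[of _ "Lop V 0"] exI[of _ of_int]) (auto simp: Lop_linear wtspace_def)
qed

text \<open>The Jacobi identity with \<open>conf V\<close> as first vector, l = 0 and m = 1 is the
  commutator formula L(0) u_n - u_n L(0) = (L(-1)u)_{n+1} + (L(0)u)_n. The derivative property turns
  the first term on the right into -(n+1) u_n.\<close>

lemma vY_wtspace:
  assumes "u \<in> wtspace V a" "v \<in> wtspace V b"
  shows "vY V u n v \<in> wtspace V (a + b - n - 1)"
proof -
  note [simp] = linear_apply[OF linear_right] linear_apply[OF linear_left]
  have "Sum_any (\<lambda>i::nat. vscale V ((-1) ^ i * (of_int 0 gchoose i))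
            (vY V (conf V) (1 + 0 - int i) (vY V u (n + int i) v))) = Lop V 0 (vY V u n v)"
    by (subst Sum_any_eq_single[of 0]) (auto simp: gbinomial_0_left Lop_def)
  moreover have "Sum_any (\<lambda>i::nat. vscale V ((-1) ^ i * (of_int 0 gchoose i))
            (vY V u (n + 0 - int i) (vY V (conf V) (1 + int i) v))) = vY V u n (Lop V 0 v)"
    by (subst Sum_any_eq_single[of 0]) (auto simp: gbinomial_0_left Lop_def)
  moreover have "Sum_any (\<lambda>i::nat. vscale V (of_int 1 gchoose i)
            (vY V (vY V (conf V) (0 + int i) u) (1 + n - int i) v))
     = vY V (Lop V (-1) u) (1 + n) v + vY V (Lop V 0 u) n v"
    by (subst Sum_any_eq_sum[of "{..<2}"]) (auto simp: gbinomial_1_left Lop_def numeral_2_eq_2)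
  ultimately have "Lop V 0 (vY V u n v) - vY V u n (Lop V 0 v)
      = vY V (Lop V (-1) u) (1 + n) v + vY V (Lop V 0 u) n v"
    using jacobi[where l=0 and m=1 and u="conf V" and v=u and n=n and w=v] by (simp only: power_int_0_right vs.scale_one)
  then have "Lop V 0 (vY V u n v) = vscale V (of_int b) (vY V u n v)
      + (vscale V (- of_int (1 + n)) (vY V u n v) + vscale V (of_int a) (vY V u n v))"
    using assms unfolding L_minus1_derivative by (simp add: wtspace_def algebra_simps)
  also have "\<dots> = vscale V (of_int (a + b - n - 1)) (vY V u n v)"
    unfolding vs.scale_left_distrib[symmetric] by (simp add: algebra_simps)
  finally show ?thesis by (simp add: wtspace_def)
qed

text \<open>This is the Virasoro relation [L(0), L(-1)] = L(-1); the central term occurs only for m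
  + n = 0.\<close>

lemma Lop_minus1_wtspace: "u \<in> wtspace V a \<Longrightarrow> Lop V (-1) u \<in> wtspace V (a + 1)"
proof -
  assume u: "u \<in> wtspace V a"
  obtain c where "\<forall>m n v. Lop V m (Lop V n v) - Lop V n (Lop V m v)
        = vscale V (of_int (m - n)) (Lop V (m + n) v)
          + (if m + n = 0 then vscale V (of_int (m ^ 3 - m) / 12 * c) v else 0)"
    using virasoro by blast
  from this[rule_format, of 0 "-1" u] u show ?thesis
    by (simp add: wtspace_def linear_apply[OF Lop_linear] vs.scale_left_distrib algebra_simps)
qed

text \<open>Creation gives L(-1)u = (L(-1)u)_{-1} 1, and the derivative property at n = -1 rewrites
  this. In this form L(-1)u appears as a coefficient of a Jacobi identity.\<close>

lemma Lop_minus1_eq: "Lop V (-1) u = vY V u (-2) (vac V)"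
  using creation(2)[of "Lop V (-1) u"] L_minus1_derivative[of u "-1" "vac V"] by simp

lemma vY_support: "finite {i::nat. vY V u (int i - k) v \<noteq> 0}"
proof -
  obtain N where N: "\<forall>n\<ge>N. vY V u n v = 0" using truncation by blast
  have "{i::nat. vY V u (int i - k) v \<noteq> 0} \<subseteq> {..<nat (N + k)}"
    using N by (auto simp: not_le[symmetric] le_nat_iff)
  then show ?thesis by (rule finite_subset) simp
qed

lemma vres_linear_left: "Vector_Spaces.linear (vscale V) (vscale V) (\<lambda>u. vres V a k u v)"
  unfolding vres_def
  by (intro linear_Sum_any linear_scaled linear_left vector_space finite_subset[OF _ vY_support]) auto

lemma vres_linear_right: "Vector_Spaces.linear (vscale V) (vscale V) (vres V a k u)"
  unfolding vres_def
  by (intro linear_Sum_any linear_scaled linear_right vector_space finite_subset[OF _ vY_support]) auto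

end

section \<open>Joint eigenspaces of L(0) and finite-order automorphisms\<close>

locale finite_order_automorphism = vertex_operator_algebra V
  for V :: "'v::ab_group_add voa" +
  fixes T :: nat and g :: "'v \<Rightarrow> 'v"
  assumes T_ge_1: "T \<ge> 1" and automorphism: "voa_automorphism V g" and order: "g ^^ T = id"
begin

lemma g_linear: "Vector_Spaces.linear (vscale V) (vscale V) g"
  using automorphism by (simp add: voa_automorphism_def)

lemma g_conf: "g (conf V) = conf V"
  using automorphism by (simp add: voa_automorphism_def)

lemma g_Lop: "g (Lop V n v) = Lop V n (g v)"
  using automorphism by (simp add: voa_automorphism_def Lop_def)

lemma g_wtspace: "v \<in> wtspace V n \<Longrightarrow> g v \<in> wtspace V n"
  by (simp add: wtspace_def g_Lop[symmetric] linear_apply(2)[OF g_linear])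

lemma conf_eig: "conf V \<in> eig V T g 0"
  by (simp add: eig_def g_conf)

lemma eig_subspace: "vs.subspace (eig V T g r)"
  unfolding eig_def by (rule eigenspace_subspace[OF g_linear])

lemma eig_decomposition:
  assumes "vs.subspace W" "\<And>x. x \<in> W \<Longrightarrow> g x \<in> W" "v \<in> W"
  obtains P where "v = (\<Sum>r<T. P r)" "\<And>r. r < T \<Longrightarrow> P r \<in> W \<inter> eig V T g r"
  using finite_order_eigen_decomposition[OF g_linear order T_ge_1 assms] unfolding eig_def by blast

text \<open>An automorphism fixes the conformal vector, hence commutes with L(0) and splits each
  weight space. Distinct indices with r < T are separated by L(0) or by g; indices with r \<ge> T
  carry {0}.\<close>

lemma grade1_graded: "graded (vscale V) (grade1 V T g)"
proof (rule gradedI[OF vector_space])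
  show "vs.subspace (grade1 V T g i)" for i
    by (cases i) (auto simp: grade1_def intro: vs.subspace_inter wtspace_subspace eig_subspace)
  have "x \<in> vs.span (\<Union>i. grade1 V T g i)" for x
    using wtspace_graded vector_space
  proof (induction x rule: graded_induct)
    case (mem n x)
    obtain P where P: "x = (\<Sum>r<T. P r)" "\<And>r. r < T \<Longrightarrow> P r \<in> wtspace V n \<inter> eig V T g r"
      using eig_decomposition[OF wtspace_subspace g_wtspace mem] by blast
    then have "P r \<in> grade1 V T g (n, r)" if "r < T" for r
      using that by (simp add: grade1_def)
    then show ?case unfolding P(1) by (intro vs.span_sum vs.span_base) blast
  qed (auto intro: vs.span_add vs.span_zero)
  then show "vs.span (\<Union>i. grade1 V T g i) = UNIV" by auto
next
  fix i j :: "int \<times> nat" assume ij: "i \<noteq> j"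
  obtain n r n' r' where i: "i = (n, r)" and j: "j = (n', r')" by (cases i, cases j)
  show "grade1 V T g i \<subseteq> {0} \<or> grade1 V T g j \<subseteq> {0} \<or>
      (\<exists>f \<mu>. Vector_Spaces.linear (vscale V) (vscale V) f \<and>
        (\<forall>k. \<forall>x\<in>grade1 V T g k. f x = vscale V (\<mu> k) x) \<and> \<mu> i \<noteq> \<mu> j)"
  proof (cases "r < T \<and> r' < T")
    case r: True
    show ?thesis
    proof (cases "n = n'")
      case True
      then have "r \<noteq> r'" using ij i j by simp
      then show ?thesis
        using r exp_root_of_unity_inj[of r T r'] i j
        by (intro disjI2 exI[of _ g]
            exI[of _ "\<lambda>(n, r). exp (2 * of_real pi * \<i> * of_nat r / of_nat T)"])
          (auto simp: g_linear grade1_def eig_def linear_apply(3)[OF g_linear] split: if_splits)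
    next
      case False
      then show ?thesis
        using i j
        by (intro disjI2 exI[of _ "Lop V 0"] exI[of _ "\<lambda>(n, r). of_int n"])
          (auto simp: Lop_linear grade1_def wtspace_def linear_apply(3)[OF Lop_linear] split: if_splits)
    qed
  qed (auto simp: i j grade1_def)
qed

end

locale commuting_automorphisms =
  a1: finite_order_automorphism V T g1 + a2: finite_order_automorphism V T g2
  for V :: "'v::ab_group_add voa" and T g1 g2 +
  assumes commute: "g1 \<circ> g2 = g2 \<circ> g1"
begin

text \<open>Each weight space is split by g1, and each piece by g2, which preserves the pieces
  because it commutes with g1 and with L(0).\<close>

lemma grade2_graded: "graded (vscale V) (grade2 V T g1 g2)"
proof (rule gradedI[OF a1.vector_space])
  show "a1.vs.subspace (grade2 V T g1 g2 i)" for i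
    by (cases i) (auto simp: grade2_def eig2_def
        intro: a1.vs.subspace_inter a1.wtspace_subspace a1.eig_subspace a2.eig_subspace)
  have "x \<in> a1.vs.span (\<Union>i. grade2 V T g1 g2 i)" for x
    using a1.wtspace_graded a1.vector_space
  proof (induction x rule: graded_induct)
    case (mem n x)
    obtain P where P: "x = (\<Sum>r<T. P r)" "\<And>r. r < T \<Longrightarrow> P r \<in> wtspace V n \<inter> eig V T g1 r"
      using a1.eig_decomposition[OF a1.wtspace_subspace a1.g_wtspace mem] by blast
    have "P r \<in> a1.vs.span (\<Union>i. grade2 V T g1 g2 i)" if r: "r < T" for r
    proof -
      have sub: "a1.vs.subspace (wtspace V n \<inter> eig V T g1 r)"
        by (intro a1.vs.subspace_inter a1.wtspace_subspace a1.eig_subspace)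
      have inv: "g2 x \<in> wtspace V n \<inter> eig V T g1 r" if "x \<in> wtspace V n \<inter> eig V T g1 r" for x
      proof -
        have "g1 (g2 x) = g2 (g1 x)" using commute by (metis comp_apply)
        then show ?thesis using that a2.g_wtspace
          by (auto simp: eig_def linear_apply[OF a2.g_linear])
      qed
      obtain Q where Q: "P r = (\<Sum>q<T. Q q)"
        "\<And>q. q < T \<Longrightarrow> Q q \<in> wtspace V n \<inter> eig V T g1 r \<inter> eig V T g2 q"
        using a2.eig_decomposition[OF sub inv P(2)[OF r]] by blast
      then have "Q q \<in> grade2 V T g1 g2 (n, r, q)" if "q < T" for q
        using that r by (simp add: grade2_def eig2_def)
      then show ?thesis unfolding Q(1) by (intro a1.vs.span_sum a1.vs.span_base) blast
    qed
    then show ?case unfolding P(1) by (intro a1.vs.span_sum) blast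
  qed (auto intro: a1.vs.span_add a1.vs.span_zero)
  then show "a1.vs.span (\<Union>i. grade2 V T g1 g2 i) = UNIV" by auto
next
  fix i j :: "int \<times> nat \<times> nat" assume ij: "i \<noteq> j"
  obtain n r q n' r' q' where i: "i = (n, r, q)" and j: "j = (n', r', q')" by (cases i, cases j)
  show "grade2 V T g1 g2 i \<subseteq> {0} \<or> grade2 V T g1 g2 j \<subseteq> {0} \<or>
      (\<exists>f \<mu>. Vector_Spaces.linear (vscale V) (vscale V) f \<and>
        (\<forall>k. \<forall>x\<in>grade2 V T g1 g2 k. f x = vscale V (\<mu> k) x) \<and> \<mu> i \<noteq> \<mu> j)"
  proof (cases "r < T \<and> r' < T \<and> q < T \<and> q' < T")
    case r: True
    consider "n \<noteq> n'" | "r \<noteq> r'" | "q \<noteq> q'" using ij i j by auto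
    then show ?thesis
    proof cases
      case 1
      then show ?thesis
        using i j
        by (intro disjI2 exI[of _ "Lop V 0"] exI[of _ "\<lambda>(n, r). of_int n"])
          (auto simp: a1.Lop_linear grade2_def wtspace_def linear_apply(3)[OF a1.Lop_linear]
            split: if_splits)
    next
      case 2
      then show ?thesis
        using r exp_root_of_unity_inj[of r T r'] i j
        by (intro disjI2 exI[of _ g1]
            exI[of _ "\<lambda>(n, r, q). exp (2 * of_real pi * \<i> * of_nat r / of_nat T)"])
          (auto simp: a1.g_linear grade2_def eig2_def eig_def linear_apply(3)[OF a1.g_linear]
            split: if_splits)
    next
      case 3
      then show ?thesis
        using r exp_root_of_unity_inj[of q T q'] i j
        by (intro disjI2 exI[of _ g2]
            exI[of _ "\<lambda>(n, r, q). exp (2 * of_real pi * \<i> * of_nat q / of_nat T)"])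
          (auto simp: a2.g_linear grade2_def eig2_def eig_def linear_apply(3)[OF a2.g_linear]
            split: if_splits)
    qed
  qed (auto simp: i j grade2_def)
qed

end

section \<open>Twisted modules\<close>

locale graded_twisted_module = aut: finite_order_automorphism V T g + twisted_module V T g M
  for V :: "'v::ab_group_add voa" and T g and M :: "('v, 'm::ab_group_add) vmod" +
  fixes h :: complex
  assumes standing: "standing V T M h"
begin

sublocale ms: vector_space "mscale M"
  by (rule vector_space)

lemma T_pos: "T > 0" "(of_nat T :: complex) \<noteq> 0"
  using aut.T_ge_1 by auto

text \<open>The exponent, truncation and Jacobi axioms speak about eigenvectors of g only;
  properties additive in u are reduced to them here.\<close>

lemma eig_induct [case_names zero add eig]:
  assumes "P 0" "\<And>x y. P x \<Longrightarrow> P y \<Longrightarrow> P (x + y)" "\<And>r x. r < T \<Longrightarrow> x \<in> eig V T g r \<Longrightarrow> P x"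
  shows "P u"
  using aut.grade1_graded aut.vector_space
proof (induction u rule: graded_induct)
  case (mem i x)
  then show ?case using assms by (cases i) (auto simp: grade1_def split: if_splits)
qed (use assms in auto)

lemmas mY_simps = linear_apply[OF linear_right] linear_apply[OF linear_left]

text \<open>For an eigenvector u the indices c + i lie either all inside the coset r/T + Z, where
  the truncation axiom applies, or all outside it, where every mode is 0. The offset c is complex
  because Jacobi sums run upward from arbitrary indices.\<close>

lemma mY_truncation: "\<exists>N::nat. \<forall>i\<ge>N. mY M u (c + of_nat i) w = 0"
proof (induction u rule: eig_induct)
  case zero
  show ?case by (simp add: mY_simps)
next
  case (add x y)
  then obtain N N' where "\<forall>i\<ge>N. mY M x (c + of_nat i) w = 0" "\<forall>i\<ge>N'. mY M y (c + of_nat i) w = 0"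
    by blast
  then show ?case by (intro exI[of _ "max N N'"]) (auto simp: mY_simps)
next
  case (eig r u)
  show ?case
  proof (cases "c - of_nat r / of_nat T \<in> \<int>")
    case True
    then obtain k where "c - of_nat r / of_nat T = of_int k" by (auto elim: Ints_cases)
    then have k: "c = of_nat r / of_nat T + of_int k" by (simp add: algebra_simps)
    obtain N where N: "\<forall>k\<ge>N. mY M u (of_nat r / of_nat T + of_int k) w = 0"
      using truncation[OF eig] by blast
    have "mY M u (c + of_nat i) w = 0" if "i \<ge> nat (N - k)" for i
    proof -
      have "N \<le> k + int i" using that by linarith
      then have "mY M u (of_nat r / of_nat T + of_int (k + int i)) w = 0" using N by blast
      then show ?thesis by (simp add: k add.assoc)
    qed
    then show ?thesis by blast
  next
    case False
    have "mY M u (c + of_nat i) w = 0" for i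
    proof (rule exponents[OF eig])
      show "c + of_nat i - of_nat r / of_nat T \<notin> \<int>"
      proof
        assume "c + of_nat i - of_nat r / of_nat T \<in> \<int>"
        from Ints_diff[OF this Ints_of_nat[of i]]
        show False using False by (simp add: algebra_simps)
      qed
    qed
    then show ?thesis by blast
  qed
qed

lemma mY_support: "finite {i::nat. mY M u (c + of_nat i) w \<noteq> 0}"
proof -
  obtain N where "\<forall>i\<ge>N. mY M u (c + of_nat i) w = 0" using mY_truncation by blast
  then have "{i::nat. mY M u (c + of_nat i) w \<noteq> 0} \<subseteq> {..<N}" by (auto simp: not_le[symmetric])
  then show ?thesis by (rule finite_subset) simp
qed

lemma mY_support': "finite {i::nat. mY M u (of_nat i - c) w \<noteq> 0}"
  using mY_support[of u "-c" w] by simp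

lemma mres_linear_left: "Vector_Spaces.linear (vscale V) (mscale M) (\<lambda>u. mres M a b u w)"
  unfolding mres_def
  by (intro linear_Sum_any linear_scaled linear_left aut.vector_space vector_space
      finite_subset[OF _ mY_support']) auto

lemma mres_linear_right: "Vector_Spaces.linear (mscale M) (mscale M) (mres M a b u)"
  unfolding mres_def
  by (intro linear_Sum_any linear_scaled linear_right vector_space
      finite_subset[OF _ mY_support']) auto

text \<open>The Jacobi identity with \<open>v = \<one>\<close>, \<open>l = -2\<close>, \<open>n = 0\<close>, since \<open>L(-1)u = u\<^bsub>-2\<^esub>\<one>\<close>.\<close>

lemma mY_Lop_minus1: "mY M (Lop V (-1) u) n w = mscale M (- n) (mY M u (n - 1) w)"
proof (induction u rule: eig_induct)
  case zero
  show ?case by (simp add: mY_simps linear_apply[OF aut.Lop_linear])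
next
  case (add x y)
  then show ?case by (simp add: mY_simps linear_apply[OF aut.Lop_linear] ms.scale_right_distrib)
next
  case (eig r u)
  show ?case
  proof (cases "n - of_nat r / of_nat T \<in> \<int>")
    case True
    then obtain p where "n - of_nat r / of_nat T = of_int p" by (auto elim: Ints_cases)
    then have p: "n = of_nat r / of_nat T + of_int p" by (simp add: algebra_simps)
    \<comment> \<open>The only nonzero mode of the vacuum has index -1. Here its indices are i \<ge>
      0, and in the second sum they are -2 - i.\<close>
    have "Sum_any (\<lambda>i::nat. mscale M ((-1) ^ i * (of_int (-2) gchoose i))
            (mY M u (n + of_int (-2) - of_nat i) (mY M (vac V) (0 + of_nat i) w))) = 0"
    proof -
      have "(of_nat i :: complex) \<noteq> -1" for i
        by (metis add.commute add_eq_0_iff nat.distinct(1) of_nat_Suc of_nat_eq_0_iff)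
      then show ?thesis by (simp add: vacuum mY_simps)
    qed
    moreover have "Sum_any (\<lambda>i::nat. mscale M ((-1) ^ i * (of_int (-2) gchoose i))
            (mY M (vac V) (0 + of_int (-2) - of_nat i) (mY M u (n + of_nat i) w))) = 0"
    proof -
      have "(0 + of_int (-2) - of_nat i :: complex) \<noteq> -1" for i
      proof
        assume "(0 + of_int (-2) - of_nat i :: complex) = -1"
        then have "(of_int (-2 - int i) :: complex) = of_int (-1)" by simp
        then show False by (simp only: of_int_eq_iff)
      qed
      then show ?thesis by (simp add: vacuum)
    qed
    \<comment> \<open>Creation kills the indices -2 + i \<ge> 0; what remains is u_{-2} 1 = L(-1)u
      at i = 0 and u_{-1} 1 = u at i = 1.\<close>
    moreover have "Sum_any (\<lambda>i::nat. mscale M (n gchoose i)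
            (mY M (vY V u (-2 + int i) (vac V)) (n + 0 - of_nat i) w))
       = mY M (Lop V (-1) u) n w + mscale M n (mY M u (n - 1) w)"
      by (subst Sum_any_eq_sum[of "{..<2}"])
        (auto simp: aut.creation mY_simps numeral_2_eq_2 aut.Lop_minus1_eq)
    ultimately have "mY M (Lop V (-1) u) n w + mscale M n (mY M u (n - 1) w) = 0"
      using jacobi[OF eig p, where l="-2" and v="vac V" and n=0 and w=w]
      by (simp only: ms.scale_zero_right diff_self)
    then show ?thesis by (simp add: eq_neg_iff_add_eq_0)
  next
    case False
    have L: "Lop V (-1) u \<in> eig V T g r"
      using eig by (simp add: eig_def aut.g_Lop[symmetric]) (simp add: aut.g_Lop linear_apply[OF aut.Lop_linear])
    have "n - 1 - of_nat r / of_nat T \<notin> \<int>"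
    proof
      assume "n - 1 - of_nat r / of_nat T \<in> \<int>"
      then have "n - 1 - of_nat r / of_nat T + 1 \<in> \<int>" by (intro Ints_add) auto
      then show False using False by (simp add: algebra_simps)
    qed
    then show ?thesis using exponents[OF eig] exponents[OF eig(1) L False] by simp
  qed
qed

lemma mL_linear: "Vector_Spaces.linear (mscale M) (mscale M) (mL V M n)"
  unfolding mL_def by (rule linear_right)

lemma lspace_subspace: "ms.subspace (lspace V M x)"
  unfolding lspace_def by (rule eigenspace_subspace[OF mL_linear])

text \<open>The commutator of L(0) with u_n again, now evaluated with \<open>mY_Lop_minus1\<close>.
  The resulting shift of weights drives the degree counts below.\<close>

lemma mY_lspace:
  assumes "u \<in> wtspace V a" "w \<in> lspace V M x"
  shows "mY M u n w \<in> lspace V M (x + of_int a - n - 1)"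
proof -
  have "Sum_any (\<lambda>i::nat. mscale M ((-1) ^ i * (of_int 0 gchoose i))
            (mY M (conf V) (1 + of_int 0 - of_nat i) (mY M u (n + of_nat i) w))) = mL V M 0 (mY M u n w)"
    by (subst Sum_any_eq_single[of 0]) (auto simp: gbinomial_0_left mL_def)
  moreover have "Sum_any (\<lambda>i::nat. mscale M ((-1) ^ i * (of_int 0 gchoose i))
            (mY M u (n + of_int 0 - of_nat i) (mY M (conf V) (1 + of_nat i) w))) = mY M u n (mL V M 0 w)"
    by (subst Sum_any_eq_single[of 0]) (auto simp: gbinomial_0_left mL_def)
  moreover have "Sum_any (\<lambda>i::nat. mscale M (1 gchoose i)
            (mY M (vY V (conf V) (0 + int i) u) (1 + n - of_nat i) w))
     = mY M (Lop V (-1) u) (1 + n) w + mY M (Lop V 0 u) n w"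
    by (subst Sum_any_eq_sum[of "{..<2}"]) (auto simp: gbinomial_1_left Lop_def numeral_2_eq_2)
  ultimately have "mL V M 0 (mY M u n w) - mY M u n (mL V M 0 w)
      = mY M (Lop V (-1) u) (1 + n) w + mY M (Lop V 0 u) n w"
    using jacobi[OF _ aut.conf_eig, where l=0 and m=1 and p=1 and v=u and n=n and w=w] T_pos
    by (simp only: power_int_0_right ms.scale_one of_int_1) simp
  then have "mL V M 0 (mY M u n w) = mscale M x (mY M u n w)
      + (mscale M (- (1 + n)) (mY M u n w) + mscale M (of_int a) (mY M u n w))"
    using assms unfolding mY_Lop_minus1 by (simp add: wtspace_def lspace_def mY_simps algebra_simps)
  also have "\<dots> = mscale M (x + of_int a - n - 1) (mY M u n w)"
    unfolding ms.scale_left_distrib[symmetric] by (simp add: algebra_simps)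
  finally show ?thesis by (simp add: lspace_def)
qed

lemma mdeg_graded: "graded (mscale M) (mdeg V T M h)"
proof (rule gradedI[OF vector_space])
  show "ms.subspace (mdeg V T M h i)" for i unfolding mdeg_def by (rule lspace_subspace)
  show "ms.span (\<Union>i. mdeg V T M h i) = UNIV" using standing by (simp add: standing_def)
  fix i j :: nat assume "i \<noteq> j"
  then show "mdeg V T M h i \<subseteq> {0} \<or> mdeg V T M h j \<subseteq> {0} \<or>
      (\<exists>f \<mu>. Vector_Spaces.linear (mscale M) (mscale M) f \<and>
        (\<forall>k. \<forall>x\<in>mdeg V T M h k. f x = mscale M (\<mu> k) x) \<and> \<mu> i \<noteq> \<mu> j)"
    using T_pos
    by (intro disjI2 exI[of _ "mL V M 0"] exI[of _ "\<lambda>n. h + of_nat n / of_nat T"])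
      (auto simp: mL_linear mdeg_def lspace_def)
qed

lemma homog_part_mL:
  "homog_part (mdeg V T M h) n (mL V M 0 w)
    = mscale M (h + of_nat n / of_nat T) (homog_part (mdeg V T M h) n w)"
  using mdeg_graded vector_space
proof (induction w rule: graded_induct)
  case zero
  show ?case by (simp add: linear_apply[OF mL_linear] linear_apply[OF homog_part_linear[OF mdeg_graded vector_space]])
next
  case (add x y)
  then show ?case
    by (simp add: linear_apply[OF mL_linear] linear_apply[OF homog_part_linear[OF mdeg_graded vector_space]]
        ms.scale_right_distrib)
next
  case (mem i w)
  then have "mL V M 0 w = mscale M (h + of_nat i / of_nat T) w" by (simp add: mdeg_def lspace_def)
  then show ?case
    using homog_part_mem[OF mdeg_graded vector_space mem]
    by (simp add: linear_apply[OF homog_part_linear[OF mdeg_graded vector_space]])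
qed

text \<open>L(0) multiplies the component of degree n/T by h + n/T. If x is none of these numbers,
  every component of w satisfies two different eigenvalue equations and is therefore 0.\<close>

lemma lspace_weight:
  assumes "w \<in> lspace V M x" "w \<noteq> 0"
  obtains n :: nat where "x = h + of_nat n / of_nat T" "w \<in> mdeg V T M h n"
proof -
  have "\<exists>n::nat. x = h + of_nat n / of_nat T"
  proof (rule ccontr)
    assume no: "\<nexists>n::nat. x = h + of_nat n / of_nat T"
    have "homog_part (mdeg V T M h) n w = 0" for n
    proof -
      have "mscale M (h + of_nat n / of_nat T) (homog_part (mdeg V T M h) n w)
          = mscale M x (homog_part (mdeg V T M h) n w)"
        using assms(1) homog_part_mL[of n w]
        by (auto simp: lspace_def linear_apply[OF homog_part_linear[OF mdeg_graded vector_space]])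
      then show ?thesis using no by (metis ms.scale_cancel_right)
    qed
    then have "w = 0" using homog_part_decomposition(3)[OF mdeg_graded vector_space, of w] by simp
    then show False using assms by simp
  qed
  then show ?thesis using that assms(1) by (auto simp: mdeg_def)
qed

text \<open>In every application the weight is h plus a real degree, which is why negativity can be
  expressed although weights are complex.\<close>

lemma lspace_negative:
  assumes "w \<in> lspace V M (h + of_real r)" "r < 0"
  shows "w = 0"
proof (rule ccontr)
  assume "w \<noteq> 0"
  then obtain n where "h + complex_of_real r = h + of_nat n / of_nat T"
    using lspace_weight[OF assms(1)] by blast
  then have "complex_of_real r = of_real (of_nat n / of_nat T)" by simp
  then have "r = real n / real T" by (simp only: of_real_eq_iff)
  then show False using assms(2) by (simp add: not_le[symmetric])
qed

section \<open>Zero modes of V on the bottom level of a module\<close>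

lemma o_mod_linear_left: "Vector_Spaces.linear (vscale V) (mscale M) (\<lambda>u. o_mod V M u w)"
  unfolding o_mod_def by (rule linear_Sum_any_homog_part[OF aut.wtspace_graded linear_left])

lemma o_mod_wtspace: "u \<in> wtspace V a \<Longrightarrow> o_mod V M u w = mY M u (of_int a - 1) w"
  unfolding o_mod_def by (rule Sum_any_homog_part_mem[OF aut.wtspace_graded linear_left])

lemma o_mod_linear_right: "Vector_Spaces.linear (mscale M) (mscale M) (o_mod V M u)"
  unfolding o_mod_def
  by (intro linear_Sum_any linear_right vector_space
      finite_subset[OF _ homog_part_decomposition(2)[OF aut.wtspace_graded aut.vector_space, of u]])
    (auto simp: mY_simps)

lemma o_mod_mdeg_0:
  assumes "w \<in> mdeg V T M h 0"
  shows "o_mod V M u w \<in> mdeg V T M h 0"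
  using aut.wtspace_graded aut.vector_space
proof (induction u rule: graded_induct)
  case (mem a u)
  then show ?case using mY_lspace[OF mem, of w h "of_int a - 1"] assms
    by (simp add: o_mod_wtspace mdeg_def)
qed (use lspace_subspace[of h] in \<open>auto simp: linear_apply[OF o_mod_linear_left] mdeg_def
    ms.subspace_0 ms.subspace_add\<close>)

text \<open>The zero mode has the integral index a - 1, which lies outside r/T + Z for 0 < r <
  T.\<close>

lemma o_mod_eig_nonzero:
  assumes "u \<in> wtspace V a" "u \<in> eig V T g r" "0 < r" "r < T"
  shows "o_mod V M u w = 0"
  unfolding o_mod_wtspace[OF assms(1)]
proof (rule exponents[OF assms(4,2)])
  show "of_int a - 1 - of_nat r / of_nat T \<notin> (\<int> :: complex set)"
  proof
    assume "of_int a - 1 - of_nat r / of_nat T \<in> (\<int> :: complex set)"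
    then have "of_int a - 1 - (of_int a - 1 - of_nat r / of_nat T) \<in> (\<int> :: complex set)"
      by (intro Ints_diff) auto
    then have "of_nat r / of_nat T \<in> (\<int> :: complex set)" by simp
    then obtain k where "of_nat r / of_nat T = (of_int k :: complex)" by (auto elim: Ints_cases)
    then have "(of_int (int r) :: complex) = of_int (k * int T)" using T_pos by (simp add: field_simps)
    then have "int r = k * int T" by (simp only: of_int_eq_iff)
    then show False using assms(3,4)
      by (metis dvd_triv_right int_dvd_int_iff nat_dvd_not_less)
  qed
qed

text \<open>The index n is chosen so that m + n - i = wt(u_{l+i} v) - 1 for every i. The right side
  of the Jacobi identity then consists of the zero modes of the terms of the residue.\<close>

lemma o_mod_vres:
  assumes r: "r < T" and u: "u \<in> wtspace V a" "u \<in> eig V T g r" and v: "v \<in> wtspace V b"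
    and m: "m = of_nat r / of_nat T + of_int p" and n: "n = of_int (a + b - l - 2) - m"
  shows "o_mod V M (vres V m (- l) u v) w =
     Sum_any (\<lambda>i::nat. mscale M ((-1) ^ i * (of_int l gchoose i))
            (mY M u (m + of_int l - of_nat i) (mY M v (n + of_nat i) w)))
        - mscale M ((-1) powi l) (Sum_any (\<lambda>i::nat. mscale M ((-1) ^ i * (of_int l gchoose i))
            (mY M v (n + of_int l - of_nat i) (mY M u (m + of_nat i) w))))"
proof -
  have "o_mod V M (vres V m (- l) u v) w
      = Sum_any (\<lambda>i::nat. o_mod V M (vscale V (m gchoose i) (vY V u (int i - (- l)) v)) w)"
    unfolding vres_def
    by (rule Sum_any_linear[OF o_mod_linear_left], rule finite_subset[OF _ aut.vY_support[of u "-l" v]]) auto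
  also have "\<dots> = Sum_any (\<lambda>i::nat. mscale M (m gchoose i)
            (mY M (vY V u (l + int i) v) (m + n - of_nat i) w))"
  proof (rule Sum_any.cong)
    fix i :: nat
    have "o_mod V M (vY V u (l + int i) v) w
        = mY M (vY V u (l + int i) v) (of_int (a + b - (l + int i) - 1) - 1) w"
      by (rule o_mod_wtspace[OF aut.vY_wtspace[OF u(1) v]])
    also have "of_int (a + b - (l + int i) - 1) - 1 = m + n - of_nat i"
      by (simp add: n)
    finally show "o_mod V M (vscale V (m gchoose i) (vY V u (int i - (- l)) v)) w
        = mscale M (m gchoose i) (mY M (vY V u (l + int i) v) (m + n - of_nat i) w)"
      by (simp add: linear_apply[OF o_mod_linear_left] add.commute)
  qed
  finally show ?thesis using jacobi[OF r u(2) m] by simp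
qed

text \<open>With n as in \<open>o_mod_vres\<close>, the vector v_n w has degree r/T + p + l + 1 - a,
  and u_m w has degree -(r/T + p + 1 - a). Larger indices lower the degree further, so both sums
  vanish term by term.\<close>

lemma o_mod_vres_vanishes:
  assumes r: "r < T" and u: "u \<in> wtspace V a" "u \<in> eig V T g r" and v: "v \<in> wtspace V b"
    and w: "w \<in> mdeg V T M h 0"
    and neg: "real r / real T + of_int (p + l + 1 - a) < 0" "real r / real T + of_int (p + 1 - a) > 0"
  shows "o_mod V M (vres V (of_nat r / of_nat T + of_int p) (- l) u v) w = 0"
proof -
  define m where "m = of_nat r / of_nat T + (of_int p :: complex)"
  define n where "n = of_int (a + b - l - 2) - m"
  have w0: "w \<in> lspace V M h" using w by (simp add: mdeg_def)
  have "mY M v (n + of_nat i) w = 0" for i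
  proof (rule lspace_negative)
    have "h + of_int b - (n + of_nat i) - 1
        = h + of_real (real r / real T + of_int (p + l + 1 - a) - real i)"
      by (simp add: n_def m_def algebra_simps)
    then show "mY M v (n + of_nat i) w
        \<in> lspace V M (h + of_real (real r / real T + of_int (p + l + 1 - a) - real i))"
      using mY_lspace[OF v w0, of "n + of_nat i"] by (simp only:)
  qed (use neg in linarith)
  moreover have "mY M u (m + of_nat i) w = 0" for i
  proof (rule lspace_negative)
    have "h + of_int a - (m + of_nat i) - 1
        = h + of_real (- (real r / real T + of_int (p + 1 - a)) - real i)"
      by (simp add: m_def algebra_simps)
    then show "mY M u (m + of_nat i) w
        \<in> lspace V M (h + of_real (- (real r / real T + of_int (p + 1 - a)) - real i))"
      using mY_lspace[OF u(1) w0, of "m + of_nat i"] by (simp only:)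
  qed (use neg in linarith)
  ultimately show ?thesis
    using o_mod_vres[OF r u v m_def n_def, of w] by (simp add: mY_simps m_def)
qed

text \<open>The boundary case m = a, l = -1 of this degree count: n becomes b - 1, so v_n w has
  degree 0 and precisely the product u_{a-1} v_{b-1} w remains.\<close>

lemma o_mod_vres_product:
  assumes u: "u \<in> wtspace V a" "u \<in> eig V T g 0" and v: "v \<in> wtspace V b"
    and w: "w \<in> mdeg V T M h 0"
  shows "o_mod V M (vres V (of_int a) 1 u v) w = o_mod V M u (o_mod V M v w)"
proof -
  define n where "n = of_int (a + b - (-1) - 2) - (of_int a :: complex)"
  have n: "n = of_int b - 1" by (simp add: n_def)
  have w0: "w \<in> lspace V M h" using w by (simp add: mdeg_def)
  have "mY M v (n + of_nat i) w = 0" if "i \<noteq> 0" for i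
  proof (rule lspace_negative)
    have "h + of_int b - (n + of_nat i) - 1 = h + of_real (- real i)"
      by (simp add: n)
    then show "mY M v (n + of_nat i) w \<in> lspace V M (h + of_real (- real i))"
      using mY_lspace[OF v w0, of "n + of_nat i"] by (simp only:)
  qed (use that in simp)
  then have "Sum_any (\<lambda>i::nat. mscale M ((-1) ^ i * (of_int (-1) gchoose i))
            (mY M u (of_int a + of_int (-1) - of_nat i) (mY M v (n + of_nat i) w)))
       = o_mod V M u (o_mod V M v w)"
    by (subst Sum_any_eq_single[of 0]) (auto simp: mY_simps n o_mod_wtspace[OF u(1)] o_mod_wtspace[OF v])
  moreover have "mY M u (of_int a + of_nat i) w = 0" for i
  proof (rule lspace_negative)
    have "h + of_int a - (of_int a + of_nat i) - 1 = h + of_real (- 1 - real i)"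
      by simp
    then show "mY M u (of_int a + of_nat i) w \<in> lspace V M (h + of_real (- 1 - real i))"
      using mY_lspace[OF u(1) w0, of "of_int a + of_nat i"] by (simp only:)
  qed simp
  ultimately show ?thesis
    using o_mod_vres[OF T_pos(1) u v _ n_def, where p=a and w=w] by (simp add: mY_simps)
qed

lemma circ_g_linear_left: "Vector_Spaces.linear (vscale V) (vscale V) (\<lambda>u. circ_g V T g u v)"
  and circ_g_grade1: "u \<in> grade1 V T g (a, r) \<Longrightarrow> circ_g V T g u v =
     vres V (of_int a - 1 + of_nat (delta1 r) + of_nat r / of_nat T) (1 + int (delta1 r)) u v"
proof -
  let ?G = "\<lambda>i u. vres V (of_int (fst i) - 1 + of_nat (delta1 (snd i)) + of_nat (snd i) / of_nat T)
      (1 + int (delta1 (snd i))) u v"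
  have eq: "circ_g V T g u v = Sum_any (\<lambda>i. ?G i (homog_part (grade1 V T g) i u))" for u
    by (simp only: circ_g_def case_prod_unfold prod.collapse)
  have lin: "Vector_Spaces.linear (vscale V) (vscale V) (?G i)" for i by (rule aut.vres_linear_left)
  show "Vector_Spaces.linear (vscale V) (vscale V) (\<lambda>u. circ_g V T g u v)"
    unfolding eq by (rule linear_Sum_any_homog_part[OF aut.grade1_graded lin])
  show "circ_g V T g u v =
     vres V (of_int a - 1 + of_nat (delta1 r) + of_nat r / of_nat T) (1 + int (delta1 r)) u v"
    if "u \<in> grade1 V T g (a, r)"
    unfolding eq using Sum_any_homog_part_mem[where G="?G", OF aut.grade1_graded lin that] by simp
qed

lemma star_g_linear_left: "Vector_Spaces.linear (vscale V) (vscale V) (\<lambda>u. star_g V T g u v)"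
  and star_g_grade1: "u \<in> grade1 V T g (a, r) \<Longrightarrow>
     star_g V T g u v = (if r = 0 then vres V (of_int a) 1 u v else 0)"
proof -
  let ?G = "\<lambda>i u. if snd i = 0 then vres V (of_int (fst i)) 1 u v else 0"
  have eq: "star_g V T g u v = Sum_any (\<lambda>i. ?G i (homog_part (grade1 V T g) i u))" for u
    by (simp only: star_g_def case_prod_unfold prod.collapse)
  have lin: "Vector_Spaces.linear (vscale V) (vscale V) (?G i)" for i
    by (cases "snd i = 0")
      (auto intro: aut.vres_linear_left linear_zero_map[OF aut.vector_space aut.vector_space])
  show "Vector_Spaces.linear (vscale V) (vscale V) (\<lambda>u. star_g V T g u v)"
    unfolding eq by (rule linear_Sum_any_homog_part[OF aut.grade1_graded lin])
  show "star_g V T g u v = (if r = 0 then vres V (of_int a) 1 u v else 0)"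
    if "u \<in> grade1 V T g (a, r)"
    unfolding eq using Sum_any_homog_part_mem[where G="?G", OF aut.grade1_graded lin that] by simp
qed

lemma grade1_memD:
  assumes "u \<in> grade1 V T g (a, r)"
  shows "u = 0 \<or> r < T \<and> u \<in> wtspace V a \<and> u \<in> eig V T g r"
  using assms by (auto simp: grade1_def split: if_splits)

text \<open>Here p = a - 1 + \<delta>(r) and l = -1 - \<delta>(r), so the two degrees are r/T - 1
  and -(r/T + \<delta>(r)). The shift by \<delta>(r) makes the second one negative when r =
  0.\<close>

lemma o_mod_circ_g:
  assumes w: "w \<in> mdeg V T M h 0"
  shows "o_mod V M (circ_g V T g u v) w = 0"
  using aut.grade1_graded aut.vector_space
proof (induction u rule: graded_induct)
  case (mem i u)
  obtain a r where i: "i = (a, r)" by (cases i)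
  note mem = mem[unfolded i]
  show ?case
  proof (cases "u = 0")
    case True
    then show ?thesis by (simp add: linear_apply[OF o_mod_linear_left] linear_apply[OF circ_g_linear_left])
  next
    case False
    then have u: "r < T" "u \<in> wtspace V a" "u \<in> eig V T g r" using grade1_memD[OF mem] by auto
    have arg: "of_int a - 1 + of_nat (delta1 r) + of_nat r / of_nat T
        = (of_nat r / of_nat T + of_int (a - 1 + int (delta1 r)) :: complex)" by simp
    show ?thesis unfolding circ_g_grade1[OF mem]
      using aut.wtspace_graded aut.vector_space
    proof (induction v rule: graded_induct)
      case (mem b v)
      have "1 + int (delta1 r) = - (- 1 - int (delta1 r))" by simp
      then show ?case unfolding arg
        using u(1) by (simp only:) (rule o_mod_vres_vanishes[OF u mem w],
          auto simp: delta1_def field_simps)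
    qed (auto simp: linear_apply[OF o_mod_linear_left] linear_apply[OF aut.vres_linear_right])
  qed
qed (auto simp: linear_apply[OF o_mod_linear_left] linear_apply[OF circ_g_linear_left])

text \<open>For r = 0 this is the boundary case \<open>o_mod_vres_product\<close>; for r > 0 the
  star product is 0 by definition and o(u) = 0 by \<open>o_mod_eig_nonzero\<close>.\<close>

lemma o_mod_star_g:
  assumes w: "w \<in> mdeg V T M h 0"
  shows "o_mod V M (star_g V T g u v) w = o_mod V M u (o_mod V M v w)"
  using aut.grade1_graded aut.vector_space
proof (induction u rule: graded_induct)
  case (mem i u)
  obtain a r where i: "i = (a, r)" by (cases i)
  note mem = mem[unfolded i]
  consider "u = 0" | "u \<noteq> 0" "r = 0" | "u \<noteq> 0" "0 < r" by auto
  then show ?case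
  proof cases
    case 1
    then show ?thesis by (simp add: linear_apply[OF o_mod_linear_left] linear_apply[OF star_g_linear_left])
  next
    case 2
    then have u: "u \<in> wtspace V a" "u \<in> eig V T g 0" using grade1_memD[OF mem] by auto
    have "star_g V T g u v = vres V (of_int a) 1 u v" using star_g_grade1[OF mem] 2 by simp
    moreover have "o_mod V M (vres V (of_int a) 1 u v) w = o_mod V M u (o_mod V M v w)"
      using aut.wtspace_graded aut.vector_space
    proof (induction v rule: graded_induct)
      case (mem b v)
      show ?case by (rule o_mod_vres_product[OF u mem w])
    qed (auto simp: linear_apply[OF o_mod_linear_left] linear_apply[OF aut.vres_linear_right]
        linear_apply[OF o_mod_linear_right])
    ultimately show ?thesis by simp
  next
    case 3
    then have u: "r < T" "u \<in> wtspace V a" "u \<in> eig V T g r" using grade1_memD[OF mem] by auto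
    have "star_g V T g u v = 0" using star_g_grade1[OF mem] 3 by simp
    then show ?thesis
      using o_mod_eig_nonzero[OF u(2,3) 3(2) u(1)] by (simp add: linear_apply[OF o_mod_linear_left])
  qed
qed (auto simp: linear_apply[OF o_mod_linear_left] linear_apply[OF star_g_linear_left])

text \<open>For u of weight a, L(-1)u has weight a + 1, so its zero mode is (L(-1)u)_a = -a u_{a-1},
  which cancels the zero mode of L(0)u = a u.\<close>

lemma o_mod_Lop_minus1_plus_Lop_0: "o_mod V M (Lop V (-1) u + Lop V 0 u) w = 0"
  using aut.wtspace_graded aut.vector_space
proof (induction u rule: graded_induct)
  case (add x y)
  have "Lop V (-1) (x + y) + Lop V 0 (x + y)
      = (Lop V (-1) x + Lop V 0 x) + (Lop V (-1) y + Lop V 0 y)"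
    by (simp add: linear_apply[OF aut.Lop_linear] add_ac)
  also have "o_mod V M \<dots> w = o_mod V M (Lop V (-1) x + Lop V 0 x) w + o_mod V M (Lop V (-1) y + Lop V 0 y) w"
    by (rule linear_apply(1)[OF o_mod_linear_left])
  finally show ?case by (simp only: add) simp
next
  case (mem a u)
  have "o_mod V M (Lop V (-1) u) w = mscale M (- of_int a) (o_mod V M u w)"
    using o_mod_wtspace[OF aut.Lop_minus1_wtspace[OF mem]] o_mod_wtspace[OF mem]
    by (simp add: mY_Lop_minus1)
  moreover have "o_mod V M (Lop V 0 u) w = mscale M (of_int a) (o_mod V M u w)"
    using mem by (simp add: wtspace_def linear_apply[OF o_mod_linear_left])
  ultimately show ?case by (simp add: linear_apply[OF o_mod_linear_left])
qed (auto simp: linear_apply[OF o_mod_linear_left] linear_apply[OF aut.Lop_linear])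

lemma o_mod_O_g:
  assumes "w \<in> mdeg V T M h 0" "v \<in> O_g V T g"
  shows "o_mod V M v w = 0"
  using assms(2) unfolding O_g_def
  by (rule linear_vanishes_on_span[OF o_mod_linear_left, rotated])
    (use o_mod_circ_g[OF assms(1)] o_mod_Lop_minus1_plus_Lop_0 in auto)

end

section \<open>Zero modes of intertwining operators\<close>

locale intertwining_setting =
  m1: graded_twisted_module V T g1 M1 h1 + m2: graded_twisted_module V T g2 M2 h2 +
  m3: graded_twisted_module V T "g1 \<circ> g2" M3 h3
  for V :: "'v::ab_group_add voa" and T g1 g2
    and M1 :: "('v, 'a::ab_group_add) vmod" and M2 :: "('v, 'b::ab_group_add) vmod"
    and M3 :: "('v, 'c::ab_group_add) vmod" and h1 h2 h3 +
  assumes commute: "g1 \<circ> g2 = g2 \<circ> g1"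
begin

sublocale commuting_automorphisms V T g1 g2
  by unfold_locales (rule commute)

text \<open>Eigenvalues multiply, so exponents add; they are reduced mod T because the axioms for M3
  ask for an exponent below T.\<close>

lemma eig2_eig_comp:
  assumes "u \<in> eig2 V T g1 g2 j1 j2"
  shows "u \<in> eig V T (g1 \<circ> g2) ((j1 + j2) mod T)"
proof -
  let ?e = "\<lambda>j::nat. exp (2 * of_real pi * \<i> * of_nat j / of_nat T) :: complex"
  have e_add: "?e (i + j) = ?e i * ?e j" for i j
    by (simp add: exp_add[symmetric] add_divide_distrib[symmetric] algebra_simps)
  have e_mult: "?e (q * T) = 1" for q
  proof -
    have "?e (q * T) = exp (of_nat q * (2 * of_real pi * \<i>))"
      using m1.T_pos by (simp add: mult_ac)
    then show ?thesis by (simp only: exp_of_nat_mult exp_two_pi_i power_one)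
  qed
  have "?e (j1 + j2) = ?e ((j1 + j2) div T * T + (j1 + j2) mod T)" by simp
  also have "\<dots> = ?e ((j1 + j2) mod T)" by (simp only: e_add e_mult mult_1)
  finally have "?e j1 * ?e j2 = ?e ((j1 + j2) mod T)" by (simp only: e_add)
  then show ?thesis
    using assms linear_apply(2)[OF m1.aut.g_linear]
    by (simp add: eig2_def eig_def mult.commute)
qed

lemma grade2_memD:
  assumes "u \<in> grade2 V T g1 g2 (a, j1, j2)" "u \<noteq> 0"
  shows "j1 < T" "j2 < T" "u \<in> wtspace V a" "u \<in> eig2 V T g1 g2 j1 j2"
  using assms by (auto simp: grade2_def split: if_splits)

section \<open>Bimodule operations on homogeneous vectors\<close>

lemma circ_b_linear_left:
    "Vector_Spaces.linear (vscale V) (mscale M1) (\<lambda>u. circ_b V T g1 g2 M1 u w)"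
  and circ_b_grade2: "u \<in> grade2 V T g1 g2 (a, j1, j2) \<Longrightarrow> circ_b V T g1 g2 M1 u w =
     mres M1 (of_int a - 1 + of_nat (delta1 j2) + of_nat j2 / of_nat T)
       (1 + of_nat (delta2 T j1 j2) - of_nat j1 / of_nat T) u w"
proof -
  let ?G = "\<lambda>i u. mres M1 (of_int (fst i) - 1 + of_nat (delta1 (snd (snd i))) + of_nat (snd (snd i)) / of_nat T)
       (1 + of_nat (delta2 T (fst (snd i)) (snd (snd i))) - of_nat (fst (snd i)) / of_nat T) u w"
  have eq: "circ_b V T g1 g2 M1 u w = Sum_any (\<lambda>i. ?G i (homog_part (grade2 V T g1 g2) i u))" for u
    by (simp only: circ_b_def case_prod_unfold prod.collapse)
  have lin: "Vector_Spaces.linear (vscale V) (mscale M1) (?G i)" for i by (rule m1.mres_linear_left)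
  show "Vector_Spaces.linear (vscale V) (mscale M1) (\<lambda>u. circ_b V T g1 g2 M1 u w)"
    unfolding eq by (rule linear_Sum_any_homog_part[OF grade2_graded lin])
  show "circ_b V T g1 g2 M1 u w =
     mres M1 (of_int a - 1 + of_nat (delta1 j2) + of_nat j2 / of_nat T)
       (1 + of_nat (delta2 T j1 j2) - of_nat j1 / of_nat T) u w"
    if "u \<in> grade2 V T g1 g2 (a, j1, j2)"
    unfolding eq using Sum_any_homog_part_mem[where G="?G", OF grade2_graded lin that] by simp
qed

lemma star_left_linear_left:
    "Vector_Spaces.linear (vscale V) (mscale M1) (\<lambda>u. star_left V T g1 g2 M1 u w)"
  and star_left_grade2: "u \<in> grade2 V T g1 g2 (a, j1, j2) \<Longrightarrow> star_left V T g1 g2 M1 u w =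
     (if (j1 + j2) mod T = 0
      then mres M1 (of_int a - 1 + of_nat (delta1 j2) + of_nat j2 / of_nat T)
            (1 - of_nat j1 / of_nat T) u w else 0)"
proof -
  let ?G = "\<lambda>i u. if (fst (snd i) + snd (snd i)) mod T = 0
      then mres M1 (of_int (fst i) - 1 + of_nat (delta1 (snd (snd i))) + of_nat (snd (snd i)) / of_nat T)
       (1 - of_nat (fst (snd i)) / of_nat T) u w else 0"
  have eq: "star_left V T g1 g2 M1 u w = Sum_any (\<lambda>i. ?G i (homog_part (grade2 V T g1 g2) i u))" for u
    by (simp only: star_left_def case_prod_unfold prod.collapse)
  have lin: "Vector_Spaces.linear (vscale V) (mscale M1) (?G i)" for i
    by (cases "(fst (snd i) + snd (snd i)) mod T = 0")
      (auto intro: m1.mres_linear_left linear_zero_map[OF m1.aut.vector_space m1.vector_space])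
  show "Vector_Spaces.linear (vscale V) (mscale M1) (\<lambda>u. star_left V T g1 g2 M1 u w)"
    unfolding eq by (rule linear_Sum_any_homog_part[OF grade2_graded lin])
  show "star_left V T g1 g2 M1 u w =
     (if (j1 + j2) mod T = 0
      then mres M1 (of_int a - 1 + of_nat (delta1 j2) + of_nat j2 / of_nat T)
            (1 - of_nat j1 / of_nat T) u w else 0)"
    if "u \<in> grade2 V T g1 g2 (a, j1, j2)"
    unfolding eq using Sum_any_homog_part_mem[where G="?G", OF grade2_graded lin that] by simp
qed

lemma star_right_linear_right:
    "Vector_Spaces.linear (vscale V) (mscale M1) (star_right V T g1 g2 M1 w)"
  and star_right_grade2: "u \<in> grade2 V T g1 g2 (a, j1, j2) \<Longrightarrow> star_right V T g1 g2 M1 w u =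
     (if j2 = 0
      then mscale M1 (exp (- (of_nat j1 / of_nat T) * of_real pi * \<i>))
            (mres M1 (of_int a - 1) (1 - of_nat j1 / of_nat T) u w) else 0)"
proof -
  let ?G = "\<lambda>i u. if snd (snd i) = 0
      then mscale M1 (exp (- (of_nat (fst (snd i)) / of_nat T) * of_real pi * \<i>))
        (mres M1 (of_int (fst i) - 1) (1 - of_nat (fst (snd i)) / of_nat T) u w) else 0"
  have eq: "star_right V T g1 g2 M1 w u = Sum_any (\<lambda>i. ?G i (homog_part (grade2 V T g1 g2) i u))" for u
    by (simp only: star_right_def case_prod_unfold prod.collapse)
  have lin: "Vector_Spaces.linear (vscale V) (mscale M1) (?G i)" for i
    by (cases "snd (snd i) = 0")
      (auto intro: linear_scaled m1.mres_linear_left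
        linear_zero_map[OF m1.aut.vector_space m1.vector_space])
  show "Vector_Spaces.linear (vscale V) (mscale M1) (star_right V T g1 g2 M1 w)"
    unfolding eq[abs_def] by (rule linear_Sum_any_homog_part[OF grade2_graded lin])
  show "star_right V T g1 g2 M1 w u =
     (if j2 = 0
      then mscale M1 (exp (- (of_nat j1 / of_nat T) * of_real pi * \<i>))
            (mres M1 (of_int a - 1) (1 - of_nat j1 / of_nat T) u w) else 0)"
    if "u \<in> grade2 V T g1 g2 (a, j1, j2)"
    unfolding eq using Sum_any_homog_part_mem[where G="?G", OF grade2_graded lin that] by simp
qed

end

text \<open>The type variables are renamed on import: \<open>'b\<close>, \<open>'c\<close>,
  \<open>'d\<close> belong to M1, M2, M3.\<close>

locale intertwining_operator = intertwining_setting +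
  fixes I :: "'b \<Rightarrow> complex \<Rightarrow> 'c \<Rightarrow> 'd"
  assumes intertwiner: "I \<in> intertwiners V T g1 g2 M1 M2 M3"
begin

lemma I_linear_left: "Vector_Spaces.linear (mscale M1) (mscale M3) (\<lambda>w1. I w1 n w2)"
  and I_linear_right: "Vector_Spaces.linear (mscale M2) (mscale M3) (I w1 n)"
  and I_Lop_minus1: "I (mL V M1 (-1) w1) n w2 = mscale M3 (- n) (I w1 (n - 1) w2)"
  using intertwiner by (simp_all add: intertwiners_def)

lemmas I_simps = linear_apply[OF I_linear_left] linear_apply[OF I_linear_right]

lemma I_truncation: "\<exists>N::nat. \<forall>i\<ge>N. I w1 (c + of_nat i) w2 = 0"
proof -
  obtain N :: rat where N: "\<forall>q\<ge>N. I w1 (c + of_rat q) w2 = 0"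
    using intertwiner unfolding intertwiners_def by blast
  have "I w1 (c + of_nat i) w2 = 0" if "i \<ge> nat \<lceil>N\<rceil>" for i
  proof -
    have "N \<le> of_nat i" using that by (simp add: nat_le_iff ceiling_le_iff)
    then show ?thesis using N[rule_format, of "of_nat i"] by simp
  qed
  then show ?thesis by blast
qed

lemma I_jacobi:
  assumes "j1 < T" "j2 < T" "u \<in> eig2 V T g1 g2 j1 j2"
    "l = of_nat j1 / of_nat T + of_int k" "m = of_nat j2 / of_nat T + of_int p"
  shows "Sum_any (\<lambda>i::nat. mscale M3 ((-1) ^ i * (l gchoose i))
            (mY M3 u (m + l - of_nat i) (I w1 (n + of_nat i) w2)))
        - mscale M3 (exp (of_nat j1 / of_nat T * of_real pi * \<i>) * (-1) powi k)
            (Sum_any (\<lambda>i::nat. mscale M3 ((-1) ^ i * (l gchoose i))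
              (I w1 (n + l - of_nat i) (mY M2 u (m + of_nat i) w2))))
        = Sum_any (\<lambda>i::nat. mscale M3 (m gchoose i)
            (I (mY M1 u (l + of_nat i) w1) (m + n - of_nat i) w2))"
  using intertwiner assms unfolding intertwiners_def Let_def by blast

text \<open>The commutator with L(0) once more: \<open>conf V\<close> is fixed by g1 and g2, so j1 =
  j2 = 0, and l = 0, m = 1 leave L(0) on M3 and M2 against L(-1) and L(0) on M1.\<close>

lemma I_lspace:
  assumes w: "w1 \<in> lspace V M1 x" "w2 \<in> lspace V M2 y"
  shows "I w1 n w2 \<in> lspace V M3 (x + y - n - 1)"
proof -
  have conf: "conf V \<in> eig2 V T g1 g2 0 0"
    using m1.aut.conf_eig m2.aut.conf_eig by (simp add: eig2_def)
  have "Sum_any (\<lambda>i::nat. mscale M3 ((-1) ^ i * (0 gchoose i))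
            (mY M3 (conf V) (1 + 0 - of_nat i) (I w1 (n + of_nat i) w2))) = mL V M3 0 (I w1 n w2)"
    by (subst Sum_any_eq_single[of 0]) (auto simp: gbinomial_0_left mL_def)
  moreover have "Sum_any (\<lambda>i::nat. mscale M3 ((-1) ^ i * (0 gchoose i))
              (I w1 (n + 0 - of_nat i) (mY M2 (conf V) (1 + of_nat i) w2))) = I w1 n (mL V M2 0 w2)"
    by (subst Sum_any_eq_single[of 0]) (auto simp: gbinomial_0_left mL_def)
  moreover have "Sum_any (\<lambda>i::nat. mscale M3 (1 gchoose i)
            (I (mY M1 (conf V) (0 + of_nat i) w1) (1 + n - of_nat i) w2))
     = I (mL V M1 (-1) w1) (1 + n) w2 + I (mL V M1 0 w1) n w2"
    by (subst Sum_any_eq_sum[of "{..<2}"]) (auto simp: gbinomial_1_left mL_def numeral_2_eq_2)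
  ultimately have "mL V M3 0 (I w1 n w2) - I w1 n (mL V M2 0 w2)
      = I (mL V M1 (-1) w1) (1 + n) w2 + I (mL V M1 0 w1) n w2"
    using I_jacobi[OF m1.T_pos(1) m1.T_pos(1) conf, where l=0 and m=1 and k=0 and p=1 and n=n
        and ?w1.0=w1 and ?w2.0=w2]
    by simp
  then have "mL V M3 0 (I w1 n w2) = mscale M3 y (I w1 n w2)
      + (mscale M3 (- (1 + n)) (I w1 n w2) + mscale M3 x (I w1 n w2))"
    using w unfolding I_Lop_minus1 by (simp add: lspace_def I_simps algebra_simps)
  also have "\<dots> = mscale M3 (x + y - n - 1) (I w1 n w2)"
    unfolding m3.ms.scale_left_distrib[symmetric] by (simp add: algebra_simps)
  finally show ?thesis by (simp add: lspace_def)
qed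

section \<open>The zero mode o_I and its degree counts\<close>

abbreviation oI :: "'b \<Rightarrow> 'c \<Rightarrow> 'd" where
  "oI \<equiv> o_int V T M1 h1 h2 h3 I"

lemma oI_linear_left: "Vector_Spaces.linear (mscale M1) (mscale M3) (\<lambda>w1. oI w1 w2)"
  unfolding o_int_def I_circ_def by (rule linear_Sum_any_homog_part[OF m1.mdeg_graded I_linear_left])

lemma oI_linear_right: "Vector_Spaces.linear (mscale M2) (mscale M3) (oI w1)"
  unfolding o_int_def I_circ_def
  by (intro linear_Sum_any I_linear_right m2.vector_space m3.vector_space
      finite_subset[OF _ homog_part_decomposition(2)[OF m1.mdeg_graded m1.vector_space, of w1]])
    (auto simp: I_simps)

text \<open>The weight x replaces the degree of w1. In this form the formula applies to every
  u_{l+i} w1, whose weight is known without asking which degree it has; the zero vector may have any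
  weight.\<close>

lemma oI_lspace:
  assumes "w1 \<in> lspace V M1 x"
  shows "oI w1 w2 = I w1 (x + h2 - h3 - 1) w2"
proof (cases "w1 = 0")
  case True
  then show ?thesis by (simp add: linear_apply[OF oI_linear_left] I_simps)
next
  case False
  then obtain n where n: "x = h1 + of_nat n / of_nat T" "w1 \<in> mdeg V T M1 h1 n"
    using m1.lspace_weight[OF assms] by blast
  have "oI w1 w2 = I w1 (of_nat n / of_nat T - 1 + h1 + h2 - h3) w2"
    unfolding o_int_def I_circ_def
    by (rule Sum_any_homog_part_mem[OF m1.mdeg_graded I_linear_left n(2)])
  then show ?thesis by (simp add: n(1) algebra_simps)
qed

lemma oI_mdeg_0:
  assumes "w2 \<in> mdeg V T M2 h2 0"
  shows "oI w1 w2 \<in> mdeg V T M3 h3 0"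
  using m1.mdeg_graded m1.vector_space
proof (induction w1 rule: graded_induct)
  case (mem d w1)
  then have w1: "w1 \<in> lspace V M1 (h1 + of_nat d / of_nat T)" by (simp add: mdeg_def)
  show ?case
    using I_lspace[OF w1, of w2 h2 "h1 + of_nat d / of_nat T + h2 - h3 - 1"] assms
    by (simp add: oI_lspace[OF w1] mdeg_def)
qed (use m3.lspace_subspace[of h3] in \<open>auto simp: linear_apply[OF oI_linear_left] mdeg_def
    m3.ms.subspace_0 m3.ms.subspace_add\<close>)

text \<open>The choice of n makes m + n - i the zero-mode index of u_{l+i} w1, namely its weight x +
  a - (l+i) - 1 plus h2 - h3 - 1. The right side of the Jacobi identity is then o_I of the
  residue.\<close>

lemma oI_mres:
  assumes u: "j1 < T" "j2 < T" "u \<in> wtspace V a" "u \<in> eig2 V T g1 g2 j1 j2"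
    and w1: "w1 \<in> lspace V M1 x"
    and l: "l = of_nat j1 / of_nat T + of_int k" and m: "m = of_nat j2 / of_nat T + of_int p"
    and n: "n = x + of_int a - l - m - 2 + h2 - h3"
  shows "oI (mres M1 m (- l) u w1) w2 =
    Sum_any (\<lambda>i::nat. mscale M3 ((-1) ^ i * (l gchoose i))
            (mY M3 u (m + l - of_nat i) (I w1 (n + of_nat i) w2)))
        - mscale M3 (exp (of_nat j1 / of_nat T * of_real pi * \<i>) * (-1) powi k)
            (Sum_any (\<lambda>i::nat. mscale M3 ((-1) ^ i * (l gchoose i))
              (I w1 (n + l - of_nat i) (mY M2 u (m + of_nat i) w2))))"
proof -
  have "oI (mres M1 m (- l) u w1) w2
      = Sum_any (\<lambda>i::nat. oI (mscale M1 (m gchoose i) (mY M1 u (of_nat i - (- l)) w1)) w2)"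
    unfolding mres_def
    by (rule Sum_any_linear[OF oI_linear_left], rule finite_subset[OF _ m1.mY_support'[of u "-l" w1]]) auto
  also have "\<dots> = Sum_any (\<lambda>i::nat. mscale M3 (m gchoose i)
            (I (mY M1 u (l + of_nat i) w1) (m + n - of_nat i) w2))"
  proof (rule Sum_any.cong)
    fix i :: nat
    have "oI (mY M1 u (l + of_nat i) w1) w2
        = I (mY M1 u (l + of_nat i) w1) (x + of_int a - (l + of_nat i) - 1 + h2 - h3 - 1) w2"
      by (rule oI_lspace[OF m1.mY_lspace[OF u(3) w1]])
    also have "x + of_int a - (l + of_nat i) - 1 + h2 - h3 - 1 = m + n - of_nat i"
      by (simp add: n)
    finally show "oI (mscale M1 (m gchoose i) (mY M1 u (of_nat i - (- l)) w1)) w2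
        = mscale M3 (m gchoose i) (I (mY M1 u (l + of_nat i) w1) (m + n - of_nat i) w2)"
      by (simp add: linear_apply[OF oI_linear_left] add.commute)
  qed
  finally show ?thesis using I_jacobi[OF u(1,2,4) l m] by simp
qed

text \<open>Subtracting i from the left side of \<open>neg\<close> gives the degree of the vector in
  M3; \<open>mY_negative\<close> is the analogous count for u_{m+i} w2 in M2.\<close>

lemma I_negative:
  assumes w: "w1 \<in> lspace V M1 x" "w2 \<in> mdeg V T M2 h2 0"
    and n: "n = x + of_int a - l - m - 2 + h2 - h3"
    and l: "l = of_nat j1 / of_nat T + of_int k" and m: "m = of_nat j2 / of_nat T + of_int p"
    and neg: "real (j1 + j2) / real T + of_int (k + p + 1 - a) < real i"
  shows "I w1 (n + of_nat i) w2 = 0"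
proof (rule m3.lspace_negative)
  have "x + h2 - (n + of_nat i) - 1
      = h3 + of_real (real (j1 + j2) / real T + of_int (k + p + 1 - a) - real i)"
    by (simp add: n l m algebra_simps add_divide_distrib)
  then show "I w1 (n + of_nat i) w2
      \<in> lspace V M3 (h3 + of_real (real (j1 + j2) / real T + of_int (k + p + 1 - a) - real i))"
    using I_lspace[OF w(1), of w2 h2 "n + of_nat i"] w(2)[unfolded mdeg_def]
    by (simp only: of_nat_0 div_0 add_0_right)
qed (use neg in simp)

lemma mY_negative:
  assumes u: "u \<in> wtspace V a" and w: "w2 \<in> mdeg V T M2 h2 0"
    and m: "m = of_nat j2 / of_nat T + of_int p"
    and neg: "of_int (a - 1 - p) - real j2 / real T < real i"
  shows "mY M2 u (m + of_nat i) w2 = 0"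
proof (rule m2.lspace_negative)
  have "h2 + of_int a - (m + of_nat i) - 1
      = h2 + of_real (of_int (a - 1 - p) - real j2 / real T - real i)"
    by (simp add: m algebra_simps)
  then show "mY M2 u (m + of_nat i) w2
      \<in> lspace V M2 (h2 + of_real (of_int (a - 1 - p) - real j2 / real T - real i))"
    using m2.mY_lspace[OF u, of w2 h2 "m + of_nat i"] w[unfolded mdeg_def]
    by (simp only: of_nat_0 div_0 add_0_right)
qed (use neg in simp)

lemma oI_mres_vanishes:
  assumes u: "j1 < T" "j2 < T" "u \<in> wtspace V a" "u \<in> eig2 V T g1 g2 j1 j2"
    and w: "w1 \<in> lspace V M1 x" "w2 \<in> mdeg V T M2 h2 0"
    and l: "l = of_nat j1 / of_nat T + of_int k" and m: "m = of_nat j2 / of_nat T + of_int p"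
    and e: "real (j1 + j2) / real T + of_int (k + p + 1 - a) < 0"
    and f: "of_int (a - 1 - p) - real j2 / real T < 0"
  shows "oI (mres M1 m (- l) u w1) w2 = 0"
proof -
  define n where "n = x + of_int a - l - m - 2 + h2 - h3"
  have "I w1 (n + of_nat i) w2 = 0" for i
    by (rule I_negative[OF w n_def l m]) (use e in linarith)
  moreover have "mY M2 u (m + of_nat i) w2 = 0" for i
    by (rule mY_negative[OF u(3) w(2) m]) (use f in linarith)
  ultimately show ?thesis
    using oI_mres[OF u w(1) l m n_def, of w2] by (simp add: I_simps m3.mY_simps)
qed

text \<open>At degree 0 the indices become m + l = a - 1 and n = x + h2 - h3 - 1, the zero-mode
  indices of u and of w1. The terms with i > 0 have negative degree.\<close>

lemma oI_mres_left:
  assumes u: "j1 < T" "j2 < T" "u \<in> wtspace V a" "u \<in> eig2 V T g1 g2 j1 j2"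
    and w: "w1 \<in> lspace V M1 x" "w2 \<in> mdeg V T M2 h2 0"
    and l: "l = of_nat j1 / of_nat T + of_int k" and m: "m = of_nat j2 / of_nat T + of_int p"
    and e: "real (j1 + j2) / real T + of_int (k + p + 1 - a) = 0"
    and f: "of_int (a - 1 - p) - real j2 / real T < 0"
  shows "oI (mres M1 m (- l) u w1) w2 = o_mod V M3 u (oI w1 w2)"
proof -
  define n where "n = x + of_int a - l - m - 2 + h2 - h3"
  have "of_real (real (j1 + j2) / real T + of_int (k + p + 1 - a)) = (0 :: complex)"
    by (simp only: e of_real_0)
  then have ml: "m + l = of_int a - 1" by (simp add: l m algebra_simps add_divide_distrib)
  then have "m = of_int a - 1 - l" by (simp add: algebra_simps)
  then have n: "n = x + h2 - h3 - 1" by (simp add: n_def)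
  have "I w1 (n + of_nat i) w2 = 0" if "i \<noteq> 0" for i
    by (rule I_negative[OF w n_def l m]) (use e that in simp)
  then have "Sum_any (\<lambda>i::nat. mscale M3 ((-1) ^ i * (l gchoose i))
            (mY M3 u (m + l - of_nat i) (I w1 (n + of_nat i) w2))) = mY M3 u (m + l) (I w1 n w2)"
    by (subst Sum_any_eq_single[of 0]) (auto simp: m3.mY_simps)
  moreover have "mY M2 u (m + of_nat i) w2 = 0" for i
    by (rule mY_negative[OF u(3) w(2) m]) (use f in linarith)
  ultimately show ?thesis
    using oI_mres[OF u w(1) l m n_def, of w2]
    by (simp add: I_simps ml n oI_lspace[OF w(1)] m3.o_mod_wtspace[OF u(3)])
qed

text \<open>With k = -1 and p = a - 1 the vector I(w1)_n w2 has degree j1/T - 1 < 0, and u_m w2 has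
  degree 0. The sign (-1)^k cancels the minus in front of the second sum and leaves the
  phase.\<close>

lemma oI_mres_right:
  assumes u: "j1 < T" "0 < T" "u \<in> wtspace V a" "u \<in> eig2 V T g1 g2 j1 0"
    and w: "w1 \<in> lspace V M1 x" "w2 \<in> mdeg V T M2 h2 0"
  shows "oI (mres M1 (of_int a - 1) (1 - of_nat j1 / of_nat T) u w1) w2
    = mscale M3 (exp (of_nat j1 / of_nat T * of_real pi * \<i>)) (oI w1 (o_mod V M2 u w2))"
proof -
  define l where "l = of_nat j1 / of_nat T + (of_int (-1) :: complex)"
  define m where "m = (of_int a - 1 :: complex)"
  define n where "n = x + of_int a - l - m - 2 + h2 - h3"
  have m: "m = of_nat 0 / of_nat T + of_int (a - 1)" by (simp add: m_def)
  have n: "n + l = x + h2 - h3 - 1" by (simp add: n_def m_def)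
  have "real j1 / real T < 1" using u(1) by simp
  then have "I w1 (n + of_nat i) w2 = 0" for i
    by (intro I_negative[OF w n_def l_def m]) simp
  moreover have "mY M2 u (m + of_nat i) w2 = 0" if "i \<noteq> 0" for i
    by (rule mY_negative[OF u(3) w(2) m]) (use that in simp)
  then have "Sum_any (\<lambda>i::nat. mscale M3 ((-1) ^ i * (l gchoose i))
              (I w1 (n + l - of_nat i) (mY M2 u (m + of_nat i) w2))) = I w1 (n + l) (mY M2 u m w2)"
    by (subst Sum_any_eq_single[of 0]) (auto simp: I_simps)
  moreover have "- l = 1 - of_nat j1 / of_nat T" by (simp add: l_def)
  ultimately show ?thesis
    using oI_mres[OF u w(1) l_def m n_def, of w2]
    by (simp add: m3.mY_simps n oI_lspace[OF w(1)] m2.o_mod_wtspace[OF u(3)] m_def)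
qed

text \<open>The exponents give k + p + 1 - a = \<delta>(j2) - \<delta>(j1,j2) - 1. For j2 = 0 the
  first degree is j1/T - 1; otherwise it is (j1+j2)/T - 2 or (j1+j2)/T - 1, according to whether j1
  + j2 \<ge> T. The second degree is -\<delta>(j2) - j2/T. All of these are negative.\<close>

lemma oI_circ_b:
  assumes w2: "w2 \<in> mdeg V T M2 h2 0"
  shows "oI (circ_b V T g1 g2 M1 u w1) w2 = 0"
  using grade2_graded m1.aut.vector_space
proof (induction u rule: graded_induct)
  case (mem i u)
  obtain a j1 j2 where i: "i = (a, j1, j2)" by (cases i)
  note mem = mem[unfolded i]
  show ?case
  proof (cases "u = 0")
    case True
    then show ?thesis by (simp add: linear_apply[OF oI_linear_left] linear_apply[OF circ_b_linear_left])
  next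
    case False
    note u = grade2_memD[OF mem False]
    have arg: "of_int a - 1 + of_nat (delta1 j2) + of_nat j2 / of_nat T
        = (of_nat j2 / of_nat T + of_int (a - 1 + int (delta1 j2)) :: complex)"
      "1 + of_nat (delta2 T j1 j2) - of_nat j1 / of_nat T
        = - (of_nat j1 / of_nat T + of_int (- 1 - int (delta2 T j1 j2)) :: complex)" by simp_all
    show ?thesis unfolding circ_b_grade2[OF mem] arg
      using m1.mdeg_graded m1.vector_space
    proof (induction w1 rule: graded_induct)
      case (mem d w1)
      then have w1: "w1 \<in> lspace V M1 (h1 + of_nat d / of_nat T)" by (simp add: mdeg_def)
      show ?case
        by (rule oI_mres_vanishes[OF u w1 w2 refl refl])
          (use u(1,2) in \<open>auto simp: delta1_def delta2_def divide_simps\<close>)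
    qed (auto simp: linear_apply[OF oI_linear_left] linear_apply[OF m1.mres_linear_right])
  qed
qed (auto simp: linear_apply[OF oI_linear_left] linear_apply[OF circ_b_linear_left])

text \<open>The first degree is now (j1+j2)/T + \<delta>(j2) - 1, which is 0 both for j1 = j2 = 0
  and for j1 + j2 = T. In the remaining cases the product is 0 by definition, and o(u) vanishes on
  M3 because g1 g2 acts on u by a nontrivial eigenvalue.\<close>

lemma oI_star_left:
  assumes w2: "w2 \<in> mdeg V T M2 h2 0"
  shows "oI (star_left V T g1 g2 M1 u w1) w2 = o_mod V M3 u (oI w1 w2)"
  using grade2_graded m1.aut.vector_space
proof (induction u rule: graded_induct)
  case (mem i u)
  obtain a j1 j2 where i: "i = (a, j1, j2)" by (cases i)
  note mem = mem[unfolded i]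
  consider "u = 0" | "u \<noteq> 0" "(j1 + j2) mod T = 0" | "u \<noteq> 0" "0 < (j1 + j2) mod T" by auto
  then show ?case
  proof cases
    case 1
    then show ?thesis
      by (simp add: linear_apply[OF oI_linear_left] linear_apply[OF star_left_linear_left]
          linear_apply[OF m3.o_mod_linear_left])
  next
    case 2
    note u = grade2_memD[OF mem 2(1)]
    \<comment> \<open>Both exponents are below T, so a sum divisible by T is 0 or T. In the latter
      case j1 < T forces j2 \<noteq> 0, hence \<delta>(j2) = 0.\<close>
    have sum: "j1 = 0 \<and> j2 = 0 \<or> j2 \<noteq> 0 \<and> j1 + j2 = T"
    proof -
      have "(j1 + j2) div T < 2" using u(1,2) by (intro less_mult_imp_div_less) simp
      then have "(j1 + j2) div T = 0 \<or> (j1 + j2) div T = 1" by linarith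
      moreover have "j1 + j2 = (j1 + j2) div T * T" using 2(2) div_mult_mod_eq[of "j1 + j2" T] by simp
      ultimately have "j1 + j2 = 0 \<or> j1 + j2 = T" by (metis mult_1 mult_zero_left)
      then show ?thesis using u(1) by auto
    qed
    have arg: "of_int a - 1 + of_nat (delta1 j2) + of_nat j2 / of_nat T
        = (of_nat j2 / of_nat T + of_int (a - 1 + int (delta1 j2)) :: complex)"
      "1 - of_nat j1 / of_nat T = - (of_nat j1 / of_nat T + of_int (- 1) :: complex)" by simp_all
    have "star_left V T g1 g2 M1 u w1
        = mres M1 (of_int a - 1 + of_nat (delta1 j2) + of_nat j2 / of_nat T) (1 - of_nat j1 / of_nat T) u w1"
      using star_left_grade2[OF mem] 2 by simp
    moreover have "oI (mres M1 (of_int a - 1 + of_nat (delta1 j2) + of_nat j2 / of_nat T)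
        (1 - of_nat j1 / of_nat T) u w1) w2 = o_mod V M3 u (oI w1 w2)"
      unfolding arg using m1.mdeg_graded m1.vector_space
    proof (induction w1 rule: graded_induct)
      case (mem d w1)
      then have w1: "w1 \<in> lspace V M1 (h1 + of_nat d / of_nat T)" by (simp add: mdeg_def)
      show ?case
        by (rule oI_mres_left[OF u w1 w2 refl refl])
          (use u(1,2) sum in \<open>auto simp: delta1_def divide_simps\<close>)
    qed (auto simp: linear_apply[OF oI_linear_left] linear_apply[OF m1.mres_linear_right]
        linear_apply[OF m3.o_mod_linear_right])
    ultimately show ?thesis by simp
  next
    case 3
    note u = grade2_memD[OF mem 3(1)]
    have "star_left V T g1 g2 M1 u w1 = 0" using star_left_grade2[OF mem] 3 by simp
    moreover have "o_mod V M3 u (oI w1 w2) = 0"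
      using m3.o_mod_eig_nonzero[OF u(3) eig2_eig_comp[OF u(4)] 3(2)] m1.T_pos by simp
    ultimately show ?thesis by (simp add: linear_apply[OF oI_linear_left])
  qed
qed (auto simp: linear_apply[OF oI_linear_left] linear_apply[OF star_left_linear_left]
    linear_apply[OF m3.o_mod_linear_left])

text \<open>The exponential factor in \<open>star_right\<close> undoes the phase of
  \<open>oI_mres_right\<close>. For j2 > 0 both sides vanish, as o(u) = 0 on M2.\<close>

lemma oI_star_right:
  assumes w2: "w2 \<in> mdeg V T M2 h2 0"
  shows "oI (star_right V T g1 g2 M1 w1 u) w2 = oI w1 (o_mod V M2 u w2)"
  using grade2_graded m1.aut.vector_space
proof (induction u rule: graded_induct)
  case (mem i u)
  obtain a j1 j2 where i: "i = (a, j1, j2)" by (cases i)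
  note mem = mem[unfolded i]
  consider "u = 0" | "u \<noteq> 0" "j2 = 0" | "u \<noteq> 0" "0 < j2" by auto
  then show ?case
  proof cases
    case 1
    then show ?thesis
      by (simp add: linear_apply[OF oI_linear_left] linear_apply[OF oI_linear_right]
          linear_apply[OF star_right_linear_right] linear_apply[OF m2.o_mod_linear_left])
  next
    case 2
    note u = grade2_memD[OF mem 2(1), unfolded 2(2)]
    have "oI (mres M1 (of_int a - 1) (1 - of_nat j1 / of_nat T) u w1) w2
      = mscale M3 (exp (of_nat j1 / of_nat T * of_real pi * \<i>)) (oI w1 (o_mod V M2 u w2))"
      using m1.mdeg_graded m1.vector_space
    proof (induction w1 rule: graded_induct)
      case (mem d w1)
      then have w1: "w1 \<in> lspace V M1 (h1 + of_nat d / of_nat T)" by (simp add: mdeg_def)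
      show ?case by (rule oI_mres_right[OF u w1 w2])
    qed (auto simp: linear_apply[OF oI_linear_left] linear_apply[OF m1.mres_linear_right]
        m3.ms.scale_right_distrib)
    then show ?thesis
      using star_right_grade2[OF mem, of w1] 2
      by (simp add: linear_apply[OF oI_linear_left] exp_add[symmetric])
  next
    case 3
    note u = grade2_memD[OF mem 3(1)]
    have "star_right V T g1 g2 M1 w1 u = 0" using star_right_grade2[OF mem] 3 by simp
    moreover have "o_mod V M2 u w2 = 0"
      using m2.o_mod_eig_nonzero[OF u(3) _ 3(2) u(2)] u(4) by (simp add: eig2_def)
    ultimately show ?thesis
      by (simp add: linear_apply[OF oI_linear_left] linear_apply[OF oI_linear_right])
  qed
qed (auto simp: linear_apply[OF oI_linear_left] linear_apply[OF oI_linear_right]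
    linear_apply[OF star_right_linear_right] linear_apply[OF m2.o_mod_linear_left])

text \<open>O' is covered by \<open>oI_circ_b\<close>. On the generators of O'' the actions become
  compositions of zero modes; these cancel because o turns the star product of A_g(V) into
  composition and kills O_g(V) on the bottom level, which o(u) and o_I respect.\<close>

lemma oI_O_b:
  assumes w2: "w2 \<in> mdeg V T M2 h2 0" and w: "w \<in> O_b V T g1 g2 M1"
  shows "oI w w2 = 0"
proof -
  note deg = m2.o_mod_mdeg_0[OF w2]
  have "oI x w2 = 0" if "x \<in> O_b' V T g1 g2 M1" for x
    using that unfolding O_b'_def
    by (rule linear_vanishes_on_span[OF oI_linear_left, rotated]) (use oI_circ_b[OF w2] in auto)
  moreover have "oI x w2 = 0" if "x \<in> O_b'' V T g1 g2 M1" for x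
    using that unfolding O_b''_def Let_def
    by (rule linear_vanishes_on_span[OF oI_linear_left, rotated])
      (auto simp: linear_apply(4)[OF oI_linear_left] oI_star_left[OF w2] oI_star_right[OF w2]
        oI_star_right[OF deg] m2.o_mod_star_g[OF w2] m3.o_mod_star_g[OF oI_mdeg_0[OF w2]]
        m2.o_mod_O_g[OF w2] m3.o_mod_O_g[OF oI_mdeg_0[OF w2]] linear_apply(3)[OF oI_linear_right])
  ultimately show ?thesis
    using w by (auto simp: O_b_def set_plus_def linear_apply(1)[OF oI_linear_left])
qed

end

section \<open>Vanishing of intertwining operators\<close>

lemma Sum_any_in_subspace:
  assumes "vector_space s" "module.subspace s S" "\<And>i. f i \<in> S"
  shows "Sum_any f \<in> S"
proof -
  interpret vector_space s by fact
  show ?thesis unfolding Sum_any.expand_set by (intro subspace_sum assms)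
qed

lemma Sum_any_add_scale:
  assumes "vector_space s" "finite {i. f i \<noteq> 0}" "finite {i. g i \<noteq> 0}"
  shows "Sum_any (\<lambda>i. f i + s c (g i)) = Sum_any f + s c (Sum_any g)"
proof -
  interpret vector_space s by fact
  have lin: "Vector_Spaces.linear s s (s c)"
    by (rule linearI) (auto simp: assms scale_right_distrib mult.commute)
  have "finite {i. s c (g i) \<noteq> 0}" by (rule finite_subset[OF _ assms(3)]) auto
  then show ?thesis by (simp add: Sum_any.distrib[OF assms(2)] Sum_any_linear[OF lin assms(3)])
qed

context intertwining_operator
begin

text \<open>\<open>Sum_any\<close> returns 0 on infinite support, so a Jacobi sum for I + c J can be
  split only once both parts are known to have finite support.\<close>

lemma I_jacobi_supports:
  "finite {i::nat. mscale M3 (c i) (mY M3 u (x i) (I w1 (n + of_nat i) w2)) \<noteq> 0}"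
  "finite {i::nat. mscale M3 (c i) (I w1 (x i) (mY M2 u (n + of_nat i) w2)) \<noteq> 0}"
  "finite {i::nat. mscale M3 (c i) (I (mY M1 u (n + of_nat i) w1) (x i) w2) \<noteq> 0}"
proof -
  obtain N where "\<forall>i\<ge>N. I w1 (n + of_nat i) w2 = 0" using I_truncation by blast
  then have "{i::nat. mscale M3 (c i) (mY M3 u (x i) (I w1 (n + of_nat i) w2)) \<noteq> 0} \<subseteq> {..<N}"
    by (force simp: not_le[symmetric] m3.mY_simps)
  then show "finite {i::nat. mscale M3 (c i) (mY M3 u (x i) (I w1 (n + of_nat i) w2)) \<noteq> 0}"
    by (rule finite_subset) simp
  show "finite {i::nat. mscale M3 (c i) (I w1 (x i) (mY M2 u (n + of_nat i) w2)) \<noteq> 0}"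
    by (rule finite_subset[OF _ m2.mY_support[of u n w2]]) (auto simp: I_simps)
  show "finite {i::nat. mscale M3 (c i) (I (mY M1 u (n + of_nat i) w1) (x i) w2) \<noteq> 0}"
    by (rule finite_subset[OF _ m1.mY_support[of u n w1]]) (auto simp: I_simps)
qed

text \<open>At most K of the vectors I(w1)_{n+i} w2 are nonzero. The Jacobi identity expresses u_s
  I(w1)_n w2 through generators and through u_{s-i} I(w1)_{n+i} w2 with i > 0, whose bound is
  smaller; hence both n and s vary in the induction.\<close>

lemma mY_I_in_span:
  assumes u: "j1 < T" "j2 < T" "u \<in> eig2 V T g1 g2 j1 j2" and w2: "w2 \<in> S"
    and "\<forall>i\<ge>K. I w1 (n + of_nat i) w2 = 0"
  shows "mY M3 u s (I w1 n w2) \<in> m3.ms.span {I w1 n w2 | w1 n w2. w2 \<in> S}"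
  using assms(5)
proof (induction K arbitrary: n s)
  case 0
  then have "I w1 n w2 = 0" using 0[rule_format, of 0] by simp
  then show ?case by (simp add: m3.mY_simps m3.ms.span_zero)
next
  case (Suc K)
  let ?N = "m3.ms.span {I w1 n w2 | w1 n w2. w2 \<in> S}"
  show ?case
  proof (cases "s - of_nat ((j1 + j2) mod T) / of_nat T \<in> \<int>")
    case False
    have "(j1 + j2) mod T < T" using m1.T_pos by simp
    from m3.exponents[OF this eig2_eig_comp[OF u(3)] False] show ?thesis
      by (simp add: m3.ms.span_zero)
  next
    case True
    then obtain q where q: "s - of_nat ((j1 + j2) mod T) / of_nat T = of_int q"
      by (auto elim: Ints_cases)
    \<comment> \<open>The exponent of u on M3 is reduced mod T, whereas m + l involves j1/T + j2/T;
      d is the carry between them.\<close>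
    define d where "d = (j1 + j2) div T"
    have "j1 + j2 = d * T + (j1 + j2) mod T" by (simp add: d_def)
    then have "(of_nat (j1 + j2) :: complex) = of_nat (d * T + (j1 + j2) mod T)" by simp
    then have "(of_nat ((j1 + j2) mod T) :: complex) = of_nat j1 + of_nat j2 - of_nat d * of_nat T"
      by simp
    then have s: "s = of_nat j1 / of_nat T + of_nat j2 / of_nat T + of_int (q - int d)"
      using q m1.T_pos by (simp add: field_simps)
    have "u \<in> eig V T g2 j2" using u(3) by (simp add: eig2_def)
    then obtain p where p: "\<forall>k\<ge>p. mY M2 u (of_nat j2 / of_nat T + of_int k) w2 = 0"
      using m2.truncation[OF u(2)] by blast
    \<comment> \<open>Only the sum m + l = s is prescribed, so m can be raised until u_{m+i} w2 = 0
      for all i \<ge> 0 while l absorbs the difference.\<close>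
    define m where "m = of_nat j2 / of_nat T + (of_int p :: complex)"
    define l where "l = of_nat j1 / of_nat T + (of_int (q - int d - p) :: complex)"
    have ml: "m + l = s" by (simp add: m_def l_def s)
    have "mY M2 u (m + of_nat i) w2 = 0" for i
      using p[rule_format, of "p + int i"] by (simp add: m_def add.assoc)
    then have jac: "Sum_any (\<lambda>i::nat. mscale M3 ((-1) ^ i * (l gchoose i))
            (mY M3 u (s - of_nat i) (I w1 (n + of_nat i) w2)))
        = Sum_any (\<lambda>i::nat. mscale M3 (m gchoose i)
            (I (mY M1 u (l + of_nat i) w1) (m + n - of_nat i) w2))"
      using I_jacobi[OF u l_def m_def, of w1 n w2] by (simp add: I_simps ml)
    let ?f = "\<lambda>i::nat. mscale M3 ((-1) ^ i * (l gchoose i))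
            (mY M3 u (s - of_nat i) (I w1 (n + of_nat i) w2))"
    have total: "Sum_any ?f \<in> ?N" unfolding jac
      by (rule Sum_any_in_subspace[OF m3.vector_space m3.ms.subspace_span],
          intro m3.ms.span_scale m3.ms.span_base) (use w2 in blast)
    have "Sum_any ?f = sum ?f {..<Suc K}"
      using Suc.prems by (intro Sum_any_eq_sum) (auto simp: m3.mY_simps not_less)
    also have "\<dots> = ?f 0 + (\<Sum>i<K. ?f (Suc i))" by (rule sum.lessThan_Suc_shift)
    finally have f0: "?f 0 = Sum_any ?f - (\<Sum>i<K. ?f (Suc i))" by simp
    have rest: "(\<Sum>i<K. ?f (Suc i)) \<in> ?N"
    proof (intro m3.ms.span_sum m3.ms.span_scale Suc.IH allI impI)
      fix i j assume "K \<le> j"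
      then have "Suc K \<le> Suc i + j" by simp
      from Suc.prems[rule_format, OF this] show "I w1 (n + of_nat (Suc i) + of_nat j) w2 = 0" by (simp only: of_nat_add add.assoc)
    qed
    have "?f 0 \<in> ?N" unfolding f0 by (rule m3.ms.span_diff[OF total rest])
    then show ?thesis by simp
  qed
qed

lemma span_I_submodule: "is_submodule M3 (m3.ms.span {I w1 n w2 | w1 n w2. w2 \<in> S})"
proof -
  let ?N = "m3.ms.span {I w1 n w2 | w1 n w2. w2 \<in> S}"
  have gens: "mY M3 u s (I w1 n w2) \<in> ?N" if w2: "w2 \<in> S" for u s w1 n w2
    using grade2_graded m1.aut.vector_space
  proof (induction u rule: graded_induct)
    case (mem i u)
    obtain a j1 j2 where i: "i = (a, j1, j2)" by (cases i)
    show ?case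
    proof (cases "u = 0")
      case False
      note u = grade2_memD[OF mem[unfolded i] False]
      obtain K where "\<forall>i\<ge>K. I w1 (n + of_nat i) w2 = 0" using I_truncation by blast
      then show ?thesis by (rule mY_I_in_span[OF u(1,2,4) w2])
    qed (simp add: m3.mY_simps m3.ms.span_zero)
  qed (auto simp: m3.mY_simps m3.ms.span_zero intro: m3.ms.span_add)
  have "mY M3 u s w \<in> ?N" if "w \<in> ?N" for u s w
    using that
  proof (induction rule: m3.ms.span_induct_alt)
    case (step c x y)
    then have "mY M3 u s x \<in> ?N" using gens by blast
    then show ?case using step.IH by (simp add: m3.mY_simps m3.ms.span_add m3.ms.span_scale)
  qed (simp add: m3.mY_simps m3.ms.span_zero)
  then show ?thesis by (simp add: is_submodule_def)
qed

text \<open>If the span were all of M3, the projection to degree 0 would vanish identically and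
  M3(0) would be 0. Being generated by M3(0), M3 would be 0 as well, which irreducibility
  excludes.\<close>

lemma I_vanishes_on_mdeg_0:
  assumes irr: "irreducible_module M3"
    and o0: "\<And>w1 w2. w2 \<in> mdeg V T M2 h2 0 \<Longrightarrow> oI w1 w2 = 0"
    and w2: "w2 \<in> mdeg V T M2 h2 0"
  shows "I w1 n w2 = 0"
proof -
  let ?N = "m3.ms.span {I w1 n w2 | w1 n w2. w2 \<in> mdeg V T M2 h2 0}"
  let ?h = "homog_part (mdeg V T M3 h3) 0"
  note h_linear = homog_part_linear[OF m3.mdeg_graded m3.vector_space]
  have "?N \<noteq> UNIV"
  proof
    assume N: "?N = UNIV"
    have "?h (I w1 n w2) = 0" if w2: "w2 \<in> mdeg V T M2 h2 0" for w1 n w2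
      using m1.mdeg_graded m1.vector_space
    proof (induction w1 rule: graded_induct)
      case (mem d w1)
      then have w1: "w1 \<in> lspace V M1 (h1 + of_nat d / of_nat T)" by (simp add: mdeg_def)
      have "w2 \<in> lspace V M2 h2" using w2 by (simp add: mdeg_def)
      note I = I_lspace[OF w1 this, of n]
      show ?case
      proof (cases "I w1 n w2 = 0")
        case False
        obtain k where k: "h1 + of_nat d / of_nat T + h2 - n - 1 = h3 + of_nat k / of_nat T"
          "I w1 n w2 \<in> mdeg V T M3 h3 k"
          using m3.lspace_weight[OF I False] by blast
        \<comment> \<open>Degree 0 forces n to be the zero-mode index, so the vector would be
          o_I(w1) w2 = 0.\<close>
        have "k \<noteq> 0"
        proof
          assume "k = 0"
          then have "n = h1 + of_nat d / of_nat T + h2 - h3 - 1" using k(1) by (simp add: algebra_simps)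
          then show False using o0[OF w2, of w1] False by (simp add: oI_lspace[OF w1])
        qed
        then show ?thesis using homog_part_mem[OF m3.mdeg_graded m3.vector_space k(2), of 0] by simp
      qed (simp add: linear_apply[OF h_linear])
    qed (auto simp: I_simps linear_apply[OF h_linear])
    then have on_gens: "?h x = 0" if "x \<in> {I w1 n w2 | w1 n w2. w2 \<in> mdeg V T M2 h2 0}" for x
      using that by blast
    have h0: "?h y = 0" for y
    proof (rule linear_vanishes_on_span[OF h_linear on_gens])
      show "y \<in> ?N" unfolding N by (rule UNIV_I)
    qed
    have "mdeg V T M3 h3 0 \<subseteq> {0}"
    proof
      fix y assume "y \<in> mdeg V T M3 h3 0"
      from homog_part_mem[OF m3.mdeg_graded m3.vector_space this, of 0] show "y \<in> {0}"
        by (simp add: h0)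
    qed
    moreover have "is_submodule M3 {0}"
      by (simp add: is_submodule_def m3.ms.subspace_single_0 m3.mY_simps)
    ultimately have "\<Inter> {N. is_submodule M3 N \<and> mdeg V T M3 h3 0 \<subseteq> N} \<subseteq> {0}" by blast
    then show False
      using irr m3.standing unfolding irreducible_module_def standing_def generated_by_def by auto
  qed
  then have "?N = {0}" using irr span_I_submodule[of "mdeg V T M2 h2 0"]
    unfolding irreducible_module_def by blast
  moreover have "I w1 n w2 \<in> ?N" using w2 by (intro m3.ms.span_base) blast
  ultimately show ?thesis by blast
qed

text \<open>Since every I(w1)_n kills w2, only the second sum of the Jacobi identity is left, a
  relation among the vectors I(w1)_{n-i} (u_{s+i} w2). For i > 0 the sequence of modes starting at s
  + i reaches 0 sooner, so the induction hypothesis removes these terms.\<close>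

lemma I_annihilator_step:
  assumes u: "j1 < T" "j2 < T" "u \<in> eig2 V T g1 g2 j1 j2"
    and w2: "\<And>w1 n. I w1 n w2 = 0" and "\<forall>i\<ge>K. mY M2 u (s + of_nat i) w2 = 0"
  shows "I w1 n (mY M2 u s w2) = 0"
  using assms(5)
proof (induction K arbitrary: s n)
  case 0
  then have "mY M2 u s w2 = 0" using 0[rule_format, of 0] by simp
  then show ?case by (simp add: I_simps)
next
  case (Suc K)
  show ?case
  proof (cases "s - of_nat j2 / of_nat T \<in> \<int>")
    case False
    have "u \<in> eig V T g2 j2" using u(3) by (simp add: eig2_def)
    from m2.exponents[OF u(2) this False] show ?thesis by (simp add: I_simps)
  next
    case True
    then obtain p where "s - of_nat j2 / of_nat T = of_int p" by (auto elim: Ints_cases)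
    then have p: "s = of_nat j2 / of_nat T + of_int p" by (simp add: algebra_simps)
    \<comment> \<open>The integer part of l is free; 0 makes the sign 1. Using n - l in the Jacobi
      identity brings the leading index of I to n.\<close>
    define l where "l = of_nat j1 / of_nat T + (of_int 0 :: complex)"
    let ?f = "\<lambda>i::nat. mscale M3 ((-1) ^ i * (l gchoose i))
              (I w1 (n - l + l - of_nat i) (mY M2 u (s + of_nat i) w2))"
    have "mscale M3 (exp (of_nat j1 / of_nat T * of_real pi * \<i>) * (-1) powi 0) (Sum_any ?f) = 0"
      using I_jacobi[OF u l_def p, of w1 "n - l" w2] by (simp add: w2 m3.mY_simps)
    then have "Sum_any ?f = 0" by simp
    moreover have "Sum_any ?f = ?f 0"
    proof (rule Sum_any_eq_single)
      fix i :: nat assume "i \<noteq> 0"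
      have "I w1 (n - l + l - of_nat i) (mY M2 u (s + of_nat i) w2) = 0"
      proof (rule Suc.IH, intro allI impI)
        fix j assume "K \<le> j"
        then have "Suc K \<le> i + j" using \<open>i \<noteq> 0\<close> by simp
        from Suc.prems[rule_format, OF this] show "mY M2 u (s + of_nat i + of_nat j) w2 = 0"
          by (simp add: add.assoc)
      qed
      then show "?f i = 0" by simp
    qed
    ultimately show ?thesis by simp
  qed
qed

lemma I_eq_0:
  assumes irr: "irreducible_module M3"
    and o0: "\<And>w1 w2. w2 \<in> mdeg V T M2 h2 0 \<Longrightarrow> oI w1 w2 = 0"
  shows "I w1 n w2 = 0"
proof -
  let ?K = "{w2. \<forall>w1 n. I w1 n w2 = 0}"
  have "mY M2 u s w2 \<in> ?K" if "w2 \<in> ?K" for u s w2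
    using grade2_graded m1.aut.vector_space
  proof (induction u rule: graded_induct)
    case (mem i u)
    obtain a j1 j2 where i: "i = (a, j1, j2)" by (cases i)
    show ?case
    proof (cases "u = 0")
      case False
      note u = grade2_memD[OF mem[unfolded i] False]
      obtain K where "\<forall>i\<ge>K. mY M2 u (s + of_nat i) w2 = 0" using m2.mY_truncation by blast
      then show ?thesis using I_annihilator_step[OF u(1,2,4)] that by blast
    qed (simp add: m2.mY_simps I_simps)
  qed (auto simp: m2.mY_simps I_simps)
  moreover have "m2.ms.subspace ?K" by (rule m2.ms.subspaceI) (auto simp: I_simps)
  ultimately have "is_submodule M2 ?K" unfolding is_submodule_def by blast
  moreover have "mdeg V T M2 h2 0 \<subseteq> ?K" using I_vanishes_on_mdeg_0[OF irr o0] by blast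
  ultimately have "?K = UNIV" using m2.standing unfolding standing_def generated_by_def by blast
  then show ?thesis by blast
qed

end

section \<open>The vector space of intertwining operators\<close>

lemma vector_space_intertwiner_scale:
  assumes "vector_space s"
  shows "vector_space (intertwiner_scale s)"
proof -
  interpret vector_space s by fact
  show ?thesis
    by unfold_locales (auto simp: intertwiner_scale_def fun_eq_iff scale_right_distrib scale_left_distrib)
qed

lemma vector_space_fun_scale:
  assumes "vector_space s"
  shows "vector_space (fun_scale s)"
proof -
  interpret vector_space s by fact
  show ?thesis
    by unfold_locales (auto simp: fun_scale_def fun_eq_iff scale_right_distrib scale_left_distrib)
qed

context intertwining_setting
begin

lemma intertwining_operatorI:
  "I \<in> intertwiners V T g1 g2 M1 M2 M3 \<Longrightarrow> intertwining_operator V T g1 g2 M1 M2 M3 h1 h2 h3 I"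
  by unfold_locales

lemma intertwiners_0: "0 \<in> intertwiners V T g1 g2 M1 M2 M3"
  unfolding intertwiners_def zero_fun_def
  by (auto simp: m3.mY_simps Let_def intro: linear_zero_map m1.vector_space m2.vector_space m3.vector_space)

text \<open>One closure property serves three purposes: c = 1 is the sum, I = 0 the scalar multiple,
  and c = -1 the difference in the injectivity argument.\<close>

lemma intertwiners_add_scale:
  assumes I: "I \<in> intertwiners V T g1 g2 M1 M2 M3" and J: "J \<in> intertwiners V T g1 g2 M1 M2 M3"
  shows "I + intertwiner_scale (mscale M3) c J \<in> intertwiners V T g1 g2 M1 M2 M3"
proof -
  interpret I: intertwining_operator V T g1 g2 M1 M2 M3 h1 h2 h3 I
    by (rule intertwining_operatorI[OF I])
  interpret J: intertwining_operator V T g1 g2 M1 M2 M3 h1 h2 h3 J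
    by (rule intertwining_operatorI[OF J])
  define K where "K = I + intertwiner_scale (mscale M3) c J"
  have K: "K w1 n w2 = I w1 n w2 + mscale M3 c (J w1 n w2)" for w1 n w2
    by (simp add: K_def intertwiner_scale_def)
  note distribs = m3.ms.scale_right_distrib m3.ms.scale_right_diff_distrib m3.mY_simps
    I.I_simps J.I_simps add_ac
  have lin1: "Vector_Spaces.linear (mscale M1) (mscale M3) (\<lambda>w1. K w1 n w2)" for n w2
    by (rule linearI[OF m1.vector_space m3.vector_space]) (auto simp: K distribs mult.commute)
  have lin2: "Vector_Spaces.linear (mscale M2) (mscale M3) (K w1 n)" for w1 n
    by (rule linearI[OF m2.vector_space m3.vector_space]) (auto simp: K distribs mult.commute)
  have trunc: "\<exists>N::rat. \<forall>q\<ge>N. K w1 (x + of_rat q) w2 = 0" for w1 w2 x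
  proof -
    obtain N :: rat where "\<forall>q\<ge>N. I w1 (x + of_rat q) w2 = 0"
      using I unfolding intertwiners_def by blast
    moreover obtain N' :: rat where "\<forall>q\<ge>N'. J w1 (x + of_rat q) w2 = 0"
      using J unfolding intertwiners_def by blast
    ultimately show ?thesis by (intro exI[of _ "max N N'"]) (auto simp: K)
  qed
  have deriv: "K (mL V M1 (-1) w1) n w2 = mscale M3 (- n) (K w1 (n - 1) w2)" for w1 n w2
    by (simp add: K distribs I.I_Lop_minus1 J.I_Lop_minus1 mult.commute)
  have jac: "Sum_any (\<lambda>i::nat. mscale M3 ((-1) ^ i * (l gchoose i))
            (mY M3 u (m + l - of_nat i) (K w1 (n + of_nat i) w2)))
        - mscale M3 (exp (of_nat j1 / of_nat T * of_real pi * \<i>) * (-1) powi k)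
            (Sum_any (\<lambda>i::nat. mscale M3 ((-1) ^ i * (l gchoose i))
              (K w1 (n + l - of_nat i) (mY M2 u (m + of_nat i) w2))))
        = Sum_any (\<lambda>i::nat. mscale M3 (m gchoose i)
            (K (mY M1 u (l + of_nat i) w1) (m + n - of_nat i) w2))"
    if hyps: "j1 < T" "j2 < T" "u \<in> eig2 V T g1 g2 j1 j2"
      "l = of_nat j1 / of_nat T + of_int k" "m = of_nat j2 / of_nat T + of_int p"
    for j1 j2 u w1 w2 k p n l m
  proof -
    let ?e = "exp (of_nat j1 / of_nat T * of_real pi * \<i>) * (-1) powi k"
    let ?L = "\<lambda>I. Sum_any (\<lambda>i::nat. mscale M3 ((-1) ^ i * (l gchoose i))
            (mY M3 u (m + l - of_nat i) (I w1 (n + of_nat i) w2)))"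
    let ?R = "\<lambda>I. Sum_any (\<lambda>i::nat. mscale M3 ((-1) ^ i * (l gchoose i))
              (I w1 (n + l - of_nat i) (mY M2 u (m + of_nat i) w2)))"
    let ?P = "\<lambda>I. Sum_any (\<lambda>i::nat. mscale M3 (m gchoose i)
            (I (mY M1 u (l + of_nat i) w1) (m + n - of_nat i) w2))"
    have "?L K = ?L I + mscale M3 c (?L J)"
      unfolding Sum_any_add_scale[OF m3.vector_space I.I_jacobi_supports(1) J.I_jacobi_supports(1), symmetric]
      by (rule Sum_any.cong) (simp add: K distribs mult_ac)
    moreover have "?R K = ?R I + mscale M3 c (?R J)"
      unfolding Sum_any_add_scale[OF m3.vector_space I.I_jacobi_supports(2) J.I_jacobi_supports(2), symmetric]
      by (rule Sum_any.cong) (simp add: K distribs mult_ac)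
    moreover have "?P K = ?P I + mscale M3 c (?P J)"
      unfolding Sum_any_add_scale[OF m3.vector_space I.I_jacobi_supports(3) J.I_jacobi_supports(3), symmetric]
      by (rule Sum_any.cong) (simp add: K distribs mult_ac)
    moreover have "?L I - mscale M3 ?e (?R I) = ?P I" by (rule I.I_jacobi[OF hyps])
    moreover have "?L J - mscale M3 ?e (?R J) = ?P J" by (rule J.I_jacobi[OF hyps])
    moreover have "(a + mscale M3 c a') - mscale M3 ?e (b + mscale M3 c b')
        = (a - mscale M3 ?e b) + mscale M3 c (a' - mscale M3 ?e b')" for a a' b b'
      by (simp add: m3.ms.scale_right_distrib m3.ms.scale_right_diff_distrib mult_ac)
    ultimately show ?thesis by (simp only:)
  qed
  have "K \<in> intertwiners V T g1 g2 M1 M2 M3"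
    unfolding intertwiners_def Let_def mem_Collect_eq
    by (intro conjI allI impI ballI lin1 lin2 trunc deriv jac[OF _ _ _ refl refl])
  then show ?thesis by (simp only: K_def)
qed

lemma intertwiners_subspace:
  "module.subspace (intertwiner_scale (mscale M3)) (intertwiners V T g1 g2 M1 M2 M3)"
proof -
  interpret vector_space "intertwiner_scale (mscale M3)"
    by (rule vector_space_intertwiner_scale[OF m3.vector_space])
  show ?thesis
  proof (rule subspaceI)
    show "x + y \<in> intertwiners V T g1 g2 M1 M2 M3"
      if "x \<in> intertwiners V T g1 g2 M1 M2 M3" "y \<in> intertwiners V T g1 g2 M1 M2 M3" for x y
      using intertwiners_add_scale[OF that, of 1] by simp
    show "intertwiner_scale (mscale M3) c x \<in> intertwiners V T g1 g2 M1 M2 M3"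
      if "x \<in> intertwiners V T g1 g2 M1 M2 M3" for x c
      using intertwiners_add_scale[OF intertwiners_0 that, of c] by simp
  qed (rule intertwiners_0)
qed

lemma o_int_add_scale:
  assumes I: "I \<in> intertwiners V T g1 g2 M1 M2 M3" and J: "J \<in> intertwiners V T g1 g2 M1 M2 M3"
  shows "o_int V T M1 h1 h2 h3 (I + intertwiner_scale (mscale M3) c J) w1 w2
    = o_int V T M1 h1 h2 h3 I w1 w2 + mscale M3 c (o_int V T M1 h1 h2 h3 J w1 w2)"
proof -
  interpret I: intertwining_operator V T g1 g2 M1 M2 M3 h1 h2 h3 I
    by (rule intertwining_operatorI[OF I])
  interpret J: intertwining_operator V T g1 g2 M1 M2 M3 h1 h2 h3 J
    by (rule intertwining_operatorI[OF J])
  note fin = homog_part_decomposition(2)[OF m1.mdeg_graded m1.vector_space, of w1]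
  have "finite {n. I (homog_part (mdeg V T M1 h1) n w1) (of_nat n / of_nat T - 1 + h1 + h2 - h3) w2 \<noteq> 0}"
    "finite {n. J (homog_part (mdeg V T M1 h1) n w1) (of_nat n / of_nat T - 1 + h1 + h2 - h3) w2 \<noteq> 0}"
    by (rule finite_subset[OF _ fin], auto simp: I.I_simps J.I_simps)+
  from Sum_any_add_scale[OF m3.vector_space this] show ?thesis
    by (simp add: o_int_def I_circ_def intertwiner_scale_def)
qed

lemma o_int_injective:
  assumes I: "I \<in> intertwiners V T g1 g2 M1 M2 M3" and J: "J \<in> intertwiners V T g1 g2 M1 M2 M3"
    and irr: "irreducible_module M3"
    and eq: "\<And>w1 w2. w2 \<in> mdeg V T M2 h2 0 \<Longrightarrow>
      o_int V T M1 h1 h2 h3 I w1 w2 = o_int V T M1 h1 h2 h3 J w1 w2"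
  shows "I = J"
proof -
  let ?D = "I + intertwiner_scale (mscale M3) (-1) J"
  interpret D: intertwining_operator V T g1 g2 M1 M2 M3 h1 h2 h3 ?D
    by (rule intertwining_operatorI[OF intertwiners_add_scale[OF I J]])
  have "?D w1 n w2 = 0" for w1 n w2
    by (rule D.I_eq_0[OF irr]) (simp add: o_int_add_scale[OF I J] eq)
  then show ?thesis by (simp add: fun_eq_iff intertwiner_scale_def)
qed

end

section \<open>The map into homomorphisms of the tensor product\<close>

lemma coset_plus:
  assumes "vector_space s" "module.subspace s S"
  shows "(x +o S) + (y +o S) = (x + y) +o S"
proof -
  interpret vector_space s by fact
  have "\<exists>b\<in>S. x + a + (y + a') = x + y + b" if "a \<in> S" "a' \<in> S" for a a'
    using that subspace_add[OF assms(2)] by (intro bexI[of _ "a + a'"]) (auto simp: add_ac)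
  moreover have "\<exists>a\<in>S. \<exists>a'\<in>S. x + y + b = x + a + (y + a')" if "b \<in> S" for b
    using that subspace_0[OF assms(2)] by (intro bexI[of _ b] bexI[of _ 0]) (auto simp: add_ac)
  ultimately show ?thesis unfolding elt_set_plus_def set_plus_def by blast
qed

lemma quot_scale_coset:
  assumes "vector_space s" "module.subspace s S"
  shows "quot_scale s S c (x +o S) = s c x +o S"
proof -
  interpret vector_space s by fact
  have "\<exists>b\<in>S. s c (x + a) + a' = s c x + b" if "a \<in> S" "a' \<in> S" for a a'
    using that assms(2) by (intro bexI[of _ "s c a + a'"])
      (auto simp: add_ac scale_right_distrib subspace_add subspace_scale)
  moreover have "\<exists>a\<in>S. \<exists>a'\<in>S. s c x + b = s c (x + a) + a'" if "b \<in> S" for b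
    using that subspace_0[OF assms(2)] by (intro bexI[of _ 0] bexI[of _ b]) auto
  ultimately show ?thesis by (fastforce simp: quot_scale_def elt_set_plus_def set_plus_def)
qed

lemma mem_own_coset:
  assumes "vector_space s" "module.subspace s S"
  shows "x \<in> x +o S"
proof -
  interpret vector_space s by fact
  show ?thesis using subspace_0[OF assms(2)] by (auto simp: elt_set_plus_def)
qed

lemma lookup_free_scale: "Poly_Mapping.lookup (free_scale c p) k = c * Poly_Mapping.lookup p k"
  by (simp add: free_scale_def Poly_Mapping.map.rep_eq when_def)

lemma free_scale_single: "free_scale c (Poly_Mapping.single k d) = Poly_Mapping.single k (c * d)"
  by (auto intro!: poly_mapping_eqI simp: lookup_free_scale lookup_single when_def)

lemma free_scale_vector_space: "vector_space free_scale"
  by unfold_locales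
    (auto intro!: poly_mapping_eqI simp: lookup_free_scale lookup_add algebra_simps)

lemma keys_free_scale: "Poly_Mapping.keys (free_scale c p) \<subseteq> Poly_Mapping.keys p"
  by (auto simp: in_keys_iff lookup_free_scale)

text \<open>\<open>f\<close> is linear on W1 only, so a basis of W1 yields a map \<open>g\<close>
  linear on the whole type and equal to \<open>f\<close> on W1. The image of the basis is
  independent and extends to a basis of W2, which is equinumerous with the one selected by
  \<open>vdim\<close>.\<close>

lemma vdim_le_if_injective:
  fixes s1 :: "complex \<Rightarrow> 'x \<Rightarrow> 'x::ab_group_add" and s2 :: "complex \<Rightarrow> 'y \<Rightarrow> 'y::ab_group_add"
  assumes vs: "vector_space s1" "vector_space s2"
    and sub: "module.subspace s1 W1" "module.subspace s2 W2"
    and maps: "\<And>x. x \<in> W1 \<Longrightarrow> f x \<in> W2"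
    and add: "\<And>x y. x \<in> W1 \<Longrightarrow> y \<in> W1 \<Longrightarrow> f (x + y) = f x + f y"
    and scale: "\<And>c x. x \<in> W1 \<Longrightarrow> f (s1 c x) = s2 c (f x)"
    and inj: "inj_on f W1"
  shows "vdim s1 W1 \<le>o vdim s2 W2"
proof -
  interpret v1: vector_space s1 by fact
  interpret v2: vector_space s2 by fact
  interpret vector_space_pair s1 s2 by unfold_locales
  have "\<exists>B. is_basis s1 W1 B"
    using v1.maximal_independent_subset[of W1] v1.span_subspace[OF _ _ sub(1)]
    unfolding is_basis_def by metis
  then have "is_basis s1 W1 (SOME B. is_basis s1 W1 B)" by (rule someI_ex)
  then obtain B where B: "B = (SOME B. is_basis s1 W1 B)"
    "B \<subseteq> W1" "v1.independent B" "v1.span B = W1" unfolding is_basis_def by blast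
  have "\<exists>C. is_basis s2 W2 C"
    using v2.maximal_independent_subset[of W2] v2.span_subspace[OF _ _ sub(2)]
    unfolding is_basis_def by metis
  then have "is_basis s2 W2 (SOME C. is_basis s2 W2 C)" by (rule someI_ex)
  then obtain C where C: "C = (SOME C. is_basis s2 W2 C)"
    "C \<subseteq> W2" "v2.independent C" "v2.span C = W2" unfolding is_basis_def by blast
  obtain g where g: "Vector_Spaces.linear s1 s2 g" "\<And>x. x \<in> B \<Longrightarrow> g x = f x"
    using linear_independent_extend[OF B(3)] by blast
  have f0: "f 0 = 0" using scale[of 0 0] v1.subspace_0[OF sub(1)] by simp
  have "x \<in> W1 \<and> g x = f x" if "x \<in> v1.span B" for x
    using that
  proof (induction rule: v1.span_induct_alt)
    case base
    then show ?case using f0 v1.subspace_0[OF sub(1)] by (simp add: linear_apply[OF g(1)])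
  next
    case (step c x y)
    then have x: "x \<in> W1" using B by auto
    then have "s1 c x \<in> W1" by (rule v1.subspace_scale[OF sub(1)])
    then show ?case using step g(2) x
      by (simp add: linear_apply[OF g(1)] add scale v1.subspace_add[OF sub(1)])
  qed
  then have gf: "g x = f x" if "x \<in> W1" for x using that B(4) by blast
  have "inj_on g (v1.span B)" using inj gf unfolding B(4) by (simp add: inj_on_def)
  then have "v2.independent (g ` B)" by (rule linear_independent_injective_image[OF g(1) B(3)])
  moreover have "g ` B \<subseteq> W2" using gf maps B(2) by auto
  ultimately obtain C' where C': "g ` B \<subseteq> C'" "C' \<subseteq> W2" "v2.independent C'" "W2 \<subseteq> v2.span C'"
    using v2.maximal_independent_subset_extend by metis
  have "v2.span C' = v2.span C" using v2.span_subspace[OF C'(2,4) sub(2)] C(4) by simp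
  then obtain e where e: "bij_betw e C' C" using v2.bij_if_span_eq_span_bases[OF C'(3) C(3)] by blast
  have "inj_on g B" using \<open>inj_on g (v1.span B)\<close> v1.span_superset by (rule inj_on_subset)
  then have "inj_on (e \<circ> g) B"
    using e C'(1) by (intro comp_inj_on) (auto simp: bij_betw_def intro: inj_on_subset)
  moreover have "(e \<circ> g) ` B \<subseteq> C" using e C'(1) by (auto simp: bij_betw_def)
  ultimately have "|B| \<le>o |C|" using card_of_ordLeq by blast
  then show ?thesis by (simp only: vdim_def B(1)[symmetric] C(1)[symmetric])
qed

context intertwining_setting
begin

section \<open>Cosets and homomorphisms of the tensor product\<close>

abbreviation "Ob \<equiv> O_b V T g1 g2 M1"
abbreviation "cl \<equiv> cls_b V T g1 g2 M1"
abbreviation "null \<equiv> tensor_null V T g1 g2 M1 M2 h2"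
abbreviation "X \<equiv> tensor_space V T g1 g2 M1 M2 h2"
abbreviation "H \<equiv> tensor_hom V T g1 g2 M1 M2 M3 h2 h3"
abbreviation "ptens \<equiv> pure_tensor V T g1 g2 M1 M2 h2"
abbreviation "Y \<equiv> {p. Poly_Mapping.keys p \<subseteq> A_b V T g1 g2 M1 \<times> mdeg V T M2 h2 0}"

lemma O_b_subspace: "m1.ms.subspace Ob"
proof -
  have "m1.ms.subspace (O_b' V T g1 g2 M1)" "m1.ms.subspace (O_b'' V T g1 g2 M1)"
    by (simp_all add: O_b'_def O_b''_def Let_def)
  from m1.ms.subspace_sums[OF this] show ?thesis
    by (auto simp: O_b_def set_plus_def elim!: back_subst[of "m1.ms.subspace"])
qed

lemma A_b_eq: "A_b V T g1 g2 M1 = range cl"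
  by (simp add: A_b_def quot_def cls_b_def)

lemma cls_b_plus: "cl x + cl y = cl (x + y)"
  unfolding cls_b_def by (rule coset_plus[OF m1.vector_space O_b_subspace])

lemma quot_scale_cls_b: "quot_scale (mscale M1) Ob c (cl x) = cl (mscale M1 c x)"
  unfolding cls_b_def by (rule quot_scale_coset[OF m1.vector_space O_b_subspace])

lemma cls_b_eqD: "cl x = cl y \<Longrightarrow> x - y \<in> Ob"
  using mem_own_coset[OF m1.vector_space O_b_subspace, of x]
  by (auto simp: cls_b_def elt_set_plus_def)

lemma tensor_null_subspace: "module.subspace free_scale null"
proof -
  interpret vector_space free_scale by (rule free_scale_vector_space)
  show ?thesis unfolding tensor_null_def by (rule subspace_span)
qed

lemmas tensor_coset_plus = coset_plus[OF free_scale_vector_space tensor_null_subspace]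
lemmas tensor_coset_scale = quot_scale_coset[OF free_scale_vector_space tensor_null_subspace]

lemma Y_closed:
  "p \<in> Y \<Longrightarrow> q \<in> Y \<Longrightarrow> p + q \<in> Y" "p \<in> Y \<Longrightarrow> free_scale c p \<in> Y"
  using keys_add[of p q] keys_free_scale[of c p] by auto

lemma tensor_space_eq: "X = (\<lambda>p. p +o null) ` Y"
  by (simp add: tensor_space_def)

lemma tensor_space_closed:
  "t \<in> X \<Longrightarrow> t' \<in> X \<Longrightarrow> t + t' \<in> X" "t \<in> X \<Longrightarrow> quot_scale free_scale null c t \<in> X"
  unfolding tensor_space_eq using Y_closed
  by (auto simp: tensor_coset_plus tensor_coset_scale)

lemma single_in_Y: "m \<in> mdeg V T M2 h2 0 \<Longrightarrow> Poly_Mapping.single (cl w, m) c \<in> Y"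
  by (auto simp: A_b_eq)

lemma pure_tensor_in_X: "m \<in> mdeg V T M2 h2 0 \<Longrightarrow> ptens (cl w) m \<in> X"
  unfolding pure_tensor_def tensor_space_eq by (rule imageI[OF single_in_Y])

lemma tensor_homI:
  assumes "\<And>t. t \<notin> X \<Longrightarrow> f t = 0" "\<And>t. t \<in> X \<Longrightarrow> f t \<in> mdeg V T M3 h3 0"
    "\<And>t t'. t \<in> X \<Longrightarrow> t' \<in> X \<Longrightarrow> f (t + t') = f t + f t'"
    "\<And>c t. t \<in> X \<Longrightarrow> f (quot_scale free_scale null c t) = mscale M3 c (f t)"
    "\<And>u w m. m \<in> mdeg V T M2 h2 0 \<Longrightarrow>
      f (ptens (cl (star_left V T g1 g2 M1 u w)) m) = o_mod V M3 u (f (ptens (cl w) m))"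
  shows "f \<in> H"
  unfolding tensor_hom_def Let_def mem_Collect_eq by (intro conjI allI impI ballI assms)

lemma tensor_homD:
  assumes "f \<in> H"
  shows "t \<notin> X \<Longrightarrow> f t = 0" "t \<in> X \<Longrightarrow> f t \<in> mdeg V T M3 h3 0"
    "t \<in> X \<Longrightarrow> t' \<in> X \<Longrightarrow> f (t + t') = f t + f t'"
    "t \<in> X \<Longrightarrow> f (quot_scale free_scale null c t) = mscale M3 c (f t)"
    "m \<in> mdeg V T M2 h2 0 \<Longrightarrow>
      f (ptens (cl (star_left V T g1 g2 M1 u w)) m) = o_mod V M3 u (f (ptens (cl w) m))"
proof -
  have f: "(\<forall>t. t \<notin> X \<longrightarrow> f t = 0) \<and>
            (\<forall>t\<in>X. f t \<in> mdeg V T M3 h3 0) \<and>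
            (\<forall>t\<in>X. \<forall>t'\<in>X. f (t + t') = f t + f t') \<and>
            (\<forall>c. \<forall>t\<in>X. f (quot_scale free_scale null c t) = mscale M3 c (f t)) \<and>
            (\<forall>a\<in>A_g V T (g1 \<circ> g2). \<forall>u\<in>a. \<forall>w. \<forall>m\<in>mdeg V T M2 h2 0.
               f (ptens (cl (star_left V T g1 g2 M1 u w)) m) = o_mod V M3 u (f (ptens (cl w) m)))"
    using assms unfolding tensor_hom_def Let_def mem_Collect_eq .
  note f1 = f[THEN conjunct1] and f2 = f[THEN conjunct2, THEN conjunct1]
    and f3 = f[THEN conjunct2, THEN conjunct2, THEN conjunct1]
    and f4 = f[THEN conjunct2, THEN conjunct2, THEN conjunct2, THEN conjunct1]
    and f5 = f[THEN conjunct2, THEN conjunct2, THEN conjunct2, THEN conjunct2]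
  show "t \<notin> X \<Longrightarrow> f t = 0" by (rule f1[rule_format])
  show "t \<in> X \<Longrightarrow> f t \<in> mdeg V T M3 h3 0" by (rule f2[rule_format])
  show "t \<in> X \<Longrightarrow> t' \<in> X \<Longrightarrow> f (t + t') = f t + f t'" by (rule f3[rule_format])
  show "t \<in> X \<Longrightarrow> f (quot_scale free_scale null c t) = mscale M3 c (f t)" by (rule f4[rule_format])
  \<comment> \<open>Every u lies in its own class, so the clause over classes and their members
    applies to each u in V.\<close>
  have "u +o O_g V T (g1 \<circ> g2) \<in> A_g V T (g1 \<circ> g2)" by (simp add: A_g_def quot_def)
  moreover have "u \<in> u +o O_g V T (g1 \<circ> g2)"
    by (rule mem_own_coset[OF m1.aut.vector_space]) (simp add: O_g_def)
  ultimately show "f (ptens (cl (star_left V T g1 g2 M1 u w)) m) = o_mod V M3 u (f (ptens (cl w) m))"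
    if "m \<in> mdeg V T M2 h2 0"
    using f5[rule_format, OF _ _ that] by blast
qed

text \<open>Pure tensors span the tensor product. The induction runs over a finite set containing
  the keys of a representative and splits off one key at a time.\<close>

lemma tensor_hom_unique:
  assumes f: "f \<in> H" and f': "f' \<in> H"
    and eq: "\<And>w m. m \<in> mdeg V T M2 h2 0 \<Longrightarrow> f (ptens (cl w) m) = f' (ptens (cl w) m)"
  shows "f = f'"
proof
  fix t
  have *: "f (p +o null) = f' (p +o null)" if "finite K" "Poly_Mapping.keys p \<subseteq> K" "p \<in> Y" for K p
    using that
  proof (induction K arbitrary: p rule: finite_induct)
    case empty
    \<comment> \<open>The base case needs the value 0 at the zero coset, which homogeneity gives for
      the scalar 0.\<close>
    then have "p = free_scale 0 p" by (auto intro!: poly_mapping_eqI simp: lookup_free_scale)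
    then have "p +o null = quot_scale free_scale null 0 (p +o null)"
      by (metis tensor_coset_scale)
    moreover have "p +o null \<in> X" unfolding tensor_space_eq by (rule imageI[OF empty(2)])
    ultimately show ?case using tensor_homD(4)[OF f, of "p +o null" 0] tensor_homD(4)[OF f', of "p +o null" 0]
      by simp
  next
    case (insert k K)
    let ?c = "Poly_Mapping.lookup p k"
    show ?case
    proof (cases "?c = 0")
      case True
      then have "Poly_Mapping.keys p \<subseteq> K" using insert.prems by (auto simp: in_keys_iff)
      then show ?thesis using insert by blast
    next
      case False
      then have "k \<in> A_b V T g1 g2 M1 \<times> mdeg V T M2 h2 0"
        using insert.prems by (auto simp: in_keys_iff)
      then obtain w m where k: "k = (cl w, m)" "m \<in> mdeg V T M2 h2 0" by (auto simp: A_b_eq)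
      define q where "q = p - Poly_Mapping.single k ?c"
      define r where "r = Poly_Mapping.single k (1 :: complex)"
      have p: "p = q + free_scale ?c r"
        by (auto intro!: poly_mapping_eqI
            simp: q_def r_def lookup_add lookup_minus lookup_free_scale lookup_single when_def)
      have keys: "Poly_Mapping.keys q \<subseteq> Poly_Mapping.keys p - {k}"
        by (auto simp: q_def in_keys_iff lookup_minus lookup_single when_def split: if_splits)
      then have q: "Poly_Mapping.keys q \<subseteq> K" "q \<in> Y" using insert.prems by auto
      then have qX: "q +o null \<in> X" by (auto simp: tensor_space_eq)
      have r: "r +o null = ptens (cl w) m" by (simp add: r_def k pure_tensor_def)
      then have rX: "r +o null \<in> X" using pure_tensor_in_X[OF k(2)] by simp
      have split: "p +o null = (q +o null) + quot_scale free_scale null ?c (r +o null)"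
        unfolding tensor_coset_scale tensor_coset_plus using p by simp
      have "f (q +o null) = f' (q +o null)" using insert.IH[OF q] .
      moreover have "f (r +o null) = f' (r +o null)" unfolding r by (rule eq[OF k(2)])
      ultimately show ?thesis unfolding split
        using tensor_homD(3,4)[OF f] tensor_homD(3,4)[OF f'] qX rX tensor_space_closed(2)[OF rX]
        by simp
    qed
  qed
  show "f t = f' t"
  proof (cases "t \<in> X")
    case True
    then obtain p where "p \<in> Y" "t = p +o null" by (auto simp: tensor_space_eq)
    then show ?thesis using *[of "Poly_Mapping.keys p" p] by simp
  next
    case False
    then show ?thesis using tensor_homD(1)[OF f] tensor_homD(1)[OF f'] by simp
  qed
qed

lemma tensor_hom_subspace: "module.subspace (fun_scale (mscale M3)) H"
proof -
  interpret vector_space "fun_scale (mscale M3)"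
    by (rule vector_space_fun_scale[OF m3.vector_space])
  have sub: "m3.ms.subspace (mdeg V T M3 h3 0)" unfolding mdeg_def by (rule m3.lspace_subspace)
  note o = linear_apply[OF m3.o_mod_linear_right]
  show ?thesis
  proof (rule subspaceI)
    show "0 \<in> H" by (rule tensor_homI) (auto simp: m3.ms.subspace_0[OF sub] o)
    show "f + f' \<in> H" if "f \<in> H" "f' \<in> H" for f f'
      by (rule tensor_homI)
        (simp_all add: tensor_homD[OF that(1)] tensor_homD[OF that(2)] m3.ms.subspace_add[OF sub] o
          m3.ms.scale_right_distrib)
    show "fun_scale (mscale M3) c f \<in> H" if "f \<in> H" for c f
      by (rule tensor_homI)
        (simp_all add: fun_scale_def tensor_homD[OF that] m3.ms.subspace_scale[OF sub] o
          m3.ms.scale_right_distrib mult.commute)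
  qed
qed

end

context intertwining_operator
begin

text \<open>The linear extension of (x, m) to o_I(w) m from the basis of the free space, with w a
  chosen representative of the class x. At keys whose first entry is no class the value is
  arbitrary, and the map is still linear on the whole free space.\<close>

definition tensor_eval :: "('b set \<times> 'c \<Rightarrow>\<^sub>0 complex) \<Rightarrow> 'd" where
  "tensor_eval p = Sum_any (\<lambda>k. mscale M3 (Poly_Mapping.lookup p k) (oI (SOME w. cl w = fst k) (snd k)))"

lemma tensor_eval_linear: "Vector_Spaces.linear free_scale (mscale M3) tensor_eval"
  unfolding tensor_eval_def[abs_def]
proof (rule linear_Sum_any)
  show "Vector_Spaces.linear free_scale (mscale M3)
      (\<lambda>p. mscale M3 (Poly_Mapping.lookup p k) (oI (SOME w. cl w = fst k) (snd k)))" for k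
    by (rule linearI[OF free_scale_vector_space m3.vector_space])
      (auto simp: lookup_add lookup_free_scale m3.ms.scale_left_distrib)
  show "finite {k. mscale M3 (Poly_Mapping.lookup p k) (oI (SOME w. cl w = fst k) (snd k)) \<noteq> 0}" for p
    by (rule finite_subset[OF _ finite_keys[of p]]) (auto simp: in_keys_iff)
qed (rule free_scale_vector_space m3.vector_space)+

text \<open>Two representatives of a class differ by an element of \<open>Ob\<close>, whose zero
  mode kills M2(0).\<close>

lemma oI_some_representative:
  assumes "m \<in> mdeg V T M2 h2 0"
  shows "oI (SOME w'. cl w' = cl w) m = oI w m"
proof -
  have "cl (SOME w'. cl w' = cl w) = cl w" by (rule someI[of _ w]) simp
  from oI_O_b[OF assms cls_b_eqD[OF this]] show ?thesis
    by (simp add: linear_apply(4)[OF oI_linear_left])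
qed

lemma tensor_eval_single:
  assumes "m \<in> mdeg V T M2 h2 0"
  shows "tensor_eval (Poly_Mapping.single (cl w, m) c) = mscale M3 c (oI w m)"
proof -
  have "tensor_eval (Poly_Mapping.single (cl w, m) c)
      = mscale M3 (Poly_Mapping.lookup (Poly_Mapping.single (cl w, m) c) (cl w, m))
          (oI (SOME w'. cl w' = fst (cl w, m)) (snd (cl w, m)))"
    unfolding tensor_eval_def by (rule Sum_any_eq_single) (simp add: lookup_single when_def)
  then show ?thesis by (simp add: oI_some_representative[OF assms])
qed

lemma tensor_eval_null:
  assumes "p \<in> null"
  shows "tensor_eval p = 0"
  using assms unfolding tensor_null_def
proof (rule linear_vanishes_on_span[OF tensor_eval_linear, rotated])
  have sub: "m2.ms.subspace (mdeg V T M2 h2 0)" unfolding mdeg_def by (rule m2.lspace_subspace)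
  note ev = linear_apply[OF tensor_eval_linear] tensor_eval_single cls_b_plus quot_scale_cls_b
    free_scale_single linear_apply[OF oI_linear_left] linear_apply[OF oI_linear_right]
    m2.ms.subspace_add[OF sub] m2.ms.subspace_scale[OF sub] oI_star_right m2.o_mod_mdeg_0
  fix r assume "r \<in> tensor_relators V T g1 g2 M1 M2 h2"
  then show "tensor_eval r = 0"
    unfolding tensor_relators_def Let_def A_b_eq
    \<comment> \<open>Four families of relators express bilinearity of o_I(w) m. The last one is
      \<open>oI_star_right\<close>, which moves u from the right action onto m.\<close>
    by (elim UnE; clarsimp simp: ev)
qed

lemma tensor_eval_mdeg_0:
  assumes "p \<in> Y"
  shows "tensor_eval p \<in> mdeg V T M3 h3 0"
proof -
  have sub: "m3.ms.subspace (mdeg V T M3 h3 0)" unfolding mdeg_def by (rule m3.lspace_subspace)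
  have "mscale M3 (Poly_Mapping.lookup p k) (oI (SOME w. cl w = fst k) (snd k)) \<in> mdeg V T M3 h3 0" for k
  proof (cases "Poly_Mapping.lookup p k = 0")
    case False
    then have "snd k \<in> mdeg V T M2 h2 0" using assms by (auto simp: in_keys_iff)
    then show ?thesis by (intro m3.ms.subspace_scale[OF sub] oI_mdeg_0)
  qed (simp add: m3.ms.subspace_0[OF sub])
  then show ?thesis unfolding tensor_eval_def by (rule Sum_any_in_subspace[OF m3.vector_space sub])
qed

definition induced_hom :: "('b set \<times> 'c \<Rightarrow>\<^sub>0 complex) set \<Rightarrow> 'd" where
  "induced_hom t = (if t \<in> X then tensor_eval (SOME p. p \<in> t) else 0)"

text \<open>The chosen member of the coset differs from p by an element of \<open>null\<close>,
  where \<open>tensor_eval\<close> is 0.\<close>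

lemma induced_hom_coset:
  assumes "p \<in> Y"
  shows "induced_hom (p +o null) = tensor_eval p"
proof -
  have "(SOME q. q \<in> p +o null) \<in> p +o null"
    by (rule someI[of _ p]) (rule mem_own_coset[OF free_scale_vector_space tensor_null_subspace])
  then obtain b where "b \<in> null" "(SOME q. q \<in> p +o null) = p + b" by (auto simp: elt_set_plus_def)
  then have "tensor_eval (SOME q. q \<in> p +o null) = tensor_eval p"
    by (simp add: linear_apply[OF tensor_eval_linear] tensor_eval_null)
  moreover have "p +o null \<in> X" using assms by (auto simp: tensor_space_eq)
  ultimately show ?thesis by (simp add: induced_hom_def)
qed

lemma induced_hom_pure:
  "m \<in> mdeg V T M2 h2 0 \<Longrightarrow> induced_hom (ptens (cl w) m) = oI w m"
  unfolding pure_tensor_def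
  using induced_hom_coset[OF single_in_Y, of m w 1] by (simp add: tensor_eval_single)

lemma induced_hom_in_H: "induced_hom \<in> H"
proof (rule tensor_homI)
  show "induced_hom t = 0" if "t \<notin> X" for t using that by (simp add: induced_hom_def)
  show "induced_hom t \<in> mdeg V T M3 h3 0" if "t \<in> X" for t
  proof -
    from that obtain p where "p \<in> Y" "t = p +o null" by (auto simp: tensor_space_eq)
    then show ?thesis using induced_hom_coset tensor_eval_mdeg_0 by simp
  qed
  show "induced_hom (t + t') = induced_hom t + induced_hom t'" if "t \<in> X" "t' \<in> X" for t t'
  proof -
    from that obtain p q where pq: "p \<in> Y" "t = p +o null" "q \<in> Y" "t' = q +o null"
      by (auto simp: tensor_space_eq)
    show ?thesis unfolding pq tensor_coset_plus
      induced_hom_coset[OF pq(1)] induced_hom_coset[OF pq(3)] induced_hom_coset[OF Y_closed(1)[OF pq(1,3)]]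
      by (rule linear_apply[OF tensor_eval_linear])
  qed
  show "induced_hom (quot_scale free_scale null c t) = mscale M3 c (induced_hom t)" if "t \<in> X" for c t
  proof -
    from that obtain p where p: "p \<in> Y" "t = p +o null" by (auto simp: tensor_space_eq)
    show ?thesis unfolding p(2) tensor_coset_scale
      induced_hom_coset[OF p(1)] induced_hom_coset[OF Y_closed(2)[OF p(1)]]
      by (rule linear_apply[OF tensor_eval_linear])
  qed
  show "induced_hom (ptens (cl (star_left V T g1 g2 M1 u w)) m) = o_mod V M3 u (induced_hom (ptens (cl w) m))"
    if "m \<in> mdeg V T M2 h2 0" for u w m
    using that by (simp add: induced_hom_pure oI_star_left)
qed

end

section \<open>The map \<pi>\<close>

context intertwining_setting
begin

abbreviation "\<pi> \<equiv> pi_map V T g1 g2 M1 M2 M3 h1 h2 h3"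

text \<open>By \<open>tensor_hom_unique\<close>, any homomorphism with the right values on pure
  tensors resolves the definite description in \<open>pi_map\<close>.\<close>

lemma pi_map_eqI:
  assumes "f \<in> H" "\<And>w m. m \<in> mdeg V T M2 h2 0 \<Longrightarrow> f (ptens (cl w) m) = o_int V T M1 h1 h2 h3 I w m"
  shows "\<pi> I = f"
  unfolding pi_map_def
  by (rule the_equality) (use assms in \<open>auto intro!: tensor_hom_unique\<close>)

lemma pi_map_in_H:
  assumes "I \<in> intertwiners V T g1 g2 M1 M2 M3"
  shows "\<pi> I \<in> H"
    and "m \<in> mdeg V T M2 h2 0 \<Longrightarrow> \<pi> I (ptens (cl w) m) = o_int V T M1 h1 h2 h3 I w m"
proof -
  interpret I: intertwining_operator V T g1 g2 M1 M2 M3 h1 h2 h3 I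
    by (rule intertwining_operatorI[OF assms])
  have "\<pi> I = I.induced_hom" by (rule pi_map_eqI[OF I.induced_hom_in_H I.induced_hom_pure])
  then show "\<pi> I \<in> H" "m \<in> mdeg V T M2 h2 0 \<Longrightarrow> \<pi> I (ptens (cl w) m) = o_int V T M1 h1 h2 h3 I w m"
    by (simp_all add: I.induced_hom_in_H I.induced_hom_pure)
qed

lemma pi_map_add_scale:
  assumes I: "I \<in> intertwiners V T g1 g2 M1 M2 M3" and J: "J \<in> intertwiners V T g1 g2 M1 M2 M3"
  shows "\<pi> (I + intertwiner_scale (mscale M3) c J) = \<pi> I + fun_scale (mscale M3) c (\<pi> J)"
proof (rule pi_map_eqI)
  interpret vector_space "fun_scale (mscale M3)"
    by (rule vector_space_fun_scale[OF m3.vector_space])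
  show "\<pi> I + fun_scale (mscale M3) c (\<pi> J) \<in> H"
    by (intro subspace_add subspace_scale tensor_hom_subspace pi_map_in_H I J)
qed (simp add: o_int_add_scale[OF I J] pi_map_in_H(2)[OF I] pi_map_in_H(2)[OF J] fun_scale_def)

lemma pi_map_add:
  assumes "I \<in> intertwiners V T g1 g2 M1 M2 M3" "J \<in> intertwiners V T g1 g2 M1 M2 M3"
  shows "\<pi> (I + J) = \<pi> I + \<pi> J"
proof -
  interpret f: vector_space "fun_scale (mscale M3)"
    by (rule vector_space_fun_scale[OF m3.vector_space])
  interpret i: vector_space "intertwiner_scale (mscale M3)"
    by (rule vector_space_intertwiner_scale[OF m3.vector_space])
  show ?thesis using pi_map_add_scale[OF assms, of 1] by simp
qed

lemma pi_map_scale: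
  assumes "I \<in> intertwiners V T g1 g2 M1 M2 M3"
  shows "\<pi> (intertwiner_scale (mscale M3) c I) = fun_scale (mscale M3) c (\<pi> I)"
  \<comment> \<open>Taking I = 0 leaves a summand \<pi> 0, which is 0 because \<pi> (0 + 0) = \<pi>
    0 + \<pi> 0.\<close>
  using pi_map_add[OF intertwiners_0 intertwiners_0] pi_map_add_scale[OF intertwiners_0 assms, of c]
  by simp

text \<open>The values of \<pi> I on pure tensors recover o_I on M2(0), so equal images reduce the
  claim to \<open>o_int_injective\<close>.\<close>

lemma pi_map_inj:
  assumes "irreducible_module M3"
  shows "inj_on \<pi> (intertwiners V T g1 g2 M1 M2 M3)"
proof (rule inj_onI)
  fix I J assume IJ: "I \<in> intertwiners V T g1 g2 M1 M2 M3" "J \<in> intertwiners V T g1 g2 M1 M2 M3"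
    and eq: "\<pi> I = \<pi> J"
  show "I = J"
    by (rule o_int_injective[OF IJ assms])
      (simp add: pi_map_in_H(2)[OF IJ(1), symmetric] pi_map_in_H(2)[OF IJ(2), symmetric] eq)
qed

lemma vdim_intertwiners_le:
  assumes "irreducible_module M3"
  shows "vdim (intertwiner_scale (mscale M3)) (intertwiners V T g1 g2 M1 M2 M3)
    \<le>o vdim (fun_scale (mscale M3)) H"
  by (rule vdim_le_if_injective[OF vector_space_intertwiner_scale[OF m3.vector_space]
        vector_space_fun_scale[OF m3.vector_space] intertwiners_subspace tensor_hom_subspace
        pi_map_in_H(1) pi_map_add pi_map_scale pi_map_inj[OF assms]])

end

theorem theorem3p13:
  fixes V :: "'v::ab_group_add voa" and T :: nat
    and g1 g2 g3 :: "'v \<Rightarrow> 'v"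
    and M1 :: "('v, 'a::ab_group_add) vmod"
    and M2 :: "('v, 'b::ab_group_add) vmod"
    and M3 :: "('v, 'c::ab_group_add) vmod"
    and h1 h2 h3 :: complex
  assumes "vertex_operator_algebra V"
    and "T \<ge> 1"
    and "voa_automorphism V g1" "voa_automorphism V g2" "voa_automorphism V g3"
    and "g1 \<circ> g2 = g2 \<circ> g1" "g1 \<circ> g3 = g3 \<circ> g1" "g2 \<circ> g3 = g3 \<circ> g2"
    and "g1 ^^ T = id" "g2 ^^ T = id" "g3 ^^ T = id"
    and "g3 = g1 \<circ> g2"
    and "twisted_module V T g1 M1" "twisted_module V T g2 M2" "twisted_module V T g3 M3"
    and "standing V T M1 h1" "standing V T M2 h2" "standing V T M3 h3"
    and "irreducible_module M3"
  shows "let \<V> = intertwiners V T g1 g2 M1 M2 M3;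
             H = tensor_hom V T g1 g2 M1 M2 M3 h2 h3;
             \<pi> = pi_map V T g1 g2 M1 M2 M3 h1 h2 h3;
             sV = intertwiner_scale (mscale M3);
             sH = fun_scale (mscale M3)
         in (\<forall>I\<in>\<V>. \<pi> I \<in> H \<and>
               (\<forall>w1. \<forall>w2\<in>mdeg V T M2 h2 0.
                  \<pi> I (pure_tensor V T g1 g2 M1 M2 h2 (cls_b V T g1 g2 M1 w1) w2)
                  = o_int V T M1 h1 h2 h3 I w1 w2)) \<and>
            (\<forall>I\<in>\<V>. \<forall>J\<in>\<V>. \<pi> (I + J) = \<pi> I + \<pi> J) \<and>
            (\<forall>c. \<forall>I\<in>\<V>. \<pi> (sV c I) = sH c (\<pi> I)) \<and>
            inj_on \<pi> \<V> \<and>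
            vdim sV \<V> \<le>o vdim sH H"
proof -
  have aut: "finite_order_automorphism V T g1" "finite_order_automorphism V T g2"
    "finite_order_automorphism V T g3"
    using assms by (auto simp: finite_order_automorphism_def finite_order_automorphism_axioms_def)
  have "graded_twisted_module V T g1 M1 h1" "graded_twisted_module V T g2 M2 h2"
    "graded_twisted_module V T (g1 \<circ> g2) M3 h3"
    using assms aut by (auto simp: graded_twisted_module_def graded_twisted_module_axioms_def)
  then interpret intertwining_setting V T g1 g2 M1 M2 M3 h1 h2 h3
    using assms(6) by (simp add: intertwining_setting_def intertwining_setting_axioms_def)
  show ?thesis
    unfolding Let_def
    using assms(19)
    by (intro conjI ballI allI pi_map_in_H pi_map_add pi_map_scale pi_map_inj vdim_intertwiners_le)
qed

end
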